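(* There is a contravariant functor $\alpha$ from the category $MV_p$ to the category $SIC$, injective on objects, and surjective on objects up to isomorphism.
   Context: An ideal of an MV-algebra $(A,\oplus,0,\neg)$ is a nonempty downward closed subset closed under $\oplus$. $MV_p$ is the category of presented MV-algebras: objects are pairs $(F,I)$ where $F$ is a freely generated MV-algebra (an algebra $\mathrm{Free}(k)$ of McNaughton functions $[0,1]^k\to[0,1]$, for $k$ a cardinal) and $I$ is an ideal of $F$; a morphism $(F,I)\to(G,J)$ is an MV-algebra homomorphism sending $F$ to $G$ and $I$ to $J$ (i.e. $I$ into $J$). A topological space is spectral if it is sober (every irreducible closed set is the closure of a unique singleton), compact, and its compact open subsets form a basis of the topology closed under intersections of any two members. A spectral map is a map between spectral spaces such that inverse images of compact open sets are compact open. For a finite set $Y$, a rational polyhedron in $[0,1]^Y$ is a finite union of rational simplexes (convex envelopes of finitely many affinely independent rational points); a cylinder rational polyhedron of $[0,1]^k$ is a set $\{f\in[0,1]^k : f|_Y\in P_0\}$ with $Y\subseteq k$ finite and $P_0\subseteq[0,1]^Y$ a rational polyhedron; $\mathrm{Cypol}(k)$ is the lattice of these sets under inclusion. A space $X$ is cylinder based if it is spectral and its lattice of compact open sets is anti-isomorphic to $\mathrm{Cypol}(k)$ for some cardinal $k$, possibly infinite. $SIC$ ("spectra in context") is the category whose objects are triples $(X,C,m)$ where $X$ is a cylinder based topological space, $C$ is a spectral space, and $m:C\to X$ is a monomorphic spectral map preserving closed sets (images of closed sets are closed). A morphism from $(X,C,m)$ to $(Y,D,n)$ is a pair of spectral maps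 $s:X\to Y$, $t:C\to D$ making the corresponding square commute: $s\circ m=n\circ t$. "Surjective on objects up to isomorphism" means every object of $SIC$ is isomorphic to one of the form $\alpha(F,I)$. *)

theory Defs
  imports "HOL-Analysis.Analysis"
begin

section \<open>Categories and contravariant functors\<close>

text \<open>
  Only arrows \<open>f \<in> Hom C A B\<close> between objects \<open>A, B \<in> Obj C\<close> matter; \<open>Comp C A B D g f\<close> is the
  composite of \<open>f \<in> Hom C A B\<close> with \<open>g \<in> Hom C B D\<close>.
\<close>

record ('o, 'm) cat =
  Obj :: "'o set"
  Hom :: "'o \<Rightarrow> 'o \<Rightarrow> 'm set"
  Id :: "'o \<Rightarrow> 'm"
  Comp :: "'o \<Rightarrow> 'o \<Rightarrow> 'o \<Rightarrow> 'm \<Rightarrow> 'm \<Rightarrow> 'm"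

definition category :: "('o, 'm) cat \<Rightarrow> bool" where
  "category C \<longleftrightarrow>
     (\<forall>A\<in>Obj C. Id C A \<in> Hom C A A) \<and>
     (\<forall>A\<in>Obj C. \<forall>B\<in>Obj C. \<forall>D\<in>Obj C. \<forall>f\<in>Hom C A B. \<forall>g\<in>Hom C B D. Comp C A B D g f \<in> Hom C A D) \<and>
     (\<forall>A\<in>Obj C. \<forall>B\<in>Obj C. \<forall>f\<in>Hom C A B.
        Comp C A A B f (Id C A) = f \<and> Comp C A B B (Id C B) f = f) \<and>
     (\<forall>A\<in>Obj C. \<forall>B\<in>Obj C. \<forall>D\<in>Obj C. \<forall>E\<in>Obj C. \<forall>f\<in>Hom C A B. \<forall>g\<in>Hom C B D. \<forall>h\<in>Hom C D E.
        Comp C A D E h (Comp C A B D g f) = Comp C A B E (Comp C B D E h g) f)"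

definition monomorphism :: "('o, 'm) cat \<Rightarrow> 'o \<Rightarrow> 'o \<Rightarrow> 'm \<Rightarrow> bool" where
  "monomorphism C A B m \<longleftrightarrow> m \<in> Hom C A B \<and>
     (\<forall>Z\<in>Obj C. \<forall>g\<in>Hom C Z A. \<forall>h\<in>Hom C Z A. Comp C Z A B m g = Comp C Z A B m h \<longrightarrow> g = h)"

definition isomorphic_in :: "('o, 'm) cat \<Rightarrow> 'o \<Rightarrow> 'o \<Rightarrow> bool" where
  "isomorphic_in C A B \<longleftrightarrow>
     (\<exists>f\<in>Hom C A B. \<exists>g\<in>Hom C B A. Comp C A B A g f = Id C A \<and> Comp C B A B f g = Id C B)"

definition contravariant_functor ::
  "('o, 'm) cat \<Rightarrow> ('p, 'n) cat \<Rightarrow> ('o \<Rightarrow> 'p) \<Rightarrow> ('o \<Rightarrow> 'o \<Rightarrow> 'm \<Rightarrow> 'n) \<Rightarrow> bool" where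
  "contravariant_functor C D Fo Fm \<longleftrightarrow> category C \<and> category D \<and>
     (\<forall>A\<in>Obj C. Fo A \<in> Obj D) \<and>
     (\<forall>A\<in>Obj C. \<forall>B\<in>Obj C. \<forall>f\<in>Hom C A B. Fm A B f \<in> Hom D (Fo B) (Fo A)) \<and>
     (\<forall>A\<in>Obj C. Fm A A (Id C A) = Id D (Fo A)) \<and>
     (\<forall>A\<in>Obj C. \<forall>B\<in>Obj C. \<forall>E\<in>Obj C. \<forall>f\<in>Hom C A B. \<forall>g\<in>Hom C B E.
        Fm A E (Comp C A B E g f) = Comp D (Fo E) (Fo B) (Fo A) (Fm A B f) (Fm B E g))"


section \<open>Cardinals\<close>

text \<open>
  The type \<open>'u\<close> carries the minimal well-order \<open>card_of UNIV\<close>.  The cardinals up to \<open>|'u|\<close> are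
  rendered as initial ordinals in the sense of von Neumann: initial segments of this well-order
  that are strictly larger in size than each of their proper initial segments.  Every subset of
  \<open>'u\<close> is equipollent to exactly one of them, see \<open>is_cardinal_unique_representative\<close> below.
\<close>

definition is_cardinal :: "'u set \<Rightarrow> bool" where
  "is_cardinal K \<longleftrightarrow> ofilter (card_of (UNIV :: 'u set)) K \<and>
     (\<forall>a\<in>K. underS (card_of (UNIV :: 'u set)) a \<prec> K)"


section \<open>MV-algebras, ideals and homomorphisms\<close>

record 'a mv =
  mv_carrier :: "'a set"
  mv_plus :: "'a \<Rightarrow> 'a \<Rightarrow> 'a"
  mv_zero :: "'a"
  mv_neg :: "'a \<Rightarrow> 'a"

definition mv_algebra :: "'a mv \<Rightarrow> bool" where
  "mv_algebra A \<longleftrightarrow>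
     mv_zero A \<in> mv_carrier A \<and>
     (\<forall>x\<in>mv_carrier A. mv_neg A x \<in> mv_carrier A) \<and>
     (\<forall>x\<in>mv_carrier A. \<forall>y\<in>mv_carrier A. mv_plus A x y \<in> mv_carrier A) \<and>
     (\<forall>x\<in>mv_carrier A. \<forall>y\<in>mv_carrier A. \<forall>z\<in>mv_carrier A.
        mv_plus A (mv_plus A x y) z = mv_plus A x (mv_plus A y z)) \<and>
     (\<forall>x\<in>mv_carrier A. \<forall>y\<in>mv_carrier A. mv_plus A x y = mv_plus A y x) \<and>
     (\<forall>x\<in>mv_carrier A. mv_plus A x (mv_zero A) = x) \<and>
     (\<forall>x\<in>mv_carrier A. mv_neg A (mv_neg A x) = x) \<and>
     (\<forall>x\<in>mv_carrier A. mv_plus A x (mv_neg A (mv_zero A)) = mv_neg A (mv_zero A)) \<and>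
     (\<forall>x\<in>mv_carrier A. \<forall>y\<in>mv_carrier A.
        mv_plus A (mv_neg A (mv_plus A (mv_neg A x) y)) y =
        mv_plus A (mv_neg A (mv_plus A (mv_neg A y) x)) x)"

definition mv_le :: "'a mv \<Rightarrow> 'a \<Rightarrow> 'a \<Rightarrow> bool" where
  "mv_le A x y \<longleftrightarrow> mv_plus A (mv_neg A x) y = mv_neg A (mv_zero A)"

definition mv_ideal :: "'a mv \<Rightarrow> 'a set \<Rightarrow> bool" where
  "mv_ideal A I \<longleftrightarrow> I \<subseteq> mv_carrier A \<and> I \<noteq> {} \<and>
     (\<forall>y\<in>I. \<forall>x\<in>mv_carrier A. mv_le A x y \<longrightarrow> x \<in> I) \<and>
     (\<forall>x\<in>I. \<forall>y\<in>I. mv_plus A x y \<in> I)"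

definition mv_hom :: "'a mv \<Rightarrow> 'b mv \<Rightarrow> ('a \<Rightarrow> 'b) set" where
  "mv_hom A B = {h \<in> mv_carrier A \<rightarrow>\<^sub>E mv_carrier B.
     h (mv_zero A) = mv_zero B \<and>
     (\<forall>x\<in>mv_carrier A. h (mv_neg A x) = mv_neg B (h x)) \<and>
     (\<forall>x\<in>mv_carrier A. \<forall>y\<in>mv_carrier A. h (mv_plus A x y) = mv_plus B (h x) (h y))}"


section \<open>McNaughton functions and free MV-algebras\<close>

definition cube :: "'u set \<Rightarrow> ('u \<Rightarrow> real) set" where
  "cube K = K \<rightarrow>\<^sub>E {0..1}"

text \<open>Finitely many coordinates: continuous and piecewise affine with integer coefficients.\<close>

definition fin_mcnaughton :: "'u set \<Rightarrow> (('u \<Rightarrow> real) \<Rightarrow> real) \<Rightarrow> bool" where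
  "fin_mcnaughton Y g \<longleftrightarrow>
     continuous_map (product_topology (\<lambda>_. top_of_set {0..1}) Y) (top_of_set {0..1}) g \<and>
     (\<exists>P :: (('u \<Rightarrow> int) \<times> int) set. finite P \<and>
        (\<forall>x\<in>cube Y. \<exists>(a, b)\<in>P. g x = (\<Sum>i\<in>Y. of_int (a i) * x i) + of_int b))"

text \<open>A McNaughton function on a cube of any dimension depends on finitely many coordinates only.\<close>

definition mcnaughton :: "'u set \<Rightarrow> (('u \<Rightarrow> real) \<Rightarrow> real) \<Rightarrow> bool" where
  "mcnaughton K f \<longleftrightarrow> f \<in> extensional (cube K) \<and>
     (\<exists>Y g. Y \<subseteq> K \<and> finite Y \<and> fin_mcnaughton Y g \<and> (\<forall>x\<in>cube K. f x = g (restrict x Y)))"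

definition Free :: "'u set \<Rightarrow> (('u \<Rightarrow> real) \<Rightarrow> real) mv" where
  "Free K =
     \<lparr>mv_carrier = {f. mcnaughton K f},
      mv_plus = (\<lambda>f g. \<lambda>x\<in>cube K. min 1 (f x + g x)),
      mv_zero = (\<lambda>x\<in>cube K. 0),
      mv_neg = (\<lambda>f. \<lambda>x\<in>cube K. 1 - f x)\<rparr>"


section \<open>Presented MV-algebras\<close>

type_synonym 'a presented = "'a mv \<times> 'a set"

definition MVp ::
  "((('u \<Rightarrow> real) \<Rightarrow> real) presented, (('u \<Rightarrow> real) \<Rightarrow> real) \<Rightarrow> (('u \<Rightarrow> real) \<Rightarrow> real)) cat" where
  "MVp =
     \<lparr>Obj = {(F, I). (\<exists>K. is_cardinal K \<and> F = Free K) \<and> mv_ideal F I},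
      Hom = (\<lambda>(F, I) (G, J). {h \<in> mv_hom F G. h ` I \<subseteq> J}),
      Id = (\<lambda>(F, I). \<lambda>x\<in>mv_carrier F. x),
      Comp = (\<lambda>(F, I) (G, J) (H, L) g f. compose (mv_carrier F) g f)\<rparr>"


section \<open>Spectral spaces\<close>

definition compact_openin :: "'p topology \<Rightarrow> 'p set \<Rightarrow> bool" where
  "compact_openin X U \<longleftrightarrow> openin X U \<and> compactin X U"

definition irreducible_closedin :: "'p topology \<Rightarrow> 'p set \<Rightarrow> bool" where
  "irreducible_closedin X S \<longleftrightarrow> closedin X S \<and> S \<noteq> {} \<and>
     (\<forall>A B. closedin X A \<and> closedin X B \<and> S = A \<union> B \<longrightarrow> S = A \<or> S = B)"

definition sober_space :: "'p topology \<Rightarrow> bool" where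
  "sober_space X \<longleftrightarrow>
     (\<forall>S. irreducible_closedin X S \<longrightarrow> (\<exists>!x. x \<in> topspace X \<and> S = X closure_of {x}))"

definition spectral_space :: "'p topology \<Rightarrow> bool" where
  "spectral_space X \<longleftrightarrow> sober_space X \<and> compact_space X \<and>
     openin X = arbitrary union_of (compact_openin X) \<and>
     (\<forall>U V. compact_openin X U \<and> compact_openin X V \<longrightarrow> compact_openin X (U \<inter> V))"

definition spectral_map :: "'p topology \<Rightarrow> 'q topology \<Rightarrow> ('p \<Rightarrow> 'q) set" where
  "spectral_map X Y = {f \<in> topspace X \<rightarrow>\<^sub>E topspace Y.
     \<forall>U. compact_openin Y U \<longrightarrow> compact_openin X {x \<in> topspace X. f x \<in> U}}"

definition Spectral :: "('p topology, 'p \<Rightarrow> 'p) cat" where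
  "Spectral =
     \<lparr>Obj = {X. spectral_space X},
      Hom = spectral_map,
      Id = (\<lambda>X. \<lambda>x\<in>topspace X. x),
      Comp = (\<lambda>X Y Z g f. compose (topspace X) g f)\<rparr>"


section \<open>Cylinder rational polyhedra\<close>

text \<open>Affine independence and convex hulls are spelled out coordinatewise, since the function
  type of points of \<open>[0,1]\<close>-cubes is not an instance of the class of real vector spaces.\<close>

definition affinely_independent :: "'u set \<Rightarrow> ('u \<Rightarrow> real) set \<Rightarrow> bool" where
  "affinely_independent Y V \<longleftrightarrow>
     (\<forall>w. (\<Sum>v\<in>V. w v) = (0::real) \<and> (\<forall>i\<in>Y. (\<Sum>v\<in>V. w v * v i) = 0) \<longrightarrow> (\<forall>v\<in>V. w v = 0))"

definition convex_envelope :: "'u set \<Rightarrow> ('u \<Rightarrow> real) set \<Rightarrow> ('u \<Rightarrow> real) set" where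
  "convex_envelope Y V =
     {x \<in> extensional Y. \<exists>w. (\<forall>v\<in>V. (0::real) \<le> w v) \<and> (\<Sum>v\<in>V. w v) = 1 \<and>
        (\<forall>i\<in>Y. x i = (\<Sum>v\<in>V. w v * v i))}"

definition rational_simplex :: "'u set \<Rightarrow> ('u \<Rightarrow> real) set \<Rightarrow> bool" where
  "rational_simplex Y S \<longleftrightarrow>
     (\<exists>V. finite V \<and> V \<subseteq> cube Y \<and> (\<forall>v\<in>V. \<forall>i\<in>Y. v i \<in> \<rat>) \<and> affinely_independent Y V \<and>
          S = convex_envelope Y V)"

definition rational_polyhedron :: "'u set \<Rightarrow> ('u \<Rightarrow> real) set \<Rightarrow> bool" where
  "rational_polyhedron Y P \<longleftrightarrow>
     (\<exists>\<S>. finite \<S> \<and> (\<forall>S\<in>\<S>. rational_simplex Y S) \<and> P = \<Union>\<S>)"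

definition Cypol :: "'u set \<Rightarrow> ('u \<Rightarrow> real) set set" where
  "Cypol K = {{f \<in> cube K. restrict f Y \<in> P} | Y P. Y \<subseteq> K \<and> finite Y \<and> rational_polyhedron Y P}"

text \<open>An anti-isomorphism of lattices of sets is a bijection reversing inclusion both ways.\<close>

definition anti_isomorphic :: "'a set set \<Rightarrow> 'b set set \<Rightarrow> bool" where
  "anti_isomorphic L M \<longleftrightarrow>
     (\<exists>\<phi>. bij_betw \<phi> L M \<and> (\<forall>U\<in>L. \<forall>V\<in>L. U \<subseteq> V \<longleftrightarrow> \<phi> V \<subseteq> \<phi> U))"

text \<open>The \<open>itself\<close> argument fixes the type whose cardinals may serve as exponents.\<close>

definition cylinder_based :: "'u itself \<Rightarrow> 'p topology \<Rightarrow> bool" where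
  "cylinder_based (_ :: 'u itself) X \<longleftrightarrow> spectral_space X \<and>
     (\<exists>K :: 'u set. is_cardinal K \<and> anti_isomorphic {U. compact_openin X U} (Cypol K))"


section \<open>Spectra in context\<close>

text \<open>
  All spaces have their points in one type \<open>'p\<close>, so that \<open>Spectral\<close> and \<open>SIC\<close> are categories
  relative to that universe, just as \<open>MVp\<close> and \<open>SIC\<close> are relative to the cardinals up to \<open>|'u|\<close>.
\<close>

type_synonym 'p in_context = "'p topology \<times> 'p topology \<times> ('p \<Rightarrow> 'p)"

definition SIC :: "'u itself \<Rightarrow> ('p in_context, ('p \<Rightarrow> 'p) \<times> ('p \<Rightarrow> 'p)) cat" where
  "SIC u =
     \<lparr>Obj = {(X, C, m). cylinder_based u X \<and> spectral_space C \<and>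
               monomorphism Spectral C X m \<and> closed_map C X m},
      Hom = (\<lambda>(X, C, m) (Y, D, n). {(s, t). s \<in> spectral_map X Y \<and> t \<in> spectral_map C D \<and>
               compose (topspace C) s m = compose (topspace C) n t}),
      Id = (\<lambda>(X, C, m). ((\<lambda>x\<in>topspace X. x), (\<lambda>c\<in>topspace C. c))),
      Comp = (\<lambda>(X, C, m) (Y, D, n) (Z, E, l) (s', t') (s, t).
               (compose (topspace X) s' s, compose (topspace C) t' t))\<rparr>"

section \<open>Basic facts\<close>

lemma is_cardinal_unique_representative:
  fixes A :: "'u set"
  shows "\<exists>!K :: 'u set. is_cardinal K \<and> K \<approx> A"
proof -
  define r where "r = card_of (UNIV :: 'u set)"
  have wr: "Well_order r" unfolding r_def by (rule card_of_Well_order)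
  have fr: "Field r = UNIV" unfolding r_def by (rule Field_card_of)
  have wo: "wo_rel r" using wr by (simp add: wo_rel_def)
  have ex: "\<exists>K :: 'u set. is_cardinal K \<and> K \<approx> A"
  proof -
    have "(card_of A, r) \<in> ordLeq" unfolding r_def by (rule card_of_mono1) simp
    then obtain f where f: "embed (card_of A) r f" by (auto simp: ordLeq_def)
    have inj: "inj_on f A"
      using embed_inj_on[OF card_of_Well_order f] by (simp add: Field_card_of)
    have eq: "f ` A \<approx> A"
      using inj by (simp add: inj_on_image_eqpoll_self)
    have "ofilter r (f ` A)"
      using embed_Field_ofilter[OF card_of_Well_order wr f] by (simp add: Field_card_of)
    moreover have "underS r (f a) \<prec> f ` A" if "a \<in> A" for a
    proof -
      have b: "bij_betw f (underS (card_of A) a) (underS r (f a))"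
        using embed_underS[OF card_of_Well_order f] that by (simp add: Field_card_of)
      have "(card_of (underS (card_of A) a), card_of A) \<in> ordLess"
        using card_of_underS[OF card_of_Card_order] that by (simp add: Field_card_of)
      then have "\<not> (card_of A, card_of (underS (card_of A) a)) \<in> ordLeq"
        by (rule not_ordLess_ordLeq)
      then have "\<not> A \<lesssim> underS (card_of A) a"
        by (simp add: lepoll_def card_of_ordLeq[symmetric])
      moreover have "underS (card_of A) a \<subseteq> A"
        using underS_Field[of _ "card_of A" a] by (auto simp: Field_card_of)
      ultimately have "underS (card_of A) a \<prec> A"
        by (simp add: lesspoll_def subset_imp_lepoll eqpoll_imp_lepoll eqpoll_sym
            lesspoll_def) (meson eqpoll_imp_lepoll eqpoll_sym)
      moreover have "underS r (f a) \<approx> underS (card_of A) a"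
        using b eqpoll_def eqpoll_sym by blast
      ultimately show ?thesis
        using eq eqpoll_sym lesspoll_eq_trans eq_lesspoll_trans by blast
    qed
    ultimately have "is_cardinal (f ` A)" by (auto simp: is_cardinal_def r_def)
    then show ?thesis using eq by blast
  qed
  have sub: "K \<subseteq> L" if K: "is_cardinal K" and L: "is_cardinal L" and e: "K \<approx> L" for K L :: "'u set"
  proof (rule ccontr)
    assume n: "\<not> K \<subseteq> L"
    have oK: "ofilter r K" and oL: "ofilter r L" using K L by (auto simp: is_cardinal_def r_def)
    then have "L \<subset> K" using wo_rel.ofilter_linord[OF wo oK oL] n by auto
    then have "L \<noteq> Field r" using fr by auto
    then obtain a where a: "L = underS r a"
      using oL wo_rel.ofilter_underS_Field[OF wo] by blast
    obtain b where b: "b \<in> K" "b \<notin> L" using n by blast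
    have "(a, b) \<in> r"
      using b(2) a wo_rel.TOTALS[OF wo] fr wo_rel.REFL[OF wo]
      by (auto simp: underS_def refl_on_def)
    then have "a \<in> K" using oK b(1) by (auto simp: ofilter_def under_def)
    then have "L \<prec> K" using K a by (auto simp: is_cardinal_def r_def)
    then show False using e by (metis eqpoll_sym lesspoll_def)
  qed
  show ?thesis
  proof (rule ex_ex1I[OF ex])
    fix K L :: "'u set"
    assume "is_cardinal K \<and> K \<approx> A" "is_cardinal L \<and> L \<approx> A"
    then show "K = L" by (meson sub eqpoll_sym eqpoll_trans subset_antisym)
  qed
qed

lemma restrict_cube: "x \<in> cube K \<Longrightarrow> Y \<subseteq> K \<Longrightarrow> restrict x Y \<in> cube Y"
  by (auto simp: cube_def PiE_iff)

lemma fin_mcnaughton_range: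
  assumes "fin_mcnaughton Y g" "x \<in> cube Y"
  shows "g x \<in> {0..1}"
proof -
  have "g \<in> topspace (product_topology (\<lambda>_. top_of_set {0..1::real}) Y)
          \<rightarrow> topspace (top_of_set {0..1::real})"
    using assms(1) by (simp only: fin_mcnaughton_def continuous_map_def)
  then show ?thesis using assms(2) by (simp add: cube_def Pi_iff)
qed

lemma fin_mcnaughton_lift:
  assumes g: "fin_mcnaughton Y g" and Y: "Y \<subseteq> Z" and Z: "finite Z"
  shows "fin_mcnaughton Z (\<lambda>x. g (restrict x Y))"
proof -
  have "continuous_map (product_topology (\<lambda>_. top_of_set {0..1}) Z) (top_of_set {0..1::real})
          (g \<circ> (\<lambda>x. restrict x Y))"
    using g Y by (intro continuous_map_compose[OF continuous_on_restrict])
      (auto simp: fin_mcnaughton_def)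
  moreover obtain P :: "(('a \<Rightarrow> int) \<times> int) set" where P: "finite P"
    "\<forall>x\<in>cube Y. \<exists>(a, b)\<in>P. g x = (\<Sum>i\<in>Y. of_int (a i) * x i) + of_int b"
    using g by (auto simp: fin_mcnaughton_def)
  define Q where "Q = (\<lambda>(a, b). (\<lambda>i. if i \<in> Y then a i else 0, b)) ` P"
  have "\<exists>(a, b)\<in>Q. g (restrict x Y) = (\<Sum>i\<in>Z. of_int (a i) * x i) + of_int b" if x: "x \<in> cube Z" for x
  proof -
    obtain a b where ab: "(a, b) \<in> P"
      "g (restrict x Y) = (\<Sum>i\<in>Y. of_int (a i) * restrict x Y i) + of_int b"
      using P(2) restrict_cube[OF x Y] by blast
    have "(\<Sum>i\<in>Y. of_int (a i) * restrict x Y i) = (\<Sum>i\<in>Z. of_int (if i \<in> Y then a i else 0) * x i)"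
      by (rule sum.mono_neutral_cong_left) (use Y Z in auto)
    then show ?thesis using ab by (force simp: Q_def)
  qed
  moreover have "finite Q" using P by (simp add: Q_def)
  ultimately show ?thesis unfolding fin_mcnaughton_def comp_def by blast
qed

lemma mcnaughton_range: "mcnaughton K f \<Longrightarrow> x \<in> cube K \<Longrightarrow> f x \<in> {0..1}"
proof -
  assume f: "mcnaughton K f" and x: "x \<in> cube K"
  then obtain Y g where "Y \<subseteq> K" "fin_mcnaughton Y g" "f x = g (restrict x Y)"
    unfolding mcnaughton_def by blast
  then show "f x \<in> {0..1}" using fin_mcnaughton_range[of Y g] restrict_cube[OF x] by simp
qed

lemma mcnaughton_zero: "mcnaughton K (\<lambda>x\<in>cube K. 0)"
proof -
  have "fin_mcnaughton {} (\<lambda>_. 0 :: real)"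
    unfolding fin_mcnaughton_def by (auto intro!: exI[of _ "{(\<lambda>_. 0, 0)}"])
  then show ?thesis unfolding mcnaughton_def by (auto intro!: exI[of _ "{}"])
qed

lemma mcnaughton_neg:
  assumes "mcnaughton K f"
  shows "mcnaughton K (\<lambda>x\<in>cube K. 1 - f x)"
proof -
  obtain Y g where Y: "Y \<subseteq> K" "finite Y" "fin_mcnaughton Y g" "\<forall>x\<in>cube K. f x = g (restrict x Y)"
    using assms by (auto simp: mcnaughton_def)
  obtain P :: "(('a \<Rightarrow> int) \<times> int) set" where P: "finite P"
    "\<forall>x\<in>cube Y. \<exists>(a, b)\<in>P. g x = (\<Sum>i\<in>Y. of_int (a i) * x i) + of_int b"
    using Y(3) by (auto simp: fin_mcnaughton_def)
  define Q where "Q = (\<lambda>(a, b). (\<lambda>i. - a i, 1 - b)) ` P"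
  have "\<exists>(a, b)\<in>Q. 1 - g x = (\<Sum>i\<in>Y. of_int (a i) * x i) + of_int b" if x: "x \<in> cube Y" for x
  proof -
    obtain a b where "(a, b) \<in> P" "g x = (\<Sum>i\<in>Y. of_int (a i) * x i) + of_int b"
      using P(2) x by blast
    then show ?thesis by (force simp: Q_def sum_negf)
  qed
  moreover have "finite Q" using P by (simp add: Q_def)
  moreover have "continuous_map (product_topology (\<lambda>_. top_of_set {0..1}) Y) (top_of_set {0..1}) (\<lambda>x. 1 - g x)"
    using Y(3) by (auto simp: fin_mcnaughton_def continuous_map_in_subtopology image_subset_iff Pi_iff
        intro!: continuous_map_diff)
  ultimately have "fin_mcnaughton Y (\<lambda>x. 1 - g x)" unfolding fin_mcnaughton_def by blast
  then show ?thesis using Y unfolding mcnaughton_def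
    by (intro conjI exI[of _ Y] exI[of _ "\<lambda>x. 1 - g x"]) auto
qed

lemma mcnaughton_plus:
  assumes "mcnaughton K f" "mcnaughton K f'"
  shows "mcnaughton K (\<lambda>x\<in>cube K. min 1 (f x + f' x))"
proof -
  obtain Y1 g1 where Y1: "Y1 \<subseteq> K" "finite Y1" "fin_mcnaughton Y1 g1" "\<forall>x\<in>cube K. f x = g1 (restrict x Y1)"
    using assms by (auto simp: mcnaughton_def)
  obtain Y2 g2 where Y2: "Y2 \<subseteq> K" "finite Y2" "fin_mcnaughton Y2 g2" "\<forall>x\<in>cube K. f' x = g2 (restrict x Y2)"
    using assms by (auto simp: mcnaughton_def)
  define Y where "Y = Y1 \<union> Y2"
  have Y: "Y1 \<subseteq> Y" "Y2 \<subseteq> Y" "finite Y" "Y \<subseteq> K" using Y1 Y2 by (auto simp: Y_def)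
  define h1 where "h1 = (\<lambda>x. g1 (restrict x Y1))"
  define h2 where "h2 = (\<lambda>x. g2 (restrict x Y2))"
  have h: "fin_mcnaughton Y h1" "fin_mcnaughton Y h2"
    unfolding h1_def h2_def using fin_mcnaughton_lift Y Y1 Y2 by blast+
  obtain P1 :: "(('a \<Rightarrow> int) \<times> int) set" where P1: "finite P1"
    "\<forall>x\<in>cube Y. \<exists>(a, b)\<in>P1. h1 x = (\<Sum>i\<in>Y. of_int (a i) * x i) + of_int b"
    using h(1) by (auto simp: fin_mcnaughton_def)
  obtain P2 :: "(('a \<Rightarrow> int) \<times> int) set" where P2: "finite P2"
    "\<forall>x\<in>cube Y. \<exists>(a, b)\<in>P2. h2 x = (\<Sum>i\<in>Y. of_int (a i) * x i) + of_int b"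
    using h(2) by (auto simp: fin_mcnaughton_def)
  define Q where "Q = insert (\<lambda>_. 0, 1) ((\<lambda>((a, b), (c, d)). (\<lambda>i. a i + c i, b + d)) ` (P1 \<times> P2))"
  have "\<exists>(a, b)\<in>Q. min 1 (h1 x + h2 x) = (\<Sum>i\<in>Y. of_int (a i) * x i) + of_int b" if x: "x \<in> cube Y" for x
  proof -
    obtain a b where ab: "(a, b) \<in> P1" "h1 x = (\<Sum>i\<in>Y. of_int (a i) * x i) + of_int b"
      using P1(2) x by blast
    obtain c d where cd: "(c, d) \<in> P2" "h2 x = (\<Sum>i\<in>Y. of_int (c i) * x i) + of_int d"
      using P2(2) x by blast
    show ?thesis
    proof (cases "h1 x + h2 x \<le> 1")
      case True
      have "(\<lambda>i. a i + c i, b + d) \<in> Q" using ab cd by (force simp: Q_def)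
      moreover have "min 1 (h1 x + h2 x) = (\<Sum>i\<in>Y. of_int (a i + c i) * x i) + of_int (b + d)"
        using True ab cd by (simp add: distrib_right sum.distrib)
      ultimately show ?thesis by (intro bexI[rotated]) auto
    next
      case False
      then show ?thesis by (intro bexI[of _ "(\<lambda>_. 0, 1)"]) (auto simp: Q_def)
    qed
  qed
  moreover have "finite Q" using P1 P2 by (simp add: Q_def)
  moreover have "continuous_map (product_topology (\<lambda>_. top_of_set {0..1}) Y) (top_of_set {0..1})
      (\<lambda>x. min 1 (h1 x + h2 x))"
    using h by (auto simp: fin_mcnaughton_def continuous_map_in_subtopology image_subset_iff Pi_iff
        intro!: continuous_map_add continuous_map_real_min)
  ultimately have "fin_mcnaughton Y (\<lambda>x. min 1 (h1 x + h2 x))" unfolding fin_mcnaughton_def by blast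
  moreover have "restrict (restrict x Y) Y1 = restrict x Y1" "restrict (restrict x Y) Y2 = restrict x Y2"
    for x :: "'a \<Rightarrow> real" using Y by (auto simp: Int_absorb1)
  ultimately show ?thesis using Y Y1 Y2 unfolding mcnaughton_def
    by (intro conjI exI[of _ Y] exI[of _ "\<lambda>x. min 1 (h1 x + h2 x)"]) (auto simp: h1_def h2_def)
qed

lemma mcnaughton_extensional: "mcnaughton K f \<Longrightarrow> f \<in> extensional (cube K)"
  by (simp only: mcnaughton_def)

lemma luk_commute:
  fixes a b :: real
  assumes "0 \<le> a \<and> a \<le> 1" "0 \<le> b \<and> b \<le> 1"
  shows "min 1 (1 - min 1 (1 - a + b) + b) = min 1 (1 - min 1 (1 - b + a) + a)"
  using assms by (auto simp: min_def)

lemma luk_assoc: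
  fixes a b c :: real
  assumes "0 \<le> a \<and> a \<le> 1" "0 \<le> c \<and> c \<le> 1"
  shows "min 1 (min 1 (a + b) + c) = min 1 (a + min 1 (b + c))"
  using assms by (auto simp: min_def)

lemma mv_algebra_Free: "mv_algebra (Free K)"
  unfolding mv_algebra_def
proof (intro conjI ballI)
  show "mv_zero (Free K) \<in> mv_carrier (Free K)"
    by (simp add: Free_def mcnaughton_zero)
next
  fix f assume "f \<in> mv_carrier (Free K)"
  then have f: "mcnaughton K f" by (simp add: Free_def)
  have b: "0 \<le> f x \<and> f x \<le> 1" if "x \<in> cube K" for x
    using mcnaughton_range[OF f that] by simp
  have u: "f x = undefined" if "x \<notin> cube K" for x
    by (rule extensional_arb[OF mcnaughton_extensional[OF f] that])
  show "mv_neg (Free K) f \<in> mv_carrier (Free K)"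
    by (simp add: Free_def mcnaughton_neg f)
  show "mv_plus (Free K) f (mv_zero (Free K)) = f"
    by (simp add: Free_def fun_eq_iff restrict_def b u)
  show "mv_neg (Free K) (mv_neg (Free K) f) = f"
    by (simp add: Free_def fun_eq_iff restrict_def u)
  show "mv_plus (Free K) f (mv_neg (Free K) (mv_zero (Free K))) = mv_neg (Free K) (mv_zero (Free K))"
    by (simp add: Free_def fun_eq_iff restrict_def b)
  fix g assume "g \<in> mv_carrier (Free K)"
  then have g: "mcnaughton K g" by (simp add: Free_def)
  have b': "0 \<le> g x \<and> g x \<le> 1" if "x \<in> cube K" for x
    using mcnaughton_range[OF g that] by simp
  show "mv_plus (Free K) f g \<in> mv_carrier (Free K)"
    by (simp add: Free_def mcnaughton_plus f g)
  show "mv_plus (Free K) f g = mv_plus (Free K) g f"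
    by (simp add: Free_def fun_eq_iff restrict_def add.commute)
  have "min 1 (1 - min 1 (1 - f x + g x) + g x) = min 1 (1 - min 1 (1 - g x + f x) + f x)"
    if "x \<in> cube K" for x
    by (rule luk_commute[OF b[OF that] b'[OF that]])
  then show "mv_plus (Free K) (mv_neg (Free K) (mv_plus (Free K) (mv_neg (Free K) f) g)) g =
      mv_plus (Free K) (mv_neg (Free K) (mv_plus (Free K) (mv_neg (Free K) g) f)) f"
    by (simp add: Free_def fun_eq_iff restrict_def)
  fix h assume "h \<in> mv_carrier (Free K)"
  then have h: "mcnaughton K h" by (simp add: Free_def)
  have "min 1 (min 1 (f x + g x) + h x) = min 1 (f x + min 1 (g x + h x))" if "x \<in> cube K" for x
    by (rule luk_assoc[OF b[OF that]]) (use mcnaughton_range[OF h that] in simp)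
  then show "mv_plus (Free K) (mv_plus (Free K) f g) h = mv_plus (Free K) f (mv_plus (Free K) g h)"
    by (simp add: Free_def fun_eq_iff restrict_def)
qed

lemma compose_extensional_id:
  assumes "f \<in> A \<rightarrow>\<^sub>E B"
  shows "compose A f (\<lambda>x\<in>A. x) = f" "compose A (\<lambda>x\<in>B. x) f = f"
  using assms by (auto simp: compose_def fun_eq_iff PiE_def extensional_def Pi_def)

lemma mv_algebra_MVp: "(F, I) \<in> Obj MVp \<Longrightarrow> mv_algebra F"
  by (auto simp: MVp_def mv_algebra_Free)

lemma category_MVp: "category MVp"
  unfolding category_def
proof (intro conjI ballI; clarify)
  fix F I assume "(F, I) \<in> Obj MVp"
  then have I: "I \<subseteq> mv_carrier F" by (auto simp: MVp_def mv_ideal_def)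
  have "mv_zero F \<in> mv_carrier F" "\<And>x. x \<in> mv_carrier F \<Longrightarrow> mv_neg F x \<in> mv_carrier F"
    "\<And>x y. x \<in> mv_carrier F \<Longrightarrow> y \<in> mv_carrier F \<Longrightarrow> mv_plus F x y \<in> mv_carrier F"
    using mv_algebra_MVp[OF \<open>(F, I) \<in> Obj MVp\<close>] by (auto simp: mv_algebra_def)
  then show "Id MVp (F, I) \<in> Hom MVp (F, I) (F, I)"
    using I by (auto simp: MVp_def mv_hom_def)
next
  fix F I G J H L f g
  assume o: "(F, I) \<in> Obj MVp" "(G, J) \<in> Obj MVp" "(H, L) \<in> Obj MVp"
    and f: "f \<in> Hom MVp (F, I) (G, J)" and g: "g \<in> Hom MVp (G, J) (H, L)"
  have "mv_zero F \<in> mv_carrier F" "\<And>x. x \<in> mv_carrier F \<Longrightarrow> mv_neg F x \<in> mv_carrier F"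
    "\<And>x y. x \<in> mv_carrier F \<Longrightarrow> y \<in> mv_carrier F \<Longrightarrow> mv_plus F x y \<in> mv_carrier F"
    using mv_algebra_MVp[OF o(1)] by (auto simp: mv_algebra_def)
  moreover have "I \<subseteq> mv_carrier F" using o by (auto simp: MVp_def mv_ideal_def)
  ultimately show "Comp MVp (F, I) (G, J) (H, L) g f \<in> Hom MVp (F, I) (H, L)"
    using f g by (auto simp: MVp_def mv_hom_def compose_def PiE_iff subset_iff image_subset_iff)
next
  fix F I G J f
  assume f: "f \<in> Hom MVp (F, I) (G, J)"
  then have f: "f \<in> mv_carrier F \<rightarrow>\<^sub>E mv_carrier G" by (auto simp: MVp_def mv_hom_def)
  show "Comp MVp (F, I) (F, I) (G, J) f (Id MVp (F, I)) = f"
    and "Comp MVp (F, I) (G, J) (G, J) (Id MVp (G, J)) f = f"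
    using compose_extensional_id[OF f] by (auto simp: MVp_def)
next
  fix F I G J H L M N f g h
  assume "f \<in> Hom MVp (F, I) (G, J)" 
  then show "Comp MVp (F, I) (H, L) (M, N) h (Comp MVp (F, I) (G, J) (H, L) g f)
           = Comp MVp (F, I) (G, J) (M, N) (Comp MVp (G, J) (H, L) (M, N) h g) f"
    by (auto simp: MVp_def mv_hom_def compose_def fun_eq_iff PiE_iff)
qed

lemma spectral_map_compose:
  assumes "f \<in> spectral_map X Y" "g \<in> spectral_map Y Z"
  shows "compose (topspace X) g f \<in> spectral_map X Z"
proof -
  have "{x \<in> topspace X. compose (topspace X) g f x \<in> U}
      = {x \<in> topspace X. f x \<in> {y \<in> topspace Y. g y \<in> U}}" for U
    using assms by (auto simp: spectral_map_def compose_def PiE_iff)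
  then show ?thesis using assms by (auto simp: spectral_map_def compose_def PiE_iff)
qed

lemma spectral_map_id: "(\<lambda>x\<in>topspace X. x) \<in> spectral_map X X"
proof -
  have "{x \<in> topspace X. (\<lambda>x\<in>topspace X. x) x \<in> U} = U" if "compact_openin X U" for U
    using that openin_subset by (fastforce simp: compact_openin_def)
  then show ?thesis by (auto simp: spectral_map_def)
qed

lemma spectral_map_PiE: "f \<in> spectral_map X Y \<Longrightarrow> f \<in> topspace X \<rightarrow>\<^sub>E topspace Y"
  by (simp add: spectral_map_def)

lemma compose_assoc_PiE:
  assumes "f \<in> A \<rightarrow>\<^sub>E B"
  shows "compose A h (compose A g f) = compose A (compose B h g) f"
  using assms by (auto simp: compose_def fun_eq_iff PiE_iff)

lemma category_Spectral: "category Spectral"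
  by (auto simp: category_def Spectral_def spectral_map_id spectral_map_compose
      compose_extensional_id[OF spectral_map_PiE] compose_assoc_PiE[OF spectral_map_PiE])

lemma SIC_object_map:
  "(X, C, m) \<in> Obj (SIC u) \<Longrightarrow> m \<in> topspace C \<rightarrow>\<^sub>E topspace X"
  by (simp add: SIC_def monomorphism_def Spectral_def spectral_map_def)

lemma category_SIC: "category (SIC u)"
  unfolding category_def
proof (intro conjI ballI; clarify)
  fix X :: "'a topology" and C m assume "(X, C, m) \<in> Obj (SIC u)"
  from SIC_object_map[OF this] show "Id (SIC u) (X, C, m) \<in> Hom (SIC u) (X, C, m) (X, C, m)"
    by (simp add: SIC_def spectral_map_id compose_extensional_id)
next
  fix X :: "'a topology" and C m Y D n Z E l s t s' t'
  assume o: "(X, C, m) \<in> Obj (SIC u)" "(Y, D, n) \<in> Obj (SIC u)"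
    and f: "(s, t) \<in> Hom (SIC u) (X, C, m) (Y, D, n)"
    and g: "(s', t') \<in> Hom (SIC u) (Y, D, n) (Z, E, l)"
  have s: "s \<in> spectral_map X Y" "t \<in> spectral_map C D" "compose (topspace C) s m = compose (topspace C) n t"
    and s': "s' \<in> spectral_map Y Z" "t' \<in> spectral_map D E" "compose (topspace D) s' n = compose (topspace D) l t'"
    using f g by (auto simp: SIC_def)
  have "compose (topspace C) (compose (topspace X) s' s) m
      = compose (topspace C) s' (compose (topspace C) n t)"
    using compose_assoc_PiE[OF SIC_object_map[OF o(1)]] s(3) by metis
  also have "\<dots> = compose (topspace C) l (compose (topspace C) t' t)"
    using compose_assoc_PiE[OF spectral_map_PiE[OF s(2)]] s'(3) by metis
  finally show "Comp (SIC u) (X, C, m) (Y, D, n) (Z, E, l) (s', t') (s, t)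
      \<in> Hom (SIC u) (X, C, m) (Z, E, l)"
    using s s' by (simp add: SIC_def spectral_map_compose)
next
  fix X :: "'a topology" and C m Y D n s t
  assume "(s, t) \<in> Hom (SIC u) (X, C, m) (Y, D, n)"
  then show "Comp (SIC u) (X, C, m) (X, C, m) (Y, D, n) (s, t) (Id (SIC u) (X, C, m)) = (s, t)"
    and "Comp (SIC u) (X, C, m) (Y, D, n) (Y, D, n) (Id (SIC u) (Y, D, n)) (s, t) = (s, t)"
    by (auto simp: SIC_def compose_extensional_id[OF spectral_map_PiE])
next
  fix X :: "'a topology" and C m Y D n Z E l W G k s t s' t' s'' t''
  assume "(s, t) \<in> Hom (SIC u) (X, C, m) (Y, D, n)"
  then show "Comp (SIC u) (X, C, m) (Z, E, l) (W, G, k) (s'', t'')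
               (Comp (SIC u) (X, C, m) (Y, D, n) (Z, E, l) (s', t') (s, t))
           = Comp (SIC u) (X, C, m) (Y, D, n) (W, G, k)
               (Comp (SIC u) (Y, D, n) (Z, E, l) (W, G, k) (s'', t'') (s', t')) (s, t)"
    by (auto simp: SIC_def compose_assoc_PiE[OF spectral_map_PiE])
qed

end

theory Submission
  imports Defs
begin

text \<open>
  The functor \<open>\<alpha>\<close> sends a presented MV-algebra \<open>(F, I)\<close> to the spectrum of prime ideals of \<open>F\<close>, the
  closed set of the primes that contain \<open>I\<close>, and the inclusion; it sends a homomorphism to the map
  that takes preimages of primes.  An injection \<open>e\<close> from sets of McNaughton functions into the
  universe \<open>'p\<close> serves to name the points.

  Everything rests on two facts about a McNaughton function \<open>f\<close> on a cube and its zero set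
  \<open>Z f\<close>.  First, ideals see nothing but zero sets: if \<open>Z g \<subseteq> Z f\<close>, then \<open>f \<le> n \<cdot> g\<close> for some \<open>n\<close>
  (\<open>mcnaughton_dominated\<close>), so \<open>f\<close> lies in every ideal that contains \<open>g\<close>.  Second, the zero sets
  are exactly the cylinder rational polyhedra (\<open>zero_set_in_Cypol\<close>, \<open>Cypol_zero_set\<close>).  Both come
  from cutting the cube into finitely many rational polytopes on which a given McNaughton function
  is affine; the passage between the half-spaces and the vertices of such a polytope, with rational
  data on both sides, is done by Fourier--Motzkin elimination and by moving a point of a polytope
  until its active constraints determine it.

  Write \<open>D f\<close> for the set of primes that omit \<open>f\<close>.  By Zorn's lemma \<open>D f \<subseteq> D g\<close> holds if and only
  if \<open>Z g \<subseteq> Z f\<close>.  Hence the spectrum is a spectral space whose compact open sets are the \<open>D f\<close>, and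
  \<open>D f \<mapsto> Z f\<close> is an anti-isomorphism onto \<open>Cypol K\<close>: the spectrum is cylinder based.

  Every object \<open>(Y, C, m)\<close> of \<open>SIC\<close> is reached up to isomorphism.  A spectral space is determined up
  to homeomorphism by its ordered set of compact open sets, because sobriety recovers the points
  (\<open>spectral_homeomorphism\<close>); so \<open>Y\<close> is homeomorphic to the spectrum of some \<open>Free K\<close>.  A monomorphism
  of spectral spaces is injective, as the one-point space is spectral.  Therefore the closed
  map \<open>m\<close> identifies \<open>C\<close> with a closed subspace (\<open>SIC_isomorphic_closed_subspace\<close>), and each closed
  subset of the spectrum consists of the primes over some ideal \<open>I\<close> (\<open>closed_is_ideal_hull\<close>).

  On objects \<open>\<alpha>\<close> is injective because the primes, which are actual sets of functions, determine the
  cube on which those functions live, and because an ideal is the intersection of the primes above it.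
\<close>

section \<open>Fourier--Motzkin elimination with integer coefficients\<close>

text \<open>
  Each constraint with \<open>c p < 0\<close> is a lower bound \<open>- d p / c p\<close> on \<open>t\<close> and each one with \<open>c p > 0\<close> an
  upper bound; the pairwise condition says that no lower bound exceeds an upper one.  The solution
  is taken to be one of the bounds, or \<open>0\<close> if there are none, and is therefore rational with the data.
\<close>

lemma one_variable_elimination:
  fixes c d :: "'a \<Rightarrow> real"
  assumes S: "finite S"
    and zero: "\<And>p. p \<in> S \<Longrightarrow> c p = 0 \<Longrightarrow> d p \<le> 0"
    and pair: "\<And>p q. p \<in> S \<Longrightarrow> q \<in> S \<Longrightarrow> c p > 0 \<Longrightarrow> c q < 0 \<Longrightarrow> c p * d q - c q * d p \<le> 0"
  shows "\<exists>t. (\<forall>p\<in>S. c p * t + d p \<le> 0) \<and> ((\<forall>p\<in>S. c p \<in> \<rat> \<and> d p \<in> \<rat>) \<longrightarrow> t \<in> \<rat>)"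
proof -
  have solve_pos: "t \<le> - b / a \<longleftrightarrow> a * t + b \<le> 0" if "a > 0" for a b t :: real
    by (subst pos_le_divide_eq[OF that]) (auto simp: algebra_simps)
  have solve_neg: "- b / a \<le> t \<longleftrightarrow> a * t + b \<le> 0" if "a < 0" for a b t :: real
    by (subst neg_divide_le_eq[OF that]) (auto simp: algebra_simps)
  define L where "L = (\<lambda>p. - d p / c p) ` {p \<in> S. c p < 0}"
  define U where "U = (\<lambda>p. - d p / c p) ` {p \<in> S. c p > 0}"
  have fin: "finite L" "finite U" using S by (auto simp: L_def U_def)
  have LU: "l \<le> u" if lu: "l \<in> L" "u \<in> U" for l u
  proof -
    obtain q p where q: "q \<in> S" "c q < 0" "l = - d q / c q" and p: "p \<in> S" "c p > 0" "u = - d p / c p"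
      using lu by (auto simp: L_def U_def)
    have "c p * d q - c q * d p \<le> 0" by (rule pair) (use p q in auto)
    moreover have "c p * u = - d p" using p by simp
    moreover have "c p * (c q * u + d q) = c q * (c p * u) + c p * d q" by (simp add: algebra_simps)
    ultimately have "c p * (c q * u + d q) \<le> 0" by (simp add: algebra_simps)
    then have "c q * u + d q \<le> 0" using p by (simp add: mult_le_0_iff)
    then show ?thesis unfolding q(3) using solve_neg q by blast
  qed
  have "\<exists>t. (\<forall>l\<in>L. l \<le> t) \<and> (\<forall>u\<in>U. t \<le> u) \<and> t \<in> insert 0 (L \<union> U)"
  proof (cases "L = {}")
    case False
    then show ?thesis using fin LU by (intro exI[of _ "Max L"]) auto
  next
    case True
    show ?thesis
    proof (cases "U = {}")
      case False
      then show ?thesis using True fin by (intro exI[of _ "Min U"]) auto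
    qed (use True in auto)
  qed
  then obtain t where t: "\<forall>l\<in>L. l \<le> t" "\<forall>u\<in>U. t \<le> u" "t \<in> insert 0 (L \<union> U)" by blast
  have "c p * t + d p \<le> 0" if p: "p \<in> S" for p
  proof -
    consider "c p = 0" | "c p > 0" | "c p < 0" by linarith
    then show ?thesis
    proof cases
      case 1 then show ?thesis using zero p by simp
    next
      case 2
      then have "t \<le> - d p / c p" using t p by (auto simp: U_def)
      then show ?thesis using solve_pos 2 by blast
    next
      case 3
      then have "- d p / c p \<le> t" using t p by (auto simp: L_def)
      then show ?thesis using solve_neg 3 by blast
    qed
  qed
  moreover have "t \<in> \<rat>" if "\<forall>p\<in>S. c p \<in> \<rat> \<and> d p \<in> \<rat>"
    using t(3) that by (auto simp: L_def U_def intro: Rats_divide)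
  ultimately show ?thesis by blast
qed

text \<open>
  A system of linear inequalities in the unknowns \<open>w v\<close>, where \<open>v\<close> ranges over \<open>V\<close>.  The constant
  terms are functions of a parameter \<open>x\<close>, so that eliminating all unknowns leaves the conditions on
  \<open>x\<close> under which the system is solvable.
\<close>

definition satisfies ::
    "'v set \<Rightarrow> (('v \<Rightarrow> int) \<times> ('x \<Rightarrow> real)) set \<Rightarrow> 'x \<Rightarrow> ('v \<Rightarrow> real) \<Rightarrow> bool" where
  "satisfies V S x w \<longleftrightarrow> (\<forall>(c, d)\<in>S. (\<Sum>v\<in>V. of_int (c v) * w v) + d x \<le> 0)"

text \<open>
  One unknown is eliminated at a time: the constraints that mention \<open>u\<close> with coefficients of opposite
  sign are combined in pairs so that \<open>u\<close> cancels.  Multiplying crosswise by the coefficients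
  keeps all coefficients integral, and the new constant terms stay in \<open>\<A>\<close>.  Substituting back yields
  a solution that is rational wherever the constant terms are.
\<close>

lemma fourier_motzkin:
  fixes \<A> :: "('x \<Rightarrow> real) set" and S :: "(('v \<Rightarrow> int) \<times> ('x \<Rightarrow> real)) set"
  assumes "finite V" "finite S" "snd ` S \<subseteq> \<A>"
    and "\<And>d d' m n. d \<in> \<A> \<Longrightarrow> d' \<in> \<A> \<Longrightarrow> (\<lambda>x. of_int m * d x + of_int n * d' x) \<in> \<A>"
  shows "\<exists>T\<subseteq>\<A>. finite T \<and> (\<forall>x.
     ((\<exists>w. satisfies V S x w) \<longrightarrow> (\<forall>d\<in>T. d x \<le> 0)) \<and>
     ((\<forall>d\<in>T. d x \<le> 0) \<longrightarrow> (\<exists>w. satisfies V S x w \<and>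
        ((\<forall>d\<in>\<A>. d x \<in> \<rat>) \<longrightarrow> (\<forall>v\<in>V. w v \<in> \<rat>)))))"
  using assms(1-3)
proof (induction V arbitrary: S rule: finite_induct)
  case empty
  show ?case using empty by (intro exI[of _ "snd ` S"]) (auto simp: satisfies_def)
next
  case (insert u V)
  define comb where "comb = (\<lambda>(p :: ('v \<Rightarrow> int) \<times> ('x \<Rightarrow> real)) q.
     ((\<lambda>v. fst p u * fst q v - fst q u * fst p v),
      (\<lambda>x. of_int (fst p u) * snd q x + of_int (- fst q u) * snd p x)))"
  define S1 where "S1 = {p \<in> S. fst p u = 0} \<union>
     (\<lambda>(p, q). comb p q) ` {(p, q) \<in> S \<times> S. fst p u > 0 \<and> fst q u < 0}"
  have "finite {(p, q) \<in> S \<times> S. fst p u > 0 \<and> fst q u < 0}"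
    by (rule finite_subset[of _ "S \<times> S"]) (use insert.prems in auto)
  then have finS1: "finite S1" using insert.prems by (simp add: S1_def)
  have "snd (comb p q) \<in> \<A>" if "p \<in> S" "q \<in> S" for p q
    unfolding comb_def snd_conv using that insert.prems by (intro assms(4)) auto
  then have "snd ` S1 \<subseteq> \<A>" using insert.prems by (auto simp: S1_def)
  from insert.IH[OF finS1 this] obtain T where T: "T \<subseteq> \<A>" "finite T"
    and TT: "\<forall>x. ((\<exists>w. satisfies V S1 x w) \<longrightarrow> (\<forall>d\<in>T. d x \<le> 0)) \<and>
     ((\<forall>d\<in>T. d x \<le> 0) \<longrightarrow> (\<exists>w. satisfies V S1 x w \<and>
        ((\<forall>d\<in>\<A>. d x \<in> \<rat>) \<longrightarrow> (\<forall>v\<in>V. w v \<in> \<rat>))))"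
    by (elim exE conjE)
  have T1: "\<forall>d\<in>T. d x \<le> 0" if "satisfies V S1 x w" for x w
    using TT that by blast
  have T2: "\<exists>w. satisfies V S1 x w \<and>
        ((\<forall>d\<in>\<A>. d x \<in> \<rat>) \<longrightarrow> (\<forall>v\<in>V. w v \<in> \<rat>))" if "\<forall>d\<in>T. d x \<le> 0" for x
    using TT that by blast
  define rest where "rest = (\<lambda>(p :: ('v \<Rightarrow> int) \<times> ('x \<Rightarrow> real)) w x.
     (\<Sum>v\<in>V. of_int (fst p v) * w v) + snd p x)"
  have rest_comb: "rest (comb p q) w x = of_int (fst p u) * rest q w x - of_int (fst q u) * rest p w x" for p q w x
    by (simp add: rest_def comb_def algebra_simps sum_subtractf sum_distrib_left)
  have split: "(\<Sum>v\<in>insert u V. of_int (fst p v) * w v) + snd p x = of_int (fst p u) * w u + rest p w x" for p w x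
    using insert.hyps by (simp add: rest_def)
  have rest_upd: "rest p (w(u := t)) x = rest p w x" for p w t x
    unfolding rest_def using insert.hyps by (intro arg_cong2[of _ _ _ _ "(+)"] sum.cong) auto
  show ?case
  proof (intro exI[of _ T] conjI allI impI T)
    fix x
    assume "\<exists>w. satisfies (insert u V) S x w"
    then obtain w where w: "\<And>p. p \<in> S \<Longrightarrow> of_int (fst p u) * w u + rest p w x \<le> 0"
      unfolding split[symmetric] satisfies_def by fastforce
    have "rest r w x \<le> 0" if "r \<in> S1" for r
    proof -
      consider "r \<in> S" "fst r u = 0"
        | p q where "p \<in> S" "q \<in> S" "fst p u > 0" "fst q u < 0" "r = comb p q"
        using \<open>r \<in> S1\<close> by (auto simp: S1_def)
      then show ?thesis
      proof cases
        case 1 then show ?thesis using w[OF 1(1)] by simp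
      next
        case 2
        have "of_int (fst p u) * (of_int (fst q u) * w u + rest q w x) \<le> 0"
          by (rule mult_nonneg_nonpos) (use 2 w[OF 2(2)] in auto)
        moreover have "- of_int (fst q u) * (of_int (fst p u) * w u + rest p w x) \<le> 0"
          by (rule mult_nonneg_nonpos) (use 2 w[OF 2(1)] in auto)
        ultimately show ?thesis unfolding 2(5) rest_comb by (simp add: algebra_simps)
      qed
    qed
    then show "\<forall>d\<in>T. d x \<le> 0" by (intro T1[of _ w]) (auto simp: rest_def satisfies_def)
  next
    fix x assume "\<forall>d\<in>T. d x \<le> 0"
    then obtain w where w0: "satisfies V S1 x w"
      and wQ: "(\<forall>d\<in>\<A>. d x \<in> \<rat>) \<longrightarrow> (\<forall>v\<in>V. w v \<in> \<rat>)" using T2 by blast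
    from w0 have w: "\<And>p. p \<in> S1 \<Longrightarrow> rest p w x \<le> 0" by (force simp: rest_def satisfies_def)
    have pair: "of_int (fst p u) * rest q w x - of_int (fst q u) * rest p w x \<le> 0"
      if "p \<in> S" "q \<in> S" "(of_int (fst p u) :: real) > 0" "(of_int (fst q u) :: real) < 0" for p q
    proof -
      have "comb p q \<in> S1" using that by (auto simp: S1_def)
      from w[OF this] show ?thesis unfolding rest_comb .
    qed
    have "\<exists>t. (\<forall>p\<in>S. of_int (fst p u) * t + rest p w x \<le> 0) \<and>
        ((\<forall>p\<in>S. (of_int (fst p u) :: real) \<in> \<rat> \<and> rest p w x \<in> \<rat>) \<longrightarrow> t \<in> \<rat>)"
      using pair w insert.prems by (intro one_variable_elimination) (auto simp: S1_def)
    then obtain t where t: "\<And>p. p \<in> S \<Longrightarrow> of_int (fst p u) * t + rest p w x \<le> 0"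
      and tQ: "(\<forall>p\<in>S. rest p w x \<in> \<rat>) \<longrightarrow> t \<in> \<rat>" by auto
    have "(\<Sum>v\<in>insert u V. of_int (fst p v) * (w(u := t)) v) + snd p x \<le> 0" if "p \<in> S" for p
      unfolding split rest_upd using t[OF that] by simp
    then have sol: "satisfies (insert u V) S x (w(u := t))" by (auto simp: satisfies_def)
    have rat: "\<forall>v\<in>insert u V. (w(u := t)) v \<in> \<rat>" if Q: "\<forall>d\<in>\<A>. d x \<in> \<rat>"
    proof -
      have "rest p w x \<in> \<rat>" if "p \<in> S" for p
        unfolding rest_def using Q wQ that insert.prems
        by (intro Rats_add Rats_sum Rats_mult Rats_of_int) auto
      then show ?thesis using tQ wQ Q by auto
    qed
    show "\<exists>w. satisfies (insert u V) S x w \<and>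
        ((\<forall>d\<in>\<A>. d x \<in> \<rat>) \<longrightarrow> (\<forall>v\<in>insert u V. w v \<in> \<rat>))"
      by (rule exI[of _ "w(u := t)"]) (intro conjI sol impI rat, assumption)
  qed
qed

lemma satisfies_rational:
  fixes S :: "(('v \<Rightarrow> int) \<times> ('x \<Rightarrow> real)) set"
  assumes "finite V" "finite S" "\<And>p. p \<in> S \<Longrightarrow> snd p x \<in> \<rat>" "satisfies V S x w"
  shows "\<exists>w. satisfies V S x w \<and> (\<forall>v\<in>V. w v \<in> \<rat>)"
proof -
  define \<A> :: "('x \<Rightarrow> real) set" where "\<A> = {d. d x \<in> \<rat>}"
  have "\<exists>T\<subseteq>\<A>. finite T \<and> (\<forall>x.
     ((\<exists>w. satisfies V S x w) \<longrightarrow> (\<forall>d\<in>T. d x \<le> 0)) \<and>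
     ((\<forall>d\<in>T. d x \<le> 0) \<longrightarrow> (\<exists>w. satisfies V S x w \<and>
        ((\<forall>d\<in>\<A>. d x \<in> \<rat>) \<longrightarrow> (\<forall>v\<in>V. w v \<in> \<rat>)))))"
    by (rule fourier_motzkin) (use assms in \<open>auto simp: \<A>_def\<close>)
  moreover have "\<forall>d\<in>\<A>. d x \<in> \<rat>" by (simp add: \<A>_def)
  ultimately show ?thesis using assms(4) by meson
qed

lemma satisfies_projection:
  fixes \<A> :: "('x \<Rightarrow> real) set" and S :: "(('v \<Rightarrow> int) \<times> ('x \<Rightarrow> real)) set"
  assumes "finite V" "finite S" "snd ` S \<subseteq> \<A>"
    and "\<And>d d' m n. d \<in> \<A> \<Longrightarrow> d' \<in> \<A> \<Longrightarrow> (\<lambda>x. of_int m * d x + of_int n * d' x) \<in> \<A>"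
  shows "\<exists>T\<subseteq>\<A>. finite T \<and> (\<forall>x. (\<exists>w. satisfies V S x w) \<longleftrightarrow> (\<forall>d\<in>T. d x \<le> 0))"
proof -
  have "\<exists>T\<subseteq>\<A>. finite T \<and> (\<forall>x.
     ((\<exists>w. satisfies V S x w) \<longrightarrow> (\<forall>d\<in>T. d x \<le> 0)) \<and>
     ((\<forall>d\<in>T. d x \<le> 0) \<longrightarrow> (\<exists>w. satisfies V S x w \<and>
        ((\<forall>d\<in>\<A>. d x \<in> \<rat>) \<longrightarrow> (\<forall>v\<in>V. w v \<in> \<rat>)))))"
    by (rule fourier_motzkin) (use assms in auto)
  then show ?thesis by meson
qed

section \<open>Rational polytopes\<close>

definition affine_form :: "'i set \<Rightarrow> ('i \<Rightarrow> int) \<times> int \<Rightarrow> ('i \<Rightarrow> real) \<Rightarrow> real" where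
  "affine_form Y p x = (\<Sum>i\<in>Y. of_int (fst p i) * x i) + of_int (snd p)"

definition half_spaces :: "'i set \<Rightarrow> (('i \<Rightarrow> int) \<times> int) set \<Rightarrow> ('i \<Rightarrow> real) set" where
  "half_spaces Y S = {x \<in> extensional Y. \<forall>p\<in>S. affine_form Y p x \<le> 0}"

lemma affine_form_zero: "affine_form Y (\<lambda>_. 0, 0) x = 0"
  by (simp add: affine_form_def)

lemma affine_form_combination:
  "affine_form Y (\<lambda>i. m * fst p i + n * fst q i, m * snd p + n * snd q) x
     = of_int m * affine_form Y p x + of_int n * affine_form Y q x"
  by (simp add: affine_form_def algebra_simps sum.distrib sum_distrib_left)

lemma affine_form_cong: "(\<And>i. i \<in> Y \<Longrightarrow> x i = y i) \<Longrightarrow> affine_form Y p x = affine_form Y p y"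
  by (simp add: affine_form_def)

lemma affine_form_segment:
  "affine_form Y p (\<lambda>i\<in>Y. x i + t * (y i - x i))
     = affine_form Y p x + t * (affine_form Y p y - affine_form Y p x)"
proof -
  have "(\<Sum>i\<in>Y. of_int (fst p i) * (\<lambda>i\<in>Y. x i + t * (y i - x i)) i)
    = (\<Sum>i\<in>Y. of_int (fst p i) * x i + t * (of_int (fst p i) * y i - of_int (fst p i) * x i))"
    by (intro sum.cong) (simp_all add: algebra_simps)
  then show ?thesis by (simp add: affine_form_def sum.distrib sum_subtractf flip: sum_distrib_left)
qed

lemma affine_form_convex_combination:
  assumes "(\<Sum>v\<in>V. w v) = 1" "\<And>i. i \<in> Y \<Longrightarrow> x i = (\<Sum>v\<in>V. w v * v i)"
  shows "affine_form Y p x = (\<Sum>v\<in>V. w v * affine_form Y p v)"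
proof -
  have "(\<Sum>i\<in>Y. of_int (fst p i) * x i) = (\<Sum>i\<in>Y. \<Sum>v\<in>V. w v * (of_int (fst p i) * v i))"
    by (intro sum.cong) (simp_all add: assms(2) sum_distrib_left mult.left_commute)
  also have "\<dots> = (\<Sum>v\<in>V. w v * (\<Sum>i\<in>Y. of_int (fst p i) * v i))"
    by (subst sum.swap) (simp add: sum_distrib_left)
  finally show ?thesis
    using assms(1) by (simp add: affine_form_def distrib_left sum.distrib flip: sum_distrib_right)
qed

lemma cube_half_spaces:
  assumes "finite Y"
  shows "\<exists>S. finite S \<and> cube Y = half_spaces Y S"
proof -
  define up lo :: "'a \<Rightarrow> ('a \<Rightarrow> int) \<times> int"
    where "up = (\<lambda>i. (\<lambda>j. if j = i then 1 else 0, - 1))" and "lo = (\<lambda>i. (\<lambda>j. if j = i then - 1 else 0, 0))"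
  have *: "(if j = i then a else 0) * b = (if j = i then a * b else 0)" for i j :: 'a and a b :: real by simp
  have "affine_form Y (up i) x = x i - 1" "affine_form Y (lo i) x = - x i" if "i \<in> Y" for i and x :: "'a \<Rightarrow> real"
    using assms that by (auto simp: affine_form_def up_def lo_def if_distrib[of of_int] * cong: if_cong)
  then have "cube Y = half_spaces Y (up ` Y \<union> lo ` Y)"
    by (auto simp: cube_def half_spaces_def PiE_iff ball_Un extensional_def)
  then show ?thesis by (rule exI[of _ "up ` Y \<union> lo ` Y", OF conjI, rotated]) (simp add: assms)
qed

lemma half_spaces_Un: "half_spaces Y (S \<union> T) = half_spaces Y S \<inter> half_spaces Y T"
  by (auto simp: half_spaces_def)

lemma common_denominator:
  assumes "finite R" "R \<subseteq> \<rat>"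
  shows "\<exists>N>0::int. \<forall>r\<in>R. \<exists>z. of_int N * r = (of_int z :: real)"
  using assms
proof (induction R rule: finite_induct)
  case (insert r R)
  then obtain N where N: "N > 0" "\<forall>r\<in>R. \<exists>z. of_int N * r = (of_int z :: real)" by auto
  from insert have "r \<in> \<rat>" by auto
  then obtain a b where ab: "b > 0" "r = of_int a / of_int b" by (metis Rats_cases')
  have "\<exists>z. of_int (N * b) * s = (of_int z :: real)" if s: "s \<in> insert r R" for s
  proof (cases "s = r")
    case True
    then show ?thesis using ab by (intro exI[of _ "N * a"]) simp
  next
    case False
    then obtain z where "of_int N * s = (of_int z :: real)" using N s by auto
    then show ?thesis by (intro exI[of _ "b * z"]) simp
  qed
  then show ?case using N ab by (intro exI[of _ "N * b"]) auto
qed (auto intro!: exI[of _ 1])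

text \<open>
  The envelope is the projection to \<open>x\<close> of the polyhedron of all pairs \<open>(x, w)\<close> in which \<open>w\<close> is a
  system of barycentric weights for \<open>x\<close>; eliminating \<open>w\<close> leaves half-spaces in \<open>x\<close>.
\<close>

lemma convex_envelope_half_spaces:
  assumes Y: "finite Y" and V: "finite V" "\<And>v i. v \<in> V \<Longrightarrow> i \<in> Y \<Longrightarrow> v i \<in> \<rat>"
  shows "\<exists>S. finite S \<and> convex_envelope Y V = half_spaces Y S"
proof -
  have "finite ((\<lambda>(v, i). v i) ` (V \<times> Y))" "(\<lambda>(v, i). v i) ` (V \<times> Y) \<subseteq> \<rat>" using Y V by auto
  from common_denominator[OF this] obtain N
    where N: "N > 0" "\<forall>v\<in>V. \<forall>i\<in>Y. \<exists>z. of_int N * v i = (of_int z :: real)" by auto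
  define z where "z = (\<lambda>(v :: 'a \<Rightarrow> real) i. \<lfloor>of_int N * v i\<rfloor>)"
  have z: "of_int N * v i = of_int (z v i)" if "v \<in> V" "i \<in> Y" for v i
    using N(2) that unfolding z_def by (metis floor_of_int)
  define \<A> where "\<A> = range (affine_form Y)"
  define coord :: "'a \<Rightarrow> int \<Rightarrow> ('a \<Rightarrow> int) \<times> int" where "coord = (\<lambda>i e. (\<lambda>j. if j = i then e else 0, 0))"
  \<comment> \<open>The equations \<open>x i = \<Sum>v. w v * v i\<close> are scaled by a common denominator \<open>N\<close> of all vertices and split, like \<open>\<Sum>v. w v = 1\<close>, into two inequalities.\<close>
  define S :: "((('a \<Rightarrow> real) \<Rightarrow> int) \<times> (('a \<Rightarrow> real) \<Rightarrow> real)) set" where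
    "S = (\<lambda>u. (\<lambda>v. if v = u then - 1 else 0, affine_form Y (\<lambda>_. 0, 0))) ` V
       \<union> {(\<lambda>_. 1, affine_form Y (\<lambda>_. 0, - 1)), (\<lambda>_. - 1, affine_form Y (\<lambda>_. 0, 1))}
       \<union> (\<lambda>i. (\<lambda>v. z v i, affine_form Y (coord i (- N)))) ` Y
       \<union> (\<lambda>i. (\<lambda>v. - z v i, affine_form Y (coord i N))) ` Y"
  have coord: "affine_form Y (coord i e) x = of_int e * x i" if "i \<in> Y" for i e x
  proof -
    have "(\<Sum>j\<in>Y. of_int (if j = i then e else 0) * x j) = (\<Sum>j\<in>Y. if j = i then of_int e * x j else 0)"
      by (intro sum.cong) auto
    then show ?thesis using Y that by (simp add: affine_form_def coord_def)
  qed
  have const: "affine_form Y (\<lambda>_. 0, b) x = of_int b" for b x by (simp add: affine_form_def)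
  have delta: "(\<Sum>v\<in>V. of_int (if v = u then - 1 else 0) * w v) = - w u" if "u \<in> V" for u and w :: "_ \<Rightarrow> real"
  proof -
    have "(\<Sum>v\<in>V. of_int (if v = u then - 1 else 0) * w v) = (\<Sum>v\<in>V. if v = u then - w v else 0)"
      by (intro sum.cong) auto
    then show ?thesis using V that by simp
  qed
  have zsum: "(\<Sum>v\<in>V. of_int (z v i) * w v) = of_int N * (\<Sum>v\<in>V. w v * v i)" if "i \<in> Y" for i and w :: "_ \<Rightarrow> real"
    unfolding sum_distrib_left by (intro sum.cong) (auto simp: z[symmetric] that)
  have sol: "satisfies V S x w \<longleftrightarrow>
      (\<forall>v\<in>V. 0 \<le> w v) \<and> (\<Sum>v\<in>V. w v) = 1 \<and> (\<forall>i\<in>Y. x i = (\<Sum>v\<in>V. w v * v i))" (is "?L = ?R") for w x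
  proof -
    have "?L \<longleftrightarrow> (\<forall>v\<in>V. 0 \<le> w v) \<and> (\<Sum>v\<in>V. w v) \<le> 1 \<and> 1 \<le> (\<Sum>v\<in>V. w v)
       \<and> (\<forall>i\<in>Y. of_int N * (\<Sum>v\<in>V. w v * v i) \<le> of_int N * x i)
       \<and> (\<forall>i\<in>Y. of_int N * x i \<le> of_int N * (\<Sum>v\<in>V. w v * v i))"
      by (simp add: satisfies_def S_def ball_Un delta const coord zsum sum_negf) blast
    also have "\<dots> \<longleftrightarrow> ?R" using N(1) by (auto simp: eq_iff)
    finally show ?thesis .
  qed
  have finS: "finite S" using V Y by (simp add: S_def)
  have sub: "snd ` S \<subseteq> \<A>" by (auto simp: S_def \<A>_def)
  have comb: "(\<lambda>x. of_int m * d x + of_int n * d' x) \<in> \<A>" if dd: "d \<in> \<A>" "d' \<in> \<A>" for d d' m n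
  proof -
    obtain p q where "d = affine_form Y p" "d' = affine_form Y q" using dd unfolding \<A>_def by blast
    then have "(\<lambda>x. of_int m * d x + of_int n * d' x)
      = affine_form Y (\<lambda>i. m * fst p i + n * fst q i, m * snd p + n * snd q)"
      by (simp add: affine_form_combination fun_eq_iff)
    then show ?thesis unfolding \<A>_def by blast
  qed
  have "\<exists>T\<subseteq>\<A>. finite T \<and> (\<forall>x. (\<exists>w. satisfies V S x w) \<longleftrightarrow> (\<forall>d\<in>T. d x \<le> 0))"
    by (rule satisfies_projection[OF V(1) finS sub]) (rule comb)
  then obtain T where T: "T \<subseteq> \<A>" "finite T"
    and "\<forall>x. (\<exists>w. satisfies V S x w) \<longleftrightarrow> (\<forall>d\<in>T. d x \<le> 0)"
    by (elim exE conjE)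
  then have TT: "(\<exists>w. satisfies V S x w) \<longleftrightarrow> (\<forall>d\<in>T. d x \<le> 0)" for x by simp
  obtain T' where T': "finite T'" "T = affine_form Y ` T'"
    using finite_subset_image[OF T(2) T(1)[unfolded \<A>_def]] by blast
  have "convex_envelope Y V = half_spaces Y T'"
    using TT unfolding sol T' convex_envelope_def half_spaces_def by simp
  then show ?thesis by (rule exI[of _ T', OF conjI, rotated]) (rule T')
qed

lemma rational_solution:
  assumes Y: "finite Y" and S: "finite S" and x: "\<forall>p\<in>S. affine_form Y p x \<le> 0"
  shows "\<exists>y. (\<forall>p\<in>S. affine_form Y p y \<le> 0) \<and> (\<forall>i\<in>Y. y i \<in> \<rat>)"
proof -
  define S' where "S' = (\<lambda>p. (fst p, \<lambda>_ :: unit. of_int (snd p) :: real)) ` S"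
  have sol: "satisfies Y S' () w \<longleftrightarrow> (\<forall>p\<in>S. affine_form Y p w \<le> 0)" for w
    by (auto simp: satisfies_def S'_def affine_form_def)
  have "\<exists>w. satisfies Y S' () w \<and> (\<forall>v\<in>Y. w v \<in> \<rat>)"
    by (rule satisfies_rational[where w = x]) (use Y S x in \<open>auto simp: sol\<close>, auto simp: S'_def)
  then show ?thesis by (simp add: sol)
qed

lemma convex_envelope_segment:
  assumes V: "finite V" and x: "x \<in> convex_envelope Y V" and y: "y \<in> convex_envelope Y V"
    and z: "z \<in> extensional Y" and a: "0 \<le> a" "0 \<le> b" "a + b = 1"
    and eq: "\<And>i. i \<in> Y \<Longrightarrow> z i = a * x i + b * y i"
  shows "z \<in> convex_envelope Y V"
proof -
  obtain u where u: "\<forall>v\<in>V. (0::real) \<le> u v" "(\<Sum>v\<in>V. u v) = 1" "\<forall>i\<in>Y. x i = (\<Sum>v\<in>V. u v * v i)"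
    using x by (auto simp: convex_envelope_def)
  obtain w where w: "\<forall>v\<in>V. (0::real) \<le> w v" "(\<Sum>v\<in>V. w v) = 1" "\<forall>i\<in>Y. y i = (\<Sum>v\<in>V. w v * v i)"
    using y by (auto simp: convex_envelope_def)
  have "(\<Sum>v\<in>V. a * u v + b * w v) = 1"
    using u w a by (simp add: sum.distrib flip: sum_distrib_left)
  moreover have "z i = (\<Sum>v\<in>V. (a * u v + b * w v) * v i)" if "i \<in> Y" for i
    using u w that eq[OF that] by (simp add: distrib_right sum.distrib sum_distrib_left mult.assoc)
  moreover have "\<forall>v\<in>V. 0 \<le> a * u v + b * w v" using u w a by auto
  ultimately show ?thesis using z unfolding convex_envelope_def
    by (auto intro!: exI[of _ "\<lambda>v. a * u v + b * w v"])
qed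

lemma convex_envelope_vertex:
  assumes "finite V" "v \<in> V" "v \<in> extensional Y"
  shows "v \<in> convex_envelope Y V"
proof -
  have "(\<Sum>u\<in>V. (if u = v then 1 else 0) * u i) = (\<Sum>u\<in>V. if u = v then u i else 0)" for i
    by (intro sum.cong) auto
  then show ?thesis using assms unfolding convex_envelope_def
    by (auto intro!: exI[of _ "\<lambda>u. if u = v then 1 else 0"])
qed

lemma half_spaces_convex_envelope:
  assumes V: "V \<subseteq> half_spaces Y S"
  shows "convex_envelope Y V \<subseteq> half_spaces Y S"
proof
  fix x assume x: "x \<in> convex_envelope Y V"
  then obtain w where w: "\<forall>v\<in>V. (0::real) \<le> w v" "(\<Sum>v\<in>V. w v) = 1" "\<forall>i\<in>Y. x i = (\<Sum>v\<in>V. w v * v i)"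
    by (auto simp: convex_envelope_def)
  have "affine_form Y p x \<le> 0" if "p \<in> S" for p
  proof -
    have "affine_form Y p x = (\<Sum>v\<in>V. w v * affine_form Y p v)"
      by (rule affine_form_convex_combination) (use w in auto)
    also have "\<dots> \<le> 0"
      using w V that by (intro sum_nonpos mult_nonneg_nonpos) (auto simp: half_spaces_def)
    finally show ?thesis .
  qed
  then show "x \<in> half_spaces Y S" using x by (auto simp: half_spaces_def convex_envelope_def)
qed

definition active :: "'i set \<Rightarrow> (('i \<Rightarrow> int) \<times> int) set \<Rightarrow> ('i \<Rightarrow> real) \<Rightarrow> (('i \<Rightarrow> int) \<times> int) set" where
  "active Y S x = {p \<in> S. affine_form Y p x = 0}"

lemma finite_minimizer:
  fixes f :: "'b \<Rightarrow> real"
  assumes "finite B" "B \<noteq> {}"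
  obtains q where "q \<in> B" "\<And>p. p \<in> B \<Longrightarrow> f q \<le> f p"
proof -
  have "Min (f ` B) \<in> f ` B" using assms by (intro Min_in) auto
  then obtain q where "q \<in> B" "f q = Min (f ` B)" by auto
  then show thesis using assms that[of q] by simp
qed

text \<open>
  If the active constraints at \<open>x\<close> also vanish at some other point \<open>y\<close>, they vanish along the whole
  line through \<open>x\<close> and \<open>y\<close>.  As the polytope is bounded, moving from \<open>x\<close> in the direction of \<open>y\<close>
  eventually meets a further constraint; the first one met becomes active in addition to the old ones.
\<close>

lemma push_to_new_active_constraint:
  assumes S: "finite S" and bounded: "half_spaces Y S \<subseteq> cube Y"
    and x: "x \<in> half_spaces Y S" and y: "i \<in> Y" "y i \<noteq> x i"
    and act: "\<And>p. p \<in> active Y S x \<Longrightarrow> affine_form Y p y = 0"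
  shows "\<exists>t>0. (\<lambda>i\<in>Y. x i + t * (y i - x i)) \<in> half_spaces Y S \<and>
     active Y S x \<subset> active Y S (\<lambda>i\<in>Y. x i + t * (y i - x i))"
proof -
  define z where "z = (\<lambda>t. \<lambda>i\<in>Y. x i + t * (y i - x i))"
  define slope where "slope = (\<lambda>p. affine_form Y p y - affine_form Y p x)"
  have z: "affine_form Y p (z t) = affine_form Y p x + t * slope p" for p t
    unfolding z_def slope_def by (rule affine_form_segment)
  have xS: "affine_form Y p x \<le> 0" if "p \<in> S" for p using x that by (simp add: half_spaces_def)
  define B where "B = {p \<in> S. slope p > 0}"
  have "B \<noteq> {}"
  proof
    assume "B = {}"
    then have s: "slope p \<le> 0" if "p \<in> S" for p
      using that unfolding B_def by (metis (no_types, lifting) empty_iff linorder_not_less mem_Collect_eq)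
    have "affine_form Y p (z t) \<le> 0" if "t \<ge> 0" "p \<in> S" for t p
      unfolding z using xS[OF that(2)] mult_nonneg_nonpos[OF that(1) s[OF that(2)]] by simp
    then have "z t \<in> half_spaces Y S" if "t \<ge> 0" for t
      using that by (auto simp: half_spaces_def z_def)
    then have "z t \<in> cube Y" if "t \<ge> 0" for t using bounded that by blast
    then have zb: "z t i \<in> {0..1}" if "t \<ge> 0" for t using that y(1) unfolding cube_def by blast
    \<comment> \<open>If no constraint stopped the motion, the coordinate \<open>i\<close> would change by \<open>2\<close>, more than the unit interval allows.\<close>
    have "z (2 / \<bar>y i - x i\<bar>) i - z 0 i = 2 / \<bar>y i - x i\<bar> * (y i - x i)"
      using y(1) by (simp add: z_def)
    moreover have "\<bar>2 / \<bar>d\<bar> * d\<bar> = 2" if "d \<noteq> 0" for d :: real using that by (simp add: abs_mult)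
    ultimately have "\<bar>z (2 / \<bar>y i - x i\<bar>) i - z 0 i\<bar> = 2" using y(2) by (metis eq_iff_diff_eq_0)
    moreover have "\<bar>z (2 / \<bar>y i - x i\<bar>) i - z 0 i\<bar> \<le> 1"
      using zb[of 0] zb[of "2 / \<bar>y i - x i\<bar>"] by (simp add: abs_le_iff)
    ultimately show False by simp
  qed
  moreover have finB: "finite B" using S by (simp add: B_def)
  ultimately obtain q where q: "q \<in> B" "\<And>p. p \<in> B \<Longrightarrow> - affine_form Y q x / slope q \<le> - affine_form Y p x / slope p"
    using finite_minimizer[of B "\<lambda>p. - affine_form Y p x / slope p"] by blast
  define t where "t = - affine_form Y q x / slope q"
  have strict: "affine_form Y p x < 0" if "p \<in> B" for p
  proof -
    have "p \<notin> active Y S x" using that act[of p] by (auto simp: B_def slope_def active_def)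
    then show ?thesis using that xS[of p] by (auto simp: B_def active_def)
  qed
  have t: "t > 0" using strict[OF q(1)] q(1) by (simp add: t_def B_def divide_neg_pos)
  have "affine_form Y p (z t) \<le> 0" if "p \<in> S" for p
  proof (cases "p \<in> B")
    case True
    then have pos: "slope p > 0" by (simp add: B_def)
    have "t \<le> - affine_form Y p x / slope p" using q(2)[OF True] by (simp add: t_def)
    then have "t * slope p \<le> - affine_form Y p x" using pos by (simp only: pos_le_divide_eq)
    then show ?thesis by (simp add: z)
  next
    case False
    then have "slope p \<le> 0" using that by (simp add: B_def)
    then have "t * slope p \<le> 0" using t by (simp add: mult_nonneg_nonpos)
    then show ?thesis using xS[OF that] by (simp add: z)
  qed
  then have "z t \<in> half_spaces Y S" by (simp add: half_spaces_def z_def)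
  moreover have "active Y S x \<subseteq> active Y S (z t)"
    using act by (auto simp: active_def z slope_def)
  moreover have "q \<in> active Y S (z t)" using q(1) by (simp add: active_def z t_def B_def)
  moreover have "q \<notin> active Y S x" using strict[OF q(1)] by (simp add: active_def)
  ultimately have "z t \<in> half_spaces Y S \<and> active Y S x \<subset> active Y S (z t)" by blast
  then show ?thesis using t unfolding z_def by (intro exI[of _ t] conjI) simp_all
qed

text \<open>
  The vertices are the points that are determined by their active constraints.  There are finitely
  many, as a vertex is determined by a subset of \<open>S\<close>, and they are rational, because a rational linear
  system with a unique solution has a rational one.  A point that is not a vertex can be moved in two
  opposite directions until more constraints are active; it lies between the two points reached, so
  induction on the number of inactive constraints applies.
\<close>

lemma half_spaces_generated_by_vertices:
  assumes Y: "finite Y" and S: "finite S" and bounded: "half_spaces Y S \<subseteq> cube Y"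
  shows "\<exists>V. finite V \<and> V \<subseteq> half_spaces Y S \<and> (\<forall>v\<in>V. \<forall>i\<in>Y. v i \<in> \<rat>) \<and>
    half_spaces Y S = convex_envelope Y V"
proof -
  define V where "V = {x \<in> half_spaces Y S.
    \<forall>y\<in>extensional Y. (\<forall>p\<in>active Y S x. affine_form Y p y = 0) \<longrightarrow> y = x}"
  have VS: "V \<subseteq> half_spaces Y S" by (auto simp: V_def)
  have ext: "x \<in> extensional Y" if "x \<in> half_spaces Y S" for x using that by (simp add: half_spaces_def)
  have "inj_on (active Y S) V"
  proof
    fix x y assume xy: "x \<in> V" "y \<in> V" "active Y S x = active Y S y"
    then have "\<forall>p\<in>active Y S x. affine_form Y p y = 0" by (simp add: active_def)
    then show "x = y" using xy VS ext by (auto simp: V_def)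
  qed
  moreover have "active Y S ` V \<subseteq> Pow S" by (auto simp: active_def)
  ultimately have finV: "finite V" using S by (meson finite_Pow_iff inj_on_finite)
  have rat: "v i \<in> \<rat>" if v: "v \<in> V" and i: "i \<in> Y" for v i
  proof -
    define T where "T = active Y S v \<union> (\<lambda>p. (\<lambda>i. - fst p i, - snd p)) ` active Y S v"
    have neg: "affine_form Y (\<lambda>i. - fst p i, - snd p) y = - affine_form Y p y" for p y
      by (simp add: affine_form_def sum_negf)
    have T: "(\<forall>p\<in>T. affine_form Y p y \<le> 0) \<longleftrightarrow> (\<forall>p\<in>active Y S v. affine_form Y p y = 0)" for y
      by (auto simp: T_def neg ball_Un intro: antisym)
    have "finite T" using S by (simp add: T_def active_def)
    moreover have "\<forall>p\<in>T. affine_form Y p v \<le> 0" unfolding T by (simp add: active_def)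
    ultimately obtain y where y: "\<forall>p\<in>T. affine_form Y p y \<le> 0" "\<forall>i\<in>Y. y i \<in> \<rat>"
      using rational_solution[OF Y] by blast
    have "affine_form Y p (restrict y Y) = affine_form Y p y" for p by (intro affine_form_cong) simp
    then have "restrict y Y = v" using y(1) v unfolding T by (auto simp: V_def)
    then show ?thesis using y(2) i by (metis restrict_apply')
  qed
  have "x \<in> convex_envelope Y V" if "x \<in> half_spaces Y S" for x
    using that
  proof (induction "card (S - active Y S x)" arbitrary: x rule: less_induct)
    case less
    show ?case
    proof (cases "x \<in> V")
      case True
      then show ?thesis using convex_envelope_vertex[OF finV] ext less.prems by blast
    next
      case False
      then obtain y where y: "y \<in> extensional Y" "\<And>p. p \<in> active Y S x \<Longrightarrow> affine_form Y p y = 0" "y \<noteq> x"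
        using less.prems by (auto simp: V_def)
      then obtain i where i: "i \<in> Y" "y i \<noteq> x i" using ext[OF less.prems] by (metis extensionalityI)
      have act: "affine_form Y p x = 0" if "p \<in> active Y S x" for p using that by (simp add: active_def)
      define y' where "y' = (\<lambda>i\<in>Y. x i + (- 1) * (y i - x i))"
      have y': "affine_form Y p y' = 0" if "p \<in> active Y S x" for p
        unfolding y'_def affine_form_segment using y(2)[OF that] act[OF that] by simp
      have i': "y' i \<noteq> x i" using i by (simp add: y'_def)
      have reach: "(\<lambda>i\<in>Y. x i + t * (u i - x i)) \<in> convex_envelope Y V"
        if "(\<lambda>i\<in>Y. x i + t * (u i - x i)) \<in> half_spaces Y S"
          "active Y S x \<subset> active Y S (\<lambda>i\<in>Y. x i + t * (u i - x i))" for t u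
      proof (rule less.hyps[OF _ that(1)])
        show "card (S - active Y S (\<lambda>i\<in>Y. x i + t * (u i - x i))) < card (S - active Y S x)"
          by (rule psubset_card_mono) (use S that(2) in \<open>auto simp: active_def\<close>)
      qed
      obtain s where s: "s > 0" "(\<lambda>i\<in>Y. x i + s * (y i - x i)) \<in> convex_envelope Y V"
        using push_to_new_active_constraint[OF S bounded less.prems i y(2)] reach by blast
      obtain t where t: "t > 0" "(\<lambda>i\<in>Y. x i + t * (y' i - x i)) \<in> convex_envelope Y V"
        using push_to_new_active_constraint[OF S bounded less.prems i(1) i' y'] reach by blast
      show ?thesis
      proof (rule convex_envelope_segment[OF finV s(2) t(2) ext[OF less.prems]])
        show "0 \<le> t / (s + t)" "0 \<le> s / (s + t)" "t / (s + t) + s / (s + t) = 1"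
          using s t by (auto simp: add_divide_distrib[symmetric])
        fix j assume j: "j \<in> Y"
        have "(s + t) * x j = t * (x j + s * (y j - x j)) + s * (x j + t * (y' j - x j))"
          using j by (simp add: y'_def algebra_simps)
        then have "x j = (t * (x j + s * (y j - x j)) + s * (x j + t * (y' j - x j))) / (s + t)"
          using s t by (simp add: eq_divide_eq mult.commute)
        then show "x j = t / (s + t) * (\<lambda>i\<in>Y. x i + s * (y i - x i)) j
            + s / (s + t) * (\<lambda>i\<in>Y. x i + t * (y' i - x i)) j"
          using j by (simp add: add_divide_distrib)
      qed
    qed
  qed
  then have "half_spaces Y S = convex_envelope Y V"
    using half_spaces_convex_envelope[OF VS] by blast
  then show ?thesis using finV VS rat by (intro exI[of _ V] conjI ballI)
qed

text \<open>
  A relation witnessing affine dependence can be subtracted from the weights of \<open>x\<close>, scaled so that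
  the first weight to vanish does so while the others are still nonnegative; this drops a vertex.
\<close>

lemma convex_envelope_caratheodory:
  assumes V: "finite V" and x: "x \<in> convex_envelope Y V"
  shows "\<exists>W\<subseteq>V. affinely_independent Y W \<and> x \<in> convex_envelope Y W"
  using assms
proof (induction "card V" arbitrary: V rule: less_induct)
  case less
  show ?case
  proof (cases "affinely_independent Y V")
    case False
    obtain w where w: "\<forall>v\<in>V. (0::real) \<le> w v" "(\<Sum>v\<in>V. w v) = 1" "\<forall>i\<in>Y. x i = (\<Sum>v\<in>V. w v * v i)"
      using less.prems by (auto simp: convex_envelope_def)
    from False obtain u where u: "(\<Sum>v\<in>V. u v) = (0::real)" "\<forall>i\<in>Y. (\<Sum>v\<in>V. u v * v i) = 0"
      and nz: "\<exists>v\<in>V. u v \<noteq> 0" by (auto simp: affinely_independent_def)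
    define B where "B = {v \<in> V. u v > 0}"
    have "B \<noteq> {}"
    proof
      assume "B = {}"
      then have "\<forall>v\<in>V. u v \<le> 0"
        unfolding B_def by (metis (no_types, lifting) empty_iff linorder_not_less mem_Collect_eq)
      then have "\<forall>v\<in>V. - u v = 0"
        using sum_nonneg_eq_0_iff[of V "\<lambda>v. - u v"] less.prems(1) u(1) by (simp add: sum_negf)
      then show False using nz by auto
    qed
    moreover have "finite B" using less.prems by (simp add: B_def)
    ultimately obtain b where b: "b \<in> B" "\<And>v. v \<in> B \<Longrightarrow> w b / u b \<le> w v / u v"
      using finite_minimizer[of B "\<lambda>v. w v / u v"] by blast
    define t where "t = w b / u b"
    define w' where "w' = (\<lambda>v. w v - t * u v)"
    have bV: "b \<in> V" "u b > 0" using b(1) by (auto simp: B_def)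
    have t: "t \<ge> 0" using bV w(1) by (simp add: t_def)
    have w'b: "w' b = 0" using bV by (simp add: w'_def t_def)
    have pos: "0 \<le> w' v" if "v \<in> V" for v
    proof (cases "u v > 0")
      case True
      then have "t \<le> w v / u v" using b(2)[of v] that by (simp add: t_def B_def)
      then show ?thesis using True by (simp add: w'_def pos_le_divide_eq)
    next
      case False
      then have "t * u v \<le> 0" using t by (simp add: mult_nonneg_nonpos)
      then show ?thesis using w(1) that by (simp add: w'_def) (meson order_trans)
    qed
    have drop: "(\<Sum>v\<in>V - {b}. w' v * g v) = (\<Sum>v\<in>V. w' v * g v)" for g
      using less.prems bV w'b by (intro sum.mono_neutral_left) auto
    have "(\<Sum>v\<in>V. w' v) = 1" using w u by (simp add: w'_def sum_subtractf flip: sum_distrib_left)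
    then have "(\<Sum>v\<in>V - {b}. w' v) = 1" using drop[of "\<lambda>_. 1"] by simp
    moreover have "x i = (\<Sum>v\<in>V - {b}. w' v * v i)" if "i \<in> Y" for i
    proof -
      have "(\<Sum>v\<in>V. w' v * v i) = (\<Sum>v\<in>V. w v * v i) - t * (\<Sum>v\<in>V. u v * v i)"
        by (simp add: w'_def left_diff_distrib sum_subtractf sum_distrib_left mult.assoc)
      then show ?thesis using w(3) u(2) that by (simp add: drop)
    qed
    ultimately have "x \<in> convex_envelope Y (V - {b})"
      using pos less.prems(2) unfolding convex_envelope_def by auto
    moreover have "card (V - {b}) < card V" using less.prems(1) bV by (meson card_Diff1_less)
    ultimately obtain W where "W \<subseteq> V - {b}" "affinely_independent Y W" "x \<in> convex_envelope Y W"
      using less.hyps[of "V - {b}"] less.prems(1) by auto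
    then show ?thesis by blast
  qed (use less.prems in blast)
qed

lemma convex_envelope_mono:
  assumes "finite V" "W \<subseteq> V"
  shows "convex_envelope Y W \<subseteq> convex_envelope Y V"
proof
  fix x assume x: "x \<in> convex_envelope Y W"
  then obtain w where w: "\<forall>v\<in>W. (0::real) \<le> w v" "(\<Sum>v\<in>W. w v) = 1" "\<forall>i\<in>Y. x i = (\<Sum>v\<in>W. w v * v i)"
    by (auto simp: convex_envelope_def)
  define w' where "w' = (\<lambda>v. if v \<in> W then w v else 0)"
  have ext: "(\<Sum>v\<in>V. w' v * g v) = (\<Sum>v\<in>W. w v * g v)" for g
    by (rule sum.mono_neutral_cong_right) (use assms in \<open>auto simp: w'_def\<close>)
  have "(\<Sum>v\<in>V. w' v) = 1" using ext[of "\<lambda>_. 1"] w by simp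
  moreover have "\<forall>v\<in>V. 0 \<le> w' v" using w by (simp add: w'_def)
  ultimately show "x \<in> convex_envelope Y V"
    using x w ext unfolding convex_envelope_def by (auto intro!: exI[of _ w'])
qed

lemma rational_polyhedron_half_spaces:
  assumes Y: "finite Y" and S: "finite S" and bounded: "half_spaces Y S \<subseteq> cube Y"
  shows "rational_polyhedron Y (half_spaces Y S)"
proof -
  obtain V where V: "finite V" "V \<subseteq> half_spaces Y S" "\<forall>v\<in>V. \<forall>i\<in>Y. v i \<in> \<rat>"
    "half_spaces Y S = convex_envelope Y V"
    using half_spaces_generated_by_vertices[OF assms] by blast
  define \<S> where "\<S> = convex_envelope Y ` {W. W \<subseteq> V \<and> affinely_independent Y W}"
  have "\<Union>\<S> = convex_envelope Y V"
  proof
    show "\<Union>\<S> \<subseteq> convex_envelope Y V"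
      unfolding \<S>_def using convex_envelope_mono[OF V(1)] by (intro Union_least) auto
    show "convex_envelope Y V \<subseteq> \<Union>\<S>"
    proof
      fix x assume "x \<in> convex_envelope Y V"
      then obtain W where "W \<subseteq> V" "affinely_independent Y W" "x \<in> convex_envelope Y W"
        using convex_envelope_caratheodory[OF V(1)] by metis
      then show "x \<in> \<Union>\<S>" by (auto simp: \<S>_def)
    qed
  qed
  moreover have "finite \<S>" using V(1) by (simp add: \<S>_def)
  moreover have "rational_simplex Y T" if "T \<in> \<S>" for T
  proof -
    obtain W where W: "W \<subseteq> V" "affinely_independent Y W" "T = convex_envelope Y W"
      using \<open>T \<in> \<S>\<close> by (auto simp: \<S>_def)
    show ?thesis unfolding rational_simplex_def
      by (rule exI[of _ W]) (use W V bounded finite_subset[OF W(1)] in auto)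
  qed
  ultimately show ?thesis unfolding rational_polyhedron_def V(4) by (intro exI[of _ \<S>]) simp
qed

section \<open>Zero sets of McNaughton functions\<close>

text \<open>
  The points at which the affine forms in \<open>P\<close> are ordered in a way that is compatible, up to new
  equalities, with their order at \<open>x\<close>.
\<close>

definition cell :: "'i set \<Rightarrow> (('i \<Rightarrow> int) \<times> int) set \<Rightarrow> ('i \<Rightarrow> real) \<Rightarrow> ('i \<Rightarrow> real) set" where
  "cell Y P x = {y \<in> cube Y. \<forall>p\<in>P. \<forall>q\<in>P.
     affine_form Y p x \<le> affine_form Y q x \<longrightarrow> affine_form Y p y \<le> affine_form Y q y}"

lemma cell_refl: "x \<in> cube Y \<Longrightarrow> x \<in> cell Y P x"
  by (simp add: cell_def)

lemma cell_half_spaces: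
  assumes Y: "finite Y" and P: "finite P"
  shows "\<exists>S. finite S \<and> cell Y P x = half_spaces Y S"
proof -
  obtain S0 where S0: "finite S0" "cube Y = half_spaces Y S0" using cube_half_spaces[OF Y] by blast
  define diff :: "('a \<Rightarrow> int) \<times> int \<Rightarrow> ('a \<Rightarrow> int) \<times> int \<Rightarrow> ('a \<Rightarrow> int) \<times> int"
    where "diff = (\<lambda>p q. (\<lambda>i. 1 * fst p i + - 1 * fst q i, 1 * snd p + - 1 * snd q))"
  have diff: "affine_form Y (diff p q) y = affine_form Y p y - affine_form Y q y" for p q y
    unfolding diff_def affine_form_combination by simp
  define S where "S = (\<lambda>(p, q). diff p q) ` {(p, q) \<in> P \<times> P. affine_form Y p x \<le> affine_form Y q x}"
  have "finite {(p, q) \<in> P \<times> P. affine_form Y p x \<le> affine_form Y q x}"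
    by (rule finite_subset[of _ "P \<times> P"]) (use P in auto)
  then have "finite (S0 \<union> S)" using S0 by (simp add: S_def)
  moreover have "(\<forall>r\<in>S. affine_form Y r y \<le> 0) \<longleftrightarrow> (\<forall>p\<in>P. \<forall>q\<in>P.
      affine_form Y p x \<le> affine_form Y q x \<longrightarrow> affine_form Y p y \<le> affine_form Y q y)" for y
    by (force simp: S_def diff)
  then have "cell Y P x = cube Y \<inter> half_spaces Y S"
    by (simp add: cell_def half_spaces_def cube_def PiE_def Int_def conj_ac)
  then have "cell Y P x = half_spaces Y (S0 \<union> S)" by (simp only: half_spaces_Un S0(2))
  ultimately show ?thesis by (intro exI[of _ "S0 \<union> S"] conjI)
qed

text \<open>
  A cell depends only on which pairs of forms in \<open>P\<close> are in order at \<open>x\<close>.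
\<close>

lemma finite_cells:
  assumes "finite P"
  shows "finite (range (cell Y P))"
proof -
  define pattern where "pattern = (\<lambda>x. {(p, q) \<in> P \<times> P. affine_form Y p x \<le> affine_form Y q x})"
  have "cell Y P x = {y \<in> cube Y. \<forall>(p, q)\<in>pattern x. affine_form Y p y \<le> affine_form Y q y}" for x
    by (auto simp: cell_def pattern_def)
  then have "range (cell Y P) =
      (\<lambda>R. {y \<in> cube Y. \<forall>(p, q)\<in>R. affine_form Y p y \<le> affine_form Y q y}) ` range pattern"
    by (auto simp: image_image)
  moreover have "range pattern \<subseteq> Pow (P \<times> P)" by (auto simp: pattern_def)
  then have "finite (range pattern)" by (rule finite_subset) (use assms in simp)
  ultimately show ?thesis by simp
qed

text \<open>
  On the segment from \<open>x\<close> to \<open>y\<close>, with \<open>y\<close> itself left out, two forms of \<open>P\<close> that differ at \<open>x\<close> differ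
  throughout, and two forms that agree at \<open>x\<close> agree throughout.  Therefore two closed conditions,
  that \<open>g\<close> agrees with \<open>p\<close> and that \<open>g\<close> agrees with a form differing from \<open>p\<close> at \<open>x\<close>, split the
  half-open segment into disjoint parts.  It is connected and the first part contains \<open>x\<close>, so \<open>g\<close>
  agrees with \<open>p\<close> on all of it and, by continuity, at \<open>y\<close>.
\<close>

lemma selection_affine_on_cell:
  assumes Y: "finite Y" and P: "finite P"
    and g: "continuous_map (product_topology (\<lambda>_. top_of_set {0..1}) Y) (top_of_set {0..1}) g"
    and sel: "\<And>z. z \<in> cube Y \<Longrightarrow> \<exists>p\<in>P. g z = affine_form Y p z"
    and x: "x \<in> cube Y" and p: "p \<in> P" "g x = affine_form Y p x" and y: "y \<in> cell Y P x"
  shows "g y = affine_form Y p y"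
proof -
  define z where "z = (\<lambda>t. \<lambda>i\<in>Y. x i + t * (y i - x i))"
  have yc: "y \<in> cube Y" using y by (simp add: cell_def)
  have z01: "z t \<in> cube Y" if t: "t \<in> {0..1}" for t
  proof -
    have "x i + t * (y i - x i) \<in> {0..1}" if "i \<in> Y" for i
    proof -
      have "x i \<in> {0..1}" "y i \<in> {0..1}" using x yc that by (auto simp: cube_def)
      then have "(1 - t) * x i \<ge> 0" "t * y i \<ge> 0" "(1 - t) * (1 - x i) \<ge> 0" "t * (1 - y i) \<ge> 0"
        using t by (auto intro!: mult_nonneg_nonneg)
      then show ?thesis by (simp add: algebra_simps)
    qed
    then show ?thesis by (simp add: z_def cube_def)
  qed
  have z: "affine_form Y q (z t) = (1 - t) * affine_form Y q x + t * affine_form Y q y" for q t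
    unfolding z_def affine_form_segment by (simp add: algebra_simps)
  have "continuous_map (top_of_set {0..1}) (product_topology (\<lambda>_. top_of_set {0..1}) Y) z"
    unfolding continuous_map_componentwise
  proof (intro conjI ballI)
    show "z ` topspace (top_of_set {0..1}) \<subseteq> extensional Y" by (auto simp: z_def)
    fix i assume i: "i \<in> Y"
    have "continuous_on {0..1} (\<lambda>t. z t i)" unfolding z_def using i by (auto intro!: continuous_intros)
    moreover have "(\<lambda>t. z t i) \<in> {0..1} \<rightarrow> {0..1}"
      using z01 i unfolding cube_def by (intro Pi_I) (rule PiE_mem)
    ultimately show "continuous_map (top_of_set {0..1}) (top_of_set {0..1}) (\<lambda>t. z t i)"
      by simp
  qed
  then have "continuous_map (top_of_set {0..1}) (top_of_set {0..1}) (g \<circ> z)"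
    using g by (rule continuous_map_compose)
  then have gz: "continuous_on {0..1} (\<lambda>t. g (z t))" by (simp add: comp_def)
  have az: "continuous_on {0..1} (\<lambda>t. affine_form Y q (z t))" for q
    unfolding z by (intro continuous_intros)
  define D where "D = (\<lambda>q t. g (z t) - affine_form Y q (z t))"
  have Dc: "continuous_on {0..1} (D q)" for q unfolding D_def by (intro continuous_intros gz az)
  define Q where "Q = {q \<in> P. affine_form Y q x \<noteq> affine_form Y p x}"
  have finQ: "finite Q" using P by (simp add: Q_def)
  define A where "A = {t \<in> {0..1}. D p t = 0}"
  define B where "B = {t \<in> {0..1}. (\<Prod>q\<in>Q. D q t) = 0}"
  have "closed A" unfolding A_def
    by (rule continuous_closed_preimage_constant[OF Dc closed_atLeastAtMost])
  have "continuous_on {0..1} (\<lambda>t. \<Prod>q\<in>Q. D q t)" by (intro continuous_intros Dc)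
  then have "closed B" unfolding B_def
    by (rule continuous_closed_preimage_constant[OF _ closed_atLeastAtMost])
  have cover: "{0..<1} \<subseteq> A \<union> B"
  proof
    fix t :: real assume t: "t \<in> {0..<1}"
    from t have "t \<in> {0..1}" by simp
    from sel[OF z01[OF this]] obtain q where q: "q \<in> P" "g (z t) = affine_form Y q (z t)" by blast
    show "t \<in> A \<union> B"
    proof (cases "q \<in> Q")
      case True
      then have "(\<Prod>q\<in>Q. D q t) = 0" using finQ q by (auto simp: D_def)
      then show ?thesis using t by (simp add: B_def)
    next
      case False
      then have eq: "affine_form Y q x = affine_form Y p x" using q by (simp add: Q_def)
      then have "affine_form Y q y = affine_form Y p y"
        using y q(1) p(1) by (auto simp: cell_def intro: antisym)
      then have "affine_form Y q (z t) = affine_form Y p (z t)" using eq by (simp add: z)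
      then show ?thesis using q(2) t by (simp add: A_def D_def)
    qed
  qed
  have disjoint: "A \<inter> B \<inter> {0..<1} = {}"
  proof (rule ccontr)
    assume "A \<inter> B \<inter> {0..<1} \<noteq> {}"
    then obtain t where t: "t \<in> A" "t \<in> B" "0 \<le> t" "t < 1" by auto
    then obtain q where q: "q \<in> Q" "D q t = 0" using finQ by (auto simp: B_def)
    then have eq: "affine_form Y q (z t) = affine_form Y p (z t)" using t(1) by (simp add: A_def D_def)
    have strict: "(1 - t) * a + t * c < (1 - t) * b + t * d" if "a < b" "c \<le> d" for a b c d :: real
      using that t by (intro add_less_le_mono mult_strict_left_mono mult_left_mono) auto
    have "affine_form Y q x \<noteq> affine_form Y p x" using q(1) by (simp add: Q_def)
    then consider "affine_form Y q x < affine_form Y p x" | "affine_form Y p x < affine_form Y q x"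
      by (rule linorder_neqE_linordered_idom)
    then show False
    proof cases
      case 1
      then have "affine_form Y q y \<le> affine_form Y p y" using y p(1) q(1) by (auto simp: cell_def Q_def)
      from strict[OF 1 this] show False using eq by (simp add: z)
    next
      case 2
      then have "affine_form Y p y \<le> affine_form Y q y" using y p(1) q(1) by (auto simp: cell_def Q_def)
      from strict[OF 2 this] show False using eq by (simp add: z)
    qed
  qed
  have "z 0 = x" using x by (auto simp: z_def cube_def fun_eq_iff PiE_iff extensional_def)
  then have "0 \<in> A" using p(2) by (simp add: A_def D_def)
  then have "A \<inter> {0..<1} \<noteq> {}" by force
  moreover have "connected {0..<1::real}" by (rule convex_connected) simp
  ultimately have "B \<inter> {0..<1} = {}"
    using cover disjoint \<open>closed A\<close> \<open>closed B\<close> unfolding connected_closed by meson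
  then have "{0..<1} \<subseteq> A" using cover by blast
  then have "closure {0..<1} \<subseteq> A" using \<open>closed A\<close> by (rule closure_minimal)
  then have "1 \<in> A" by (auto simp: subset_iff)
  moreover have "z 1 = y" using yc by (auto simp: z_def cube_def fun_eq_iff PiE_iff extensional_def)
  ultimately show ?thesis by (simp add: A_def D_def)
qed

lemma fin_mcnaughton_selection:
  assumes "fin_mcnaughton Y g"
  shows "\<exists>P. finite P \<and> (\<forall>z\<in>cube Y. \<exists>p\<in>P. g z = affine_form Y p z)"
proof -
  obtain P :: "(('a \<Rightarrow> int) \<times> int) set" where P: "finite P"
    "\<forall>z\<in>cube Y. \<exists>(a, b)\<in>P. g z = (\<Sum>i\<in>Y. of_int (a i) * z i) + of_int b"
    using assms by (auto simp: fin_mcnaughton_def)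
  have "\<exists>p\<in>P. g z = affine_form Y p z" if z: "z \<in> cube Y" for z
  proof -
    obtain a b where "(a, b) \<in> P" "g z = (\<Sum>i\<in>Y. of_int (a i) * z i) + of_int b" using P(2) z by blast
    then show ?thesis by (intro bexI[of _ "(a, b)"]) (simp_all add: affine_form_def)
  qed
  then show ?thesis using P(1) by blast
qed

text \<open>
  With the zero form adjoined to the affine pieces of \<open>g\<close>, the cell of any zero of \<open>g\<close> consists of
  zeros.  The zero set is thus a union of cells, which are finitely many rational polytopes.
\<close>

lemma fin_mcnaughton_zero_set:
  assumes Y: "finite Y" and g: "fin_mcnaughton Y g"
  shows "rational_polyhedron Y {x \<in> cube Y. g x = 0}"
proof -
  obtain P0 where P0: "finite P0" "\<forall>z\<in>cube Y. \<exists>p\<in>P0. g z = affine_form Y p z"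
    using fin_mcnaughton_selection[OF g] by blast
  define P where "P = insert (\<lambda>_. 0, 0) P0"
  have P: "finite P" using P0 by (simp add: P_def)
  have sel: "\<exists>p\<in>P. g z = affine_form Y p z" if "z \<in> cube Y" for z using P0 that by (auto simp: P_def)
  have cont: "continuous_map (product_topology (\<lambda>_. top_of_set {0..1}) Y) (top_of_set {0..1}) g"
    using g by (simp only: fin_mcnaughton_def)
  define Z where "Z = {x \<in> cube Y. g x = 0}"
  define \<C> where "\<C> = cell Y P ` Z"
  have "cell Y P x \<subseteq> Z" if "x \<in> Z" for x
  proof
    fix y assume y: "y \<in> cell Y P x"
    have "g y = affine_form Y (\<lambda>_. 0, 0) y"
      by (rule selection_affine_on_cell[OF Y P cont sel _ _ _ y])
        (use that in \<open>auto simp: Z_def P_def affine_form_zero\<close>)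
    then show "y \<in> Z" using y by (simp add: Z_def cell_def affine_form_zero)
  qed
  then have Z: "Z = \<Union>\<C>" using cell_refl by (force simp: \<C>_def Z_def)
  have fin: "finite \<C>" using finite_cells[OF P, of Y] by (rule finite_subset[rotated]) (auto simp: \<C>_def)
  have "rational_polyhedron Y C" if "C \<in> \<C>" for C
  proof -
    obtain x where x: "C = cell Y P x" using \<open>C \<in> \<C>\<close> by (auto simp: \<C>_def)
    then obtain S where S: "finite S" "C = half_spaces Y S" using cell_half_spaces[OF Y P, of x] by blast
    have "half_spaces Y S \<subseteq> cube Y" using S x by (auto simp: cell_def)
    from rational_polyhedron_half_spaces[OF Y S(1) this] show ?thesis using S by simp
  qed
  then obtain \<S> where \<S>: "\<And>C. C \<in> \<C> \<Longrightarrow> finite (\<S> C) \<and> (\<forall>S\<in>\<S> C. rational_simplex Y S) \<and> C = \<Union>(\<S> C)"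
    unfolding rational_polyhedron_def by metis
  have "rational_polyhedron Y Z" unfolding rational_polyhedron_def
  proof (intro exI conjI)
    show "finite (\<Union>(\<S> ` \<C>))" "\<forall>S\<in>\<Union>(\<S> ` \<C>). rational_simplex Y S" using fin \<S> by auto
    have "\<Union>(\<Union>(\<S> ` \<C>)) = (\<Union>C\<in>\<C>. \<Union>(\<S> C))" by blast
    also have "\<dots> = (\<Union>C\<in>\<C>. C)" by (rule SUP_cong[OF refl]) (use \<S> in metis)
    finally show "Z = \<Union>(\<Union>(\<S> ` \<C>))" unfolding Z by simp
  qed
  then show ?thesis by (simp add: Z_def)
qed

text \<open>
  On a cell both functions are affine, so it suffices to compare them at the vertices.  At a
  vertex \<open>v\<close> either \<open>g v > 0\<close> and a large multiple of \<open>g v\<close> is at least \<open>1\<close>, or \<open>g v = 0\<close> and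
  then \<open>f v = 0\<close>.
\<close>

lemma fin_mcnaughton_dominated:
  assumes Y: "finite Y" and f: "fin_mcnaughton Y f" and g: "fin_mcnaughton Y g"
    and zeros: "\<And>x. x \<in> cube Y \<Longrightarrow> g x = 0 \<Longrightarrow> f x = 0"
  shows "\<exists>n::nat. \<forall>x\<in>cube Y. f x \<le> real n * g x"
proof -
  obtain Pf where Pf: "finite Pf" "\<forall>z\<in>cube Y. \<exists>p\<in>Pf. f z = affine_form Y p z"
    using fin_mcnaughton_selection[OF f] by blast
  obtain Pg where Pg: "finite Pg" "\<forall>z\<in>cube Y. \<exists>p\<in>Pg. g z = affine_form Y p z"
    using fin_mcnaughton_selection[OF g] by blast
  define P where "P = Pf \<union> Pg"
  have P: "finite P" using Pf Pg by (simp add: P_def)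
  have self: "\<exists>p\<in>P. f z = affine_form Y p z" and selg: "\<exists>p\<in>P. g z = affine_form Y p z"
    if "z \<in> cube Y" for z using Pf Pg that by (auto simp: P_def)
  have contf: "continuous_map (product_topology (\<lambda>_. top_of_set {0..1}) Y) (top_of_set {0..1}) f"
    and contg: "continuous_map (product_topology (\<lambda>_. top_of_set {0..1}) Y) (top_of_set {0..1}) g"
    using f g by (simp_all only: fin_mcnaughton_def)
  have "\<exists>n::nat. \<forall>y\<in>cell Y P x. f y \<le> real n * g y" if x: "x \<in> cube Y" for x
  proof -
    obtain p q where p: "p \<in> P" "f x = affine_form Y p x" and q: "q \<in> P" "g x = affine_form Y q x"
      using self selg x by blast
    have fp: "f y = affine_form Y p y" and gq: "g y = affine_form Y q y" if "y \<in> cell Y P x" for y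
      using selection_affine_on_cell[OF Y P contf self x p that]
        selection_affine_on_cell[OF Y P contg selg x q that] by auto
    obtain S where S: "finite S" "cell Y P x = half_spaces Y S" using cell_half_spaces[OF Y P, of x] by blast
    have "half_spaces Y S \<subseteq> cube Y" using S by (auto simp: cell_def)
    then obtain V where V: "finite V" "V \<subseteq> cell Y P x" "cell Y P x = convex_envelope Y V"
      using half_spaces_generated_by_vertices[OF Y S(1)] S(2) by metis
    \<comment> \<open>The sum bounds \<open>1 / g v\<close> at every vertex, since \<open>1 / 0 = 0\<close> and all terms are nonnegative.\<close>
    define n where "n = nat \<lceil>\<Sum>v\<in>V. 1 / g v\<rceil>"
    have V01: "f v \<in> {0..1}" "g v \<in> {0..1}" "v \<in> cube Y" if "v \<in> V" for v
      using V(2) that fin_mcnaughton_range[OF f] fin_mcnaughton_range[OF g] by (auto simp: cell_def)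
    have vertex: "f v \<le> real n * g v" if v: "v \<in> V" for v
    proof (cases "g v = 0")
      case True
      then show ?thesis using zeros V01[OF v] by simp
    next
      case False
      then have pos: "g v > 0" using V01[OF v] by simp
      have "1 / g v \<le> (\<Sum>v\<in>V. 1 / g v)" using V01 V(1) v by (intro member_le_sum) auto
      then have "1 / g v \<le> real n" unfolding n_def by linarith
      then have "1 \<le> real n * g v" using pos by (simp add: pos_divide_le_eq)
      then show ?thesis using V01[OF v] by auto
    qed
    have "f y \<le> real n * g y" if y: "y \<in> cell Y P x" for y
    proof -
      obtain w where w: "\<forall>v\<in>V. (0::real) \<le> w v" "(\<Sum>v\<in>V. w v) = 1" "\<forall>i\<in>Y. y i = (\<Sum>v\<in>V. w v * v i)"
        using y V(3) by (auto simp: convex_envelope_def)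
      have comb: "affine_form Y r y = (\<Sum>v\<in>V. w v * affine_form Y r v)" for r
        by (rule affine_form_convex_combination) (use w in auto)
      have "f y = (\<Sum>v\<in>V. w v * f v)" using comb[of p] fp[OF y] fp V(2) by (simp add: subset_iff)
      also have "\<dots> \<le> (\<Sum>v\<in>V. w v * (real n * g v))"
        using w vertex by (intro sum_mono mult_left_mono) auto
      also have "\<dots> = real n * (\<Sum>v\<in>V. w v * g v)" by (simp add: sum_distrib_left mult.left_commute)
      also have "(\<Sum>v\<in>V. w v * g v) = g y" using comb[of q] gq[OF y] gq V(2) by (simp add: subset_iff)
      finally show ?thesis .
    qed
    then show ?thesis by blast
  qed
  then have "\<exists>n::nat. \<forall>y\<in>C. f y \<le> real n * g y" if "C \<in> cell Y P ` cube Y" for C using that by blast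
  then obtain n :: "_ \<Rightarrow> nat" where n: "\<And>C y. C \<in> cell Y P ` cube Y \<Longrightarrow> y \<in> C \<Longrightarrow> f y \<le> real (n C) * g y"
    by metis
  define N where "N = (\<Sum>C\<in>cell Y P ` cube Y. n C)"
  have fin: "finite (cell Y P ` cube Y)" using finite_cells[OF P, of Y] by (rule finite_subset[rotated]) auto
  have "f y \<le> real N * g y" if y: "y \<in> cube Y" for y
  proof -
    have C: "cell Y P y \<in> cell Y P ` cube Y" using y by blast
    have "f y \<le> real (n (cell Y P y)) * g y" by (rule n[OF C cell_refl[OF y]])
    also have "\<dots> \<le> real N * g y"
    proof (rule mult_right_mono)
      show "real (n (cell Y P y)) \<le> real N" unfolding N_def using fin C
        by (simp add: member_le_sum del: of_nat_sum)
      show "0 \<le> g y" using fin_mcnaughton_range[OF g y] by simp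
    qed
    finally show ?thesis .
  qed
  then show ?thesis by blast
qed

definition zero_set :: "'u set \<Rightarrow> (('u \<Rightarrow> real) \<Rightarrow> real) \<Rightarrow> ('u \<Rightarrow> real) set" where
  "zero_set K f = {x \<in> cube K. f x = 0}"

text \<open>
  The infimum of the natural order, as a term in the MV-operations, so that homomorphisms preserve it.
  In \<open>Free K\<close> it is the pointwise minimum.
\<close>

definition mv_inf :: "'a mv \<Rightarrow> 'a \<Rightarrow> 'a \<Rightarrow> 'a" where
  "mv_inf A x y = mv_neg A (mv_plus A (mv_neg A (mv_plus A x (mv_neg A y))) (mv_neg A y))"

lemma mv_carrier_Free: "f \<in> mv_carrier (Free K) \<longleftrightarrow> mcnaughton K f"
  by (simp add: Free_def)

lemma mv_le_Free:
  assumes "mcnaughton K f" "mcnaughton K g"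
  shows "mv_le (Free K) f g \<longleftrightarrow> (\<forall>x\<in>cube K. f x \<le> g x)"
proof -
  have "(min 1 (1 - f x + g x) = 1) = (f x \<le> g x)" for x by (auto simp: min_def)
  then show ?thesis by (auto simp: mv_le_def Free_def fun_eq_iff)
qed

lemma mcnaughton_inf:
  assumes "mcnaughton K f" "mcnaughton K g"
  shows "mcnaughton K (mv_inf (Free K) f g)"
  using mv_algebra_Free[of K] assms
  by (simp add: mv_inf_def mv_algebra_def mv_carrier_Free)

lemma mv_inf_Free_apply:
  assumes "mcnaughton K f" "mcnaughton K g" "x \<in> cube K"
  shows "mv_inf (Free K) f g x = min (f x) (g x)"
  using mcnaughton_range[OF assms(1,3)] mcnaughton_range[OF assms(2,3)] assms(3)
  by (auto simp: mv_inf_def Free_def min_def)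

lemma zero_set_inf:
  assumes "mcnaughton K f" "mcnaughton K g"
  shows "zero_set K (mv_inf (Free K) f g) = zero_set K f \<union> zero_set K g"
proof -
  have "min (f x) (g x) = 0 \<longleftrightarrow> f x = 0 \<or> g x = 0" if "x \<in> cube K" for x
    using mcnaughton_range[OF assms(1) that] mcnaughton_range[OF assms(2) that] by (auto simp: min_def)
  then show ?thesis unfolding zero_set_def
    by (simp add: mv_inf_Free_apply[OF assms] Collect_disj_eq[symmetric] conj_disj_distribL[symmetric] cong: conj_cong)
qed

lemma zero_set_plus:
  assumes "mcnaughton K f" "mcnaughton K g"
  shows "zero_set K (mv_plus (Free K) f g) = zero_set K f \<inter> zero_set K g"
proof -
  have "min 1 (f x + g x) = 0 \<longleftrightarrow> f x = 0 \<and> g x = 0" if "x \<in> cube K" for x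
    using mcnaughton_range[OF assms(1) that] mcnaughton_range[OF assms(2) that] by (auto simp: min_def)
  then have "x \<in> zero_set K (mv_plus (Free K) f g) \<longleftrightarrow> x \<in> zero_set K f \<inter> zero_set K g" for x
    by (auto simp: zero_set_def Free_def)
  then show ?thesis by blast
qed

lemma zero_set_zero: "zero_set K (mv_zero (Free K)) = cube K"
  by (simp add: zero_set_def Free_def)

lemma zero_set_one: "zero_set K (mv_neg (Free K) (mv_zero (Free K))) = {}"
  by (simp add: zero_set_def Free_def)

lemma cube_extend:
  assumes "Y \<subseteq> K" "y \<in> cube Y"
  shows "\<exists>x\<in>cube K. restrict x Y = y"
proof
  show "(\<lambda>i\<in>K. if i \<in> Y then y i else 0) \<in> cube K" using assms by (auto simp: cube_def)
  show "restrict (\<lambda>i\<in>K. if i \<in> Y then y i else 0) Y = y"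
    using assms by (auto simp: cube_def fun_eq_iff PiE_iff extensional_def)
qed

theorem zero_set_in_Cypol:
  assumes "mcnaughton K f"
  shows "zero_set K f \<in> Cypol K"
proof -
  obtain Y g where Y: "Y \<subseteq> K" "finite Y" "fin_mcnaughton Y g" "\<forall>x\<in>cube K. f x = g (restrict x Y)"
    using assms by (auto simp: mcnaughton_def)
  have "zero_set K f = {x \<in> cube K. restrict x Y \<in> {y \<in> cube Y. g y = 0}}"
    using Y restrict_cube[OF _ Y(1)] by (auto simp: zero_set_def)
  then show ?thesis using fin_mcnaughton_zero_set[OF Y(2,3)] Y(1,2) unfolding Cypol_def by blast
qed

text \<open>
  Both functions factor through the finitely many coordinates on which one or the other depends, where
  the finite-dimensional case applies.
\<close>

theorem mcnaughton_dominated: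
  assumes f: "mcnaughton K f" and g: "mcnaughton K g" and zeros: "zero_set K g \<subseteq> zero_set K f"
  shows "\<exists>n::nat. \<forall>x\<in>cube K. f x \<le> real n * g x"
proof -
  obtain Y1 f0 where Y1: "Y1 \<subseteq> K" "finite Y1" "fin_mcnaughton Y1 f0" "\<forall>x\<in>cube K. f x = f0 (restrict x Y1)"
    using f by (auto simp: mcnaughton_def)
  obtain Y2 g0 where Y2: "Y2 \<subseteq> K" "finite Y2" "fin_mcnaughton Y2 g0" "\<forall>x\<in>cube K. g x = g0 (restrict x Y2)"
    using g by (auto simp: mcnaughton_def)
  define Y where "Y = Y1 \<union> Y2"
  have Y: "finite Y" "Y \<subseteq> K" "Y1 \<subseteq> Y" "Y2 \<subseteq> Y" using Y1 Y2 by (auto simp: Y_def)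
  have rr: "restrict (restrict x Y) Y1 = restrict x Y1" "restrict (restrict x Y) Y2 = restrict x Y2"
    for x :: "'a \<Rightarrow> real" using Y by (auto simp: Int_absorb1)
  have "\<exists>n::nat. \<forall>y\<in>cube Y. f0 (restrict y Y1) \<le> real n * g0 (restrict y Y2)"
  proof (rule fin_mcnaughton_dominated[OF Y(1)])
    show "fin_mcnaughton Y (\<lambda>y. f0 (restrict y Y1))" "fin_mcnaughton Y (\<lambda>y. g0 (restrict y Y2))"
      using fin_mcnaughton_lift Y Y1 Y2 by blast+
    fix y assume y: "y \<in> cube Y" "g0 (restrict y Y2) = 0"
    obtain x where x: "x \<in> cube K" "restrict x Y = y" using cube_extend[OF Y(2) y(1)] by blast
    have yx: "restrict y Y1 = restrict x Y1" "restrict y Y2 = restrict x Y2"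
      by (simp_all only: x(2)[symmetric] rr)
    have "g x = 0" using y(2) Y2(4) x(1) by (simp only: yx)
    then have "x \<in> zero_set K f" using zeros x(1) by (auto simp: zero_set_def)
    then show "f0 (restrict y Y1) = 0" using Y1(4) x(1) by (simp add: zero_set_def yx)
  qed
  then obtain n :: nat where n: "\<And>y. y \<in> cube Y \<Longrightarrow> f0 (restrict y Y1) \<le> real n * g0 (restrict y Y2)" by blast
  have "f x \<le> real n * g x" if x: "x \<in> cube K" for x
    using n[OF restrict_cube[OF x Y(2)]] Y1(4) Y2(4) x by (simp only: rr)
  then show ?thesis by blast
qed

text \<open>
  Truncating an integral affine form to \<open>[0, 1]\<close> gives a McNaughton function that vanishes exactly
  where the form is not positive.
\<close>

lemma mcnaughton_half_space:
  assumes Y: "Y \<subseteq> K" "finite Y"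
  shows "\<exists>f. mcnaughton K f \<and> zero_set K f = {x \<in> cube K. affine_form Y p x \<le> 0}"
proof -
  define g where "g = (\<lambda>x. max 0 (min 1 (affine_form Y p x)))"
  have "continuous_map (product_topology (\<lambda>_. top_of_set {0..1}) Y) euclideanreal (\<lambda>x. x i)" if "i \<in> Y" for i
    using continuous_map_product_projection[OF that, of "\<lambda>_. top_of_set {0..1::real}"]
    by (rule continuous_map_into_fulltopology)
  then have "continuous_map (product_topology (\<lambda>_. top_of_set {0..1}) Y) euclideanreal g"
    unfolding g_def affine_form_def using Y(2)
    by (intro continuous_map_real_max continuous_map_real_min continuous_map_add continuous_map_sum
        continuous_map_real_mult) auto
  moreover have "g x \<in> {0..1}" for x by (auto simp: g_def)
  ultimately have "continuous_map (product_topology (\<lambda>_. top_of_set {0..1}) Y) (top_of_set {0..1}) g"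
    by (simp add: continuous_map_in_subtopology image_subset_iff)
  moreover have "\<exists>(a, b)\<in>{p, (\<lambda>_. 0, 0), (\<lambda>_. 0, 1)}. g x = (\<Sum>i\<in>Y. of_int (a i) * x i) + of_int b" for x
    by (auto simp: g_def affine_form_def max_def min_def split: prod.splits)
  ultimately have g: "fin_mcnaughton Y g" unfolding fin_mcnaughton_def
    by (intro conjI exI[of _ "{p, (\<lambda>_. 0, 0), (\<lambda>_. 0, 1)}"] ballI) auto
  define f where "f = (\<lambda>x\<in>cube K. g (restrict x Y))"
  have "mcnaughton K f" unfolding mcnaughton_def f_def using g Y
    by (intro conjI exI[of _ Y] exI[of _ g]) auto
  moreover have "affine_form Y p (restrict x Y) = affine_form Y p x" for x by (intro affine_form_cong) simp
  then have "zero_set K f = {x \<in> cube K. affine_form Y p x \<le> 0}"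
    by (auto simp: zero_set_def f_def g_def max_def min_def)
  ultimately show ?thesis by blast
qed

lemma zero_set_finite_Inter:
  assumes "finite \<A>" "\<And>A. A \<in> \<A> \<Longrightarrow> \<exists>f. mcnaughton K f \<and> zero_set K f = A"
  shows "\<exists>f. mcnaughton K f \<and> zero_set K f = cube K \<inter> \<Inter>\<A>"
  using assms
proof (induction \<A> rule: finite_induct)
  case empty
  have "mcnaughton K (mv_zero (Free K))" using mcnaughton_zero by (simp add: Free_def)
  then show ?case using zero_set_zero[of K] by (intro exI[of _ "mv_zero (Free K)"]) simp
next
  case (insert A \<A>)
  obtain f where f: "mcnaughton K f" "zero_set K f = A" using insert.prems by blast
  obtain g where g: "mcnaughton K g" "zero_set K g = cube K \<inter> \<Inter>\<A>" using insert by blast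
  have "mcnaughton K (mv_plus (Free K) f g)" using mcnaughton_plus[OF f(1) g(1)] by (simp add: Free_def)
  then show ?case using zero_set_plus[OF f(1) g(1)] f(2) g(2)
    by (intro exI[of _ "mv_plus (Free K) f g"]) (auto simp: zero_set_def)
qed

lemma zero_set_finite_Union:
  assumes "finite \<A>" "\<And>A. A \<in> \<A> \<Longrightarrow> \<exists>f. mcnaughton K f \<and> zero_set K f = A"
  shows "\<exists>f. mcnaughton K f \<and> zero_set K f = \<Union>\<A>"
  using assms
proof (induction \<A> rule: finite_induct)
  case empty
  have "mv_neg (Free K) (mv_zero (Free K)) \<in> mv_carrier (Free K)"
    using mv_algebra_Free[of K] by (simp add: mv_algebra_def)
  then show ?case using zero_set_one[of K]
    by (intro exI[of _ "mv_neg (Free K) (mv_zero (Free K))"]) (simp add: mv_carrier_Free)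
next
  case (insert A \<A>)
  obtain f where f: "mcnaughton K f" "zero_set K f = A" using insert.prems by blast
  obtain g where g: "mcnaughton K g" "zero_set K g = \<Union>\<A>" using insert by blast
  show ?case using mcnaughton_inf[OF f(1) g(1)] zero_set_inf[OF f(1) g(1)] f(2) g(2)
    by (intro exI[of _ "mv_inf (Free K) f g"]) simp
qed

text \<open>
  A rational simplex is a finite intersection of half-spaces, and zero sets are closed under finite
  intersections (sums) and finite unions (infima).
\<close>

theorem Cypol_zero_set:
  assumes "A \<in> Cypol K"
  shows "\<exists>f. mcnaughton K f \<and> zero_set K f = A"
proof -
  obtain Y P where Y: "Y \<subseteq> K" "finite Y" and P: "rational_polyhedron Y P"
    and A: "A = {x \<in> cube K. restrict x Y \<in> P}" using assms by (auto simp: Cypol_def)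
  obtain \<S> where \<S>: "finite \<S>" "\<forall>S\<in>\<S>. rational_simplex Y S" "P = \<Union>\<S>"
    using P by (auto simp: rational_polyhedron_def)
  define cyl where "cyl = (\<lambda>S. {x \<in> cube K. restrict x Y \<in> S})"
  have "\<exists>f. mcnaughton K f \<and> zero_set K f = cyl S" if S: "S \<in> \<S>" for S
  proof -
    obtain V where V: "finite V" "\<forall>v\<in>V. \<forall>i\<in>Y. v i \<in> \<rat>" "S = convex_envelope Y V"
      using \<S>(2) S by (auto simp: rational_simplex_def)
    have "\<exists>T. finite T \<and> S = half_spaces Y T"
      unfolding V(3) by (rule convex_envelope_half_spaces[OF Y(2) V(1)]) (use V(2) in auto)
    then obtain T where T: "finite T" "S = half_spaces Y T" by (elim exE conjE) (rule that)
    define \<H> where "\<H> = (\<lambda>p. {x \<in> cube K. affine_form Y p x \<le> 0}) ` T"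
    have "affine_form Y p (restrict x Y) = affine_form Y p x" for p x by (intro affine_form_cong) simp
    then have "cyl S = cube K \<inter> \<Inter>\<H>" unfolding T cyl_def half_spaces_def \<H>_def by auto
    moreover have "\<exists>f. mcnaughton K f \<and> zero_set K f = cube K \<inter> \<Inter>\<H>"
    proof (rule zero_set_finite_Inter)
      show "finite \<H>" using T by (simp add: \<H>_def)
      show "\<exists>f. mcnaughton K f \<and> zero_set K f = H" if "H \<in> \<H>" for H
        using that mcnaughton_half_space[OF Y] by (auto simp: \<H>_def)
    qed
    ultimately show ?thesis by simp
  qed
  then have "\<exists>f. mcnaughton K f \<and> zero_set K f = \<Union>(cyl ` \<S>)"
    using \<S>(1) by (intro zero_set_finite_Union) auto
  moreover have "\<Union>(cyl ` \<S>) = A" by (auto simp: A \<S>(3) cyl_def)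
  ultimately show ?thesis by simp
qed

section \<open>Spectral spaces and their closed subspaces\<close>

lemma spectral_basis:
  assumes X: "spectral_space X" and A: "openin X A" and x: "x \<in> A"
  obtains U where "compact_openin X U" "x \<in> U" "U \<subseteq> A"
proof -
  have "(arbitrary union_of (compact_openin X)) A" using X A by (metis spectral_space_def)
  then show thesis using x that by (auto simp: arbitrary_union_of_alt)
qed

lemma compact_openin_Union:
  assumes "finite \<F>" "\<And>U. U \<in> \<F> \<Longrightarrow> compact_openin X U"
  shows "compact_openin X (\<Union>\<F>)"
  using assms by (auto simp: compact_openin_def intro: compactin_Union)

lemma compact_openin_topspace: "spectral_space X \<Longrightarrow> compact_openin X (topspace X)"
proof -
  assume "spectral_space X"
  then have "compactin X (topspace X)" by (simp add: spectral_space_def compact_space_def)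
  then show ?thesis by (simp add: compact_openin_def)
qed

lemma irreducible_closure_of_point:
  assumes "x \<in> topspace X"
  shows "irreducible_closedin X (X closure_of {x})"
  unfolding irreducible_closedin_def
proof (intro conjI allI impI)
  have x: "x \<in> X closure_of {x}" using assms closure_of_subset[of "{x}" X] by auto
  then show "X closure_of {x} \<noteq> {}" by blast
  fix A B assume AB: "closedin X A \<and> closedin X B \<and> X closure_of {x} = A \<union> B"
  then have "x \<in> A \<or> x \<in> B" using x by blast
  then have "X closure_of {x} \<subseteq> A \<or> X closure_of {x} \<subseteq> B"
    using AB closure_of_minimal[of "{x}" A X] closure_of_minimal[of "{x}" B X] by auto
  then show "X closure_of {x} = A \<or> X closure_of {x} = B" using AB by blast
qed simp

text \<open>
  Points in the same compact open sets have the same closure, and sobriety lets a closure have only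
  one generic point.
\<close>

lemma spectral_separation:
  assumes X: "spectral_space X" and x: "x \<in> topspace X" and y: "y \<in> topspace X"
    and eq: "\<And>U. compact_openin X U \<Longrightarrow> x \<in> U \<longleftrightarrow> y \<in> U"
  shows "x = y"
proof -
  have "x \<in> A \<longleftrightarrow> y \<in> A" if A: "openin X A" for A
  proof
    assume "x \<in> A"
    then obtain U where "compact_openin X U" "x \<in> U" "U \<subseteq> A" using spectral_basis[OF X A] by blast
    then show "y \<in> A" using eq by blast
  next
    assume "y \<in> A"
    then obtain U where "compact_openin X U" "y \<in> U" "U \<subseteq> A" using spectral_basis[OF X A] by blast
    then show "x \<in> A" using eq by blast
  qed
  then have "X closure_of {x} = X closure_of {y}" by (auto simp: closure_of_def)
  moreover have "\<exists>!z. z \<in> topspace X \<and> X closure_of {x} = X closure_of {z}"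
    using X irreducible_closure_of_point[OF x] by (auto simp: spectral_space_def sober_space_def)
  ultimately show ?thesis using x y by blast
qed

lemma spectral_map_continuous:
  assumes Y: "spectral_space Y" and f: "f \<in> spectral_map X Y"
  shows "continuous_map X Y f"
  unfolding continuous_map
proof (intro conjI allI impI)
  show "f ` topspace X \<subseteq> topspace Y" using f by (auto simp: spectral_map_def)
  fix A assume A: "openin Y A"
  show "openin X {x \<in> topspace X. f x \<in> A}"
  proof (subst openin_subopen, intro ballI)
    fix x assume x: "x \<in> {x \<in> topspace X. f x \<in> A}"
    then obtain U where U: "compact_openin Y U" "f x \<in> U" "U \<subseteq> A" using spectral_basis[OF Y A] by blast
    have "openin X {x \<in> topspace X. f x \<in> U}"
      using f U(1) by (auto simp: spectral_map_def compact_openin_def)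
    then show "\<exists>T. openin X T \<and> x \<in> T \<and> T \<subseteq> {x \<in> topspace X. f x \<in> A}"
      using U(2,3) x by (intro exI[of _ "{x \<in> topspace X. f x \<in> U}"]) auto
  qed
qed

text \<open>
  The compact open sets \<open>\<phi> U\<close> with \<open>x \<notin> U\<close> should be those that omit the point \<open>y\<close> to be found.  The
  complement \<open>S\<close> of their union is irreducible: by compactness, a compact open set misses \<open>S\<close> only if
  it is contained in a single such \<open>\<phi> U\<close>, and the family of all \<open>U\<close> with \<open>x \<notin> U\<close> contains an
  intersection \<open>V' \<inter> W'\<close> only if it contains \<open>V'\<close> or \<open>W'\<close>.  The generic point of \<open>S\<close> is \<open>y\<close>.
\<close>

lemma spectral_transported_point:
  assumes X: "spectral_space X" and Y: "spectral_space Y"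
    and \<phi>: "\<phi> ` {U. compact_openin X U} = {V. compact_openin Y V}"
    and mono: "\<And>U V. compact_openin X U \<Longrightarrow> compact_openin X V \<Longrightarrow> \<phi> U \<subseteq> \<phi> V \<longleftrightarrow> U \<subseteq> V"
    and x: "x \<in> topspace X"
  shows "\<exists>y\<in>topspace Y. \<forall>U. compact_openin X U \<longrightarrow> (x \<in> U \<longleftrightarrow> y \<in> \<phi> U)"
proof -
  have CO: "compact_openin Y (\<phi> U)" if "compact_openin X U" for U using \<phi> that by blast
  define N where "N = {U. compact_openin X U \<and> x \<notin> U}"
  define S where "S = topspace Y - \<Union>(\<phi> ` N)"
  have key: "\<exists>U\<in>N. W \<subseteq> \<phi> U" if W: "compactin Y W" "W \<inter> S = {}" for W
  proof -
    have "W \<subseteq> \<Union>(\<phi> ` N)" using W compactin_subset_topspace[OF W(1)] by (auto simp: S_def)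
    moreover have "\<forall>V\<in>\<phi> ` N. openin Y V" using CO by (auto simp: N_def compact_openin_def)
    ultimately obtain \<F> where \<F>: "finite \<F>" "\<F> \<subseteq> \<phi> ` N" "W \<subseteq> \<Union>\<F>"
      using W(1) unfolding compactin_def by meson
    obtain \<G> where \<G>: "finite \<G>" "\<G> \<subseteq> N" "\<F> = \<phi> ` \<G>"
      using finite_subset_image[OF \<F>(1,2)] by blast
    have U: "compact_openin X (\<Union>\<G>)" using \<G>(1,2) by (intro compact_openin_Union) (auto simp: N_def)
    then have "\<Union>\<G> \<in> N" using \<G>(2) by (auto simp: N_def)
    moreover have "\<phi> G \<subseteq> \<phi> (\<Union>\<G>)" if "G \<in> \<G>" for G
      using that \<G>(2) by (subst mono[OF _ U]) (auto simp: N_def)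
    then have "W \<subseteq> \<phi> (\<Union>\<G>)" using \<F>(3) \<G>(3) by blast
    ultimately show ?thesis by blast
  qed
  have "irreducible_closedin Y S"
    unfolding irreducible_closedin_def
  proof (intro conjI allI impI)
    show "closedin Y S" unfolding S_def
      using CO by (intro closedin_diff openin_Union) (auto simp: N_def compact_openin_def)
    show "S \<noteq> {}"
    proof
      assume "S = {}"
      then obtain U where U: "U \<in> N" "topspace Y \<subseteq> \<phi> U"
        using key[of "topspace Y"] compact_openin_topspace[OF Y] by (auto simp: compact_openin_def)
      have "\<phi> (topspace X) \<subseteq> \<phi> U"
        using CO[OF compact_openin_topspace[OF X]] U(2) openin_subset[of Y "\<phi> (topspace X)"]
        by (auto simp: compact_openin_def)
      then show False using mono[OF compact_openin_topspace[OF X]] U(1) x by (auto simp: N_def)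
    qed
    fix A B assume AB: "closedin Y A \<and> closedin Y B \<and> S = A \<union> B"
    show "S = A \<or> S = B"
    proof (rule ccontr)
      assume "\<not> (S = A \<or> S = B)"
      then obtain a b where a: "a \<in> S" "a \<notin> A" and b: "b \<in> S" "b \<notin> B" using AB by blast
      have aY: "a \<in> topspace Y - A" "b \<in> topspace Y - B" using a b by (auto simp: S_def)
      have oAB: "openin Y (topspace Y - A)" "openin Y (topspace Y - B)" using AB by auto
      obtain V where V: "compact_openin Y V" "a \<in> V" "V \<subseteq> topspace Y - A"
        by (rule spectral_basis[OF Y oAB(1) aY(1)])
      obtain W where W: "compact_openin Y W" "b \<in> W" "W \<subseteq> topspace Y - B"
        by (rule spectral_basis[OF Y oAB(2) aY(2)])
      have "V \<in> \<phi> ` {U. compact_openin X U}" "W \<in> \<phi> ` {U. compact_openin X U}"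
        unfolding \<phi> using V(1) W(1) by simp_all
      then obtain V' W' where V': "compact_openin X V'" "V = \<phi> V'" and W': "compact_openin X W'" "W = \<phi> W'"
        by (elim imageE) simp
      have VW: "compact_openin Y (V \<inter> W)" "compact_openin X (V' \<inter> W')"
        using X Y V W V' W' by (auto simp: spectral_space_def)
      have "(V \<inter> W) \<inter> S = {}" using V W AB by blast
      then obtain U where U: "U \<in> N" "V \<inter> W \<subseteq> \<phi> U" using key[of "V \<inter> W"] VW by (auto simp: compact_openin_def)
      have "\<phi> (V' \<inter> W') \<subseteq> \<phi> V' \<inter> \<phi> W'" using mono[OF VW(2)] V' W' by auto
      then have "\<phi> (V' \<inter> W') \<subseteq> \<phi> U" using U(2) V' W' by blast
      then have "V' \<inter> W' \<subseteq> U" using mono[OF VW(2)] U(1) by (auto simp: N_def)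
      then have "V' \<in> N \<or> W' \<in> N" using U(1) V' W' by (auto simp: N_def)
      then have "V \<inter> S = {} \<or> W \<inter> S = {}" using V'(2) W'(2) by (auto simp: S_def)
      then show False using a b V W by blast
    qed
  qed
  then obtain y where y: "y \<in> topspace Y" "S = Y closure_of {y}"
    using Y by (auto simp: spectral_space_def sober_space_def)
  then have yS: "y \<in> S" using closure_of_subset[of "{y}" Y] by auto
  have "x \<in> U \<longleftrightarrow> y \<in> \<phi> U" if U: "compact_openin X U" for U
  proof
    assume "x \<in> U"
    show "y \<in> \<phi> U"
    proof (rule ccontr)
      assume "y \<notin> \<phi> U"
      then have "\<phi> U \<inter> S = {}"
        using CO[OF U] unfolding y(2) by (auto simp: closure_of_def compact_openin_def)
      then obtain U' where "U' \<in> N" "\<phi> U \<subseteq> \<phi> U'" using key[of "\<phi> U"] CO[OF U] by (auto simp: compact_openin_def)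
      then show False using mono[OF U] \<open>x \<in> U\<close> by (auto simp: N_def)
    qed
  next
    assume "y \<in> \<phi> U"
    then show "x \<in> U" using yS U by (auto simp: S_def N_def)
  qed
  then show ?thesis using y(1) by blast
qed

theorem spectral_homeomorphism:
  assumes X: "spectral_space X" and Y: "spectral_space Y"
    and bij: "bij_betw \<phi> {U. compact_openin X U} {V. compact_openin Y V}"
    and mono: "\<And>U V. compact_openin X U \<Longrightarrow> compact_openin X V \<Longrightarrow> \<phi> U \<subseteq> \<phi> V \<longleftrightarrow> U \<subseteq> V"
  shows "\<exists>s\<in>spectral_map X Y. \<exists>s'\<in>spectral_map Y X.
    (\<forall>x\<in>topspace X. s' (s x) = x) \<and> (\<forall>y\<in>topspace Y. s (s' y) = y)"
proof -
  define \<psi> where "\<psi> = inv_into {U. compact_openin X U} \<phi>"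
  have \<phi>: "\<phi> ` {U. compact_openin X U} = {V. compact_openin Y V}" using bij by (rule bij_betw_imp_surj_on)
  have \<psi>: "compact_openin X (\<psi> V)" "\<phi> (\<psi> V) = V" if "compact_openin Y V" for V
    using inv_into_into[of V \<phi> "{U. compact_openin X U}"] f_inv_into_f[of V \<phi> "{U. compact_openin X U}"]
      \<phi> that by (auto simp: \<psi>_def)
  have \<psi>\<phi>: "\<psi> (\<phi> U) = U" if "compact_openin X U" for U
    using bij that by (simp add: \<psi>_def bij_betw_def inv_into_f_f)
  have \<psi>img: "\<psi> ` {V. compact_openin Y V} = {U. compact_openin X U}"
  proof
    show "\<psi> ` {V. compact_openin Y V} \<subseteq> {U. compact_openin X U}" using \<psi> by auto
    show "{U. compact_openin X U} \<subseteq> \<psi> ` {V. compact_openin Y V}"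
    proof
      fix U assume U: "U \<in> {U. compact_openin X U}"
      then have "\<phi> U \<in> {V. compact_openin Y V}" using \<phi> by blast
      moreover have "U = \<psi> (\<phi> U)" using U \<psi>\<phi> by simp
      ultimately show "U \<in> \<psi> ` {V. compact_openin Y V}" by (rule rev_image_eqI)
    qed
  qed
  have \<psi>mono: "\<psi> U \<subseteq> \<psi> V \<longleftrightarrow> U \<subseteq> V" if "compact_openin Y U" "compact_openin Y V" for U V
    using mono[of "\<psi> U" "\<psi> V"] \<psi> that by simp
  obtain s where s: "\<And>x. x \<in> topspace X \<Longrightarrow> s x \<in> topspace Y"
    "\<And>x U. x \<in> topspace X \<Longrightarrow> compact_openin X U \<Longrightarrow> x \<in> U \<longleftrightarrow> s x \<in> \<phi> U"
    using spectral_transported_point[OF X Y \<phi> mono] by metis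
  obtain s' where s': "\<And>y. y \<in> topspace Y \<Longrightarrow> s' y \<in> topspace X"
    "\<And>y V. y \<in> topspace Y \<Longrightarrow> compact_openin Y V \<Longrightarrow> y \<in> V \<longleftrightarrow> s' y \<in> \<psi> V"
    using spectral_transported_point[OF Y X \<psi>img \<psi>mono] by metis
  have CO: "compact_openin Y (\<phi> U)" if "compact_openin X U" for U using \<phi> that by blast
  have s's: "s' (s x) = x" if x: "x \<in> topspace X" for x
  proof (rule spectral_separation[OF X s'(1)[OF s(1)[OF x]] x])
    fix U assume U: "compact_openin X U"
    show "s' (s x) \<in> U \<longleftrightarrow> x \<in> U"
      using s(2)[OF x U] s'(2)[OF s(1)[OF x] CO[OF U]] \<psi>\<phi>[OF U] by simp
  qed
  have ss': "s (s' y) = y" if y: "y \<in> topspace Y" for y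
  proof (rule spectral_separation[OF Y s(1)[OF s'(1)[OF y]] y])
    fix V assume V: "compact_openin Y V"
    show "s (s' y) \<in> V \<longleftrightarrow> y \<in> V"
      using s'(2)[OF y V] s(2)[OF s'(1)[OF y] \<psi>(1)[OF V]] \<psi>(2)[OF V] by simp
  qed
  have "{x \<in> topspace X. restrict s (topspace X) x \<in> V} = \<psi> V" if V: "compact_openin Y V" for V
    using s(2)[OF _ \<psi>(1)[OF V]] \<psi>[OF V] openin_subset[of X "\<psi> V"] by (auto simp: compact_openin_def)
  then have "restrict s (topspace X) \<in> spectral_map X Y"
    using s(1) \<psi>(1) by (auto simp: spectral_map_def)
  moreover have "{y \<in> topspace Y. restrict s' (topspace Y) y \<in> U} = \<phi> U" if U: "compact_openin X U" for U
    using s'(2)[OF _ CO[OF U]] \<psi>\<phi>[OF U] openin_subset[of Y "\<phi> U"] CO[OF U] by (auto simp: compact_openin_def)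
  then have "restrict s' (topspace Y) \<in> spectral_map Y X"
    using s'(1) CO by (auto simp: spectral_map_def)
  ultimately show ?thesis
    by (intro bexI[of _ "restrict s (topspace X)"] bexI[of _ "restrict s' (topspace Y)"])
      (simp_all add: s(1) s'(1) s's ss')
qed

lemma spectral_space_singleton: "spectral_space (discrete_topology {a})"
proof -
  have co: "compact_openin (discrete_topology {a}) U \<longleftrightarrow> U \<subseteq> {a}" for U
    using finite_subset[of U "{a}"] by (auto simp: compact_openin_def finite_imp_compactin_eq)
  have "sober_space (discrete_topology {a})"
    unfolding sober_space_def
  proof (intro allI impI)
    fix S assume "irreducible_closedin (discrete_topology {a}) S"
    then have "S = {a}" by (auto simp: irreducible_closedin_def)
    moreover have "discrete_topology {a} closure_of {a} = {a}" by (simp add: closure_of_closedin)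
    ultimately show "\<exists>!x. x \<in> topspace (discrete_topology {a}) \<and> S = discrete_topology {a} closure_of {x}"
      by auto
  qed
  moreover have "openin (discrete_topology {a}) = arbitrary union_of (compact_openin (discrete_topology {a}))"
    by (auto simp: fun_eq_iff co arbitrary_union_of_alt)
  ultimately show ?thesis
    by (auto simp: spectral_space_def co compact_space_def finite_imp_compactin_eq)
qed

text \<open>
  Monomorphisms are injective because every map from the one-point space is spectral, so that points
  are themselves morphisms.
\<close>

lemma spectral_monomorphism_iff:
  "monomorphism Spectral C X m \<longleftrightarrow> m \<in> spectral_map C X \<and> inj_on m (topspace C)"
proof
  assume mono: "monomorphism Spectral C X m"
  then have m: "m \<in> spectral_map C X" by (simp add: monomorphism_def Spectral_def)
  have "x = y" if xy: "x \<in> topspace C" "y \<in> topspace C" "m x = m y" for x y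
  proof -
    define P :: "'a topology" where "P = discrete_topology {x}"
    have pt: "(\<lambda>_\<in>{x}. z) \<in> spectral_map P C" if "z \<in> topspace C" for z
      using that by (auto simp: spectral_map_def P_def compact_openin_def finite_imp_compactin_eq)
    have "compose (topspace P) m (\<lambda>_\<in>{x}. x) = compose (topspace P) m (\<lambda>_\<in>{x}. y)"
      using xy by (auto simp: P_def compose_def)
    moreover have "P \<in> Obj Spectral" by (simp add: P_def Spectral_def spectral_space_singleton)
    ultimately have "(\<lambda>_\<in>{x}. x) = (\<lambda>_\<in>{x}. y)"
      using mono pt[OF xy(1)] pt[OF xy(2)] by (auto simp: monomorphism_def Spectral_def)
    then show "x = y" by (metis restrict_apply' singletonI)
  qed
  then show "m \<in> spectral_map C X \<and> inj_on m (topspace C)" using m by (auto intro: inj_onI)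
next
  assume m: "m \<in> spectral_map C X \<and> inj_on m (topspace C)"
  have "g = h" if gh: "g \<in> spectral_map Z C" "h \<in> spectral_map Z C"
    "compose (topspace Z) m g = compose (topspace Z) m h" for Z g h
  proof (rule PiE_ext[OF spectral_map_PiE[OF gh(1)] spectral_map_PiE[OF gh(2)]])
    fix z assume z: "z \<in> topspace Z"
    have "g z \<in> topspace C" "h z \<in> topspace C" using gh(1,2) z by (auto simp: spectral_map_def)
    moreover have "m (g z) = m (h z)" using fun_cong[OF gh(3), of z] z by (simp add: compose_def)
    ultimately show "g z = h z" using m by (auto dest: inj_onD)
  qed
  then show "monomorphism Spectral C X m"
    unfolding monomorphism_def using m by (simp add: Spectral_def) blast
qed

text \<open>
  A compact set of the form \<open>A \<inter> S\<close> with \<open>A\<close> open is covered by finitely many compact open sets inside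
  \<open>A\<close>, and their union may replace \<open>A\<close>.
\<close>

lemma compact_openin_closed_subspace:
  assumes X: "spectral_space X" and S: "closedin X S"
  shows "compact_openin (subtopology X S) U \<longleftrightarrow> (\<exists>V. compact_openin X V \<and> U = V \<inter> S)"
proof
  assume "compact_openin (subtopology X S) U"
  then obtain A where A: "openin X A" "U = A \<inter> S" and U: "compactin X U"
    by (auto simp: compact_openin_def openin_subtopology compactin_subtopology)
  define \<V> where "\<V> = {V. compact_openin X V \<and> V \<subseteq> A}"
  have "U \<subseteq> \<Union>\<V>"
  proof
    fix x assume "x \<in> U"
    then have "x \<in> A" using A(2) by blast
    then obtain V where "compact_openin X V" "x \<in> V" "V \<subseteq> A" by (rule spectral_basis[OF X A(1)])
    then show "x \<in> \<Union>\<V>" by (auto simp: \<V>_def)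
  qed
  moreover have "\<forall>V\<in>\<V>. openin X V" by (simp add: \<V>_def compact_openin_def)
  ultimately obtain \<F> where \<F>: "finite \<F>" "\<F> \<subseteq> \<V>" "U \<subseteq> \<Union>\<F>" using U unfolding compactin_def by meson
  have "compact_openin X (\<Union>\<F>)" using \<F> by (intro compact_openin_Union) (auto simp: \<V>_def)
  moreover have "U = \<Union>\<F> \<inter> S" using \<F> A(2) by (auto simp: \<V>_def)
  ultimately show "\<exists>V. compact_openin X V \<and> U = V \<inter> S" by blast
next
  assume "\<exists>V. compact_openin X V \<and> U = V \<inter> S"
  then obtain V where V: "compact_openin X V" "U = V \<inter> S" by blast
  then have "compactin X U" using S by (metis compact_Int_closedin compact_openin_def)
  then show "compact_openin (subtopology X S) U"
    using V by (auto simp: compact_openin_def openin_subtopology compactin_subtopology)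
qed

theorem spectral_closed_subspace:
  assumes X: "spectral_space X" and S: "closedin X S"
  shows "spectral_space (subtopology X S)"
proof -
  note co = compact_openin_closed_subspace[OF X S]
  have SX: "S \<subseteq> topspace X" using S by (rule closedin_subset)
  have cl: "subtopology X S closure_of {x} = X closure_of {x}" if "x \<in> S" for x
    using that closure_of_minimal[OF _ S, of "{x}"] by (auto simp: closure_of_subtopology)
  have "sober_space (subtopology X S)"
    unfolding sober_space_def
  proof (intro allI impI)
    fix T assume T: "irreducible_closedin (subtopology X S) T"
    then have TX: "closedin X T" "T \<subseteq> S"
      using S by (auto simp: irreducible_closedin_def closedin_closed_subtopology)
    have "irreducible_closedin X T"
      unfolding irreducible_closedin_def
    proof (intro conjI allI impI TX)
      show "T \<noteq> {}" using T by (simp add: irreducible_closedin_def)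
      fix A B assume AB: "closedin X A \<and> closedin X B \<and> T = A \<union> B"
      then have "closedin (subtopology X S) A" "closedin (subtopology X S) B"
        using TX S by (auto simp: closedin_closed_subtopology)
      then show "T = A \<or> T = B" using T AB by (auto simp: irreducible_closedin_def)
    qed
    then have ex1: "\<exists>!x. x \<in> topspace X \<and> T = X closure_of {x}"
      using X by (simp add: spectral_space_def sober_space_def)
    moreover have "x \<in> topspace X \<and> T = X closure_of {x} \<longleftrightarrow>
        x \<in> topspace (subtopology X S) \<and> T = subtopology X S closure_of {x}" for x
    proof
      assume x: "x \<in> topspace X \<and> T = X closure_of {x}"
      then have "x \<in> S" using TX(2) closure_of_subset[of "{x}" X] by auto
      then show "x \<in> topspace (subtopology X S) \<and> T = subtopology X S closure_of {x}"
        using x cl by simp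
    qed (use cl in auto)
    ultimately show "\<exists>!x. x \<in> topspace (subtopology X S) \<and> T = subtopology X S closure_of {x}"
      by simp
  qed
  moreover have "compact_space (subtopology X S)"
    using X S by (simp add: spectral_space_def compact_space_subtopology closedin_compact_space)
  moreover have "openin (subtopology X S) = arbitrary union_of (compact_openin (subtopology X S))"
  proof
    fix U
    show "openin (subtopology X S) U = (arbitrary union_of (compact_openin (subtopology X S))) U"
    proof
      assume "openin (subtopology X S) U"
      then obtain A where A: "openin X A" "U = A \<inter> S" by (auto simp: openin_subtopology)
      show "(arbitrary union_of (compact_openin (subtopology X S))) U"
        unfolding arbitrary_union_of_alt
      proof
        fix x assume x: "x \<in> U"
        then have "x \<in> A" using A(2) by blast
        then obtain V where "compact_openin X V" "x \<in> V" "V \<subseteq> A" by (rule spectral_basis[OF X A(1)])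
        then show "\<exists>V. compact_openin (subtopology X S) V \<and> x \<in> V \<and> V \<subseteq> U"
          using A(2) x co by (intro exI[of _ "V \<inter> S"]) auto
      qed
    next
      assume "(arbitrary union_of (compact_openin (subtopology X S))) U"
      then show "openin (subtopology X S) U"
        unfolding arbitrary_union_of_alt compact_openin_def by (subst openin_subopen) blast
    qed
  qed
  moreover have "compact_openin (subtopology X S) (U \<inter> V)"
    if UV: "compact_openin (subtopology X S) U" "compact_openin (subtopology X S) V" for U V
  proof -
    obtain U' where U': "compact_openin X U'" "U = U' \<inter> S" using UV(1) unfolding co by auto
    obtain V' where V': "compact_openin X V'" "V = V' \<inter> S" using UV(2) unfolding co by auto
    have "compact_openin X (U' \<inter> V')" using X U'(1) V'(1) by (simp add: spectral_space_def)
    moreover have "U \<inter> V = (U' \<inter> V') \<inter> S" using U'(2) V'(2) by auto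
    ultimately show ?thesis unfolding co by (intro exI[of _ "U' \<inter> V'"] conjI)
  qed
  ultimately show ?thesis by (simp add: spectral_space_def)
qed

lemma closed_subspace_inclusion:
  assumes X: "spectral_space X" and S: "closedin X S"
  shows "monomorphism Spectral (subtopology X S) X (\<lambda>x\<in>S. x)"
    and "closed_map (subtopology X S) X (\<lambda>x\<in>S. x)"
proof -
  have SX: "S \<subseteq> topspace X" using S by (rule closedin_subset)
  then have top: "topspace (subtopology X S) = S" by auto
  have "{x \<in> S. (\<lambda>x\<in>S. x) x \<in> U} = U \<inter> S" for U by auto
  then have "(\<lambda>x\<in>S. x) \<in> spectral_map (subtopology X S) X"
    using compact_openin_closed_subspace[OF X S] SX unfolding spectral_map_def top by auto
  then show "monomorphism Spectral (subtopology X S) X (\<lambda>x\<in>S. x)"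
    by (simp add: spectral_monomorphism_iff top inj_on_def)
  show "closed_map (subtopology X S) X (\<lambda>x\<in>S. x)"
    unfolding closed_map_def
  proof (intro allI impI)
    fix T assume T: "closedin (subtopology X S) T"
    then have "closedin X T" "T \<subseteq> S" using S by (auto simp: closedin_closed_subtopology)
    moreover from this have "(\<lambda>x\<in>S. x) ` T = T" by force
    ultimately show "closedin X ((\<lambda>x\<in>S. x) ` T)" by simp
  qed
qed

text \<open>
  A homeomorphism \<open>s\<close> from \<open>X\<close> to \<open>Y\<close> carries the closed subset \<open>S\<close> of \<open>X\<close> onto the image of \<open>m\<close>.  Since
  \<open>m\<close> is injective and closed, it is a homeomorphism onto its image, and \<open>inv m \<circ> s\<close> and
  \<open>s' \<circ> m\<close> are mutually inverse spectral maps between \<open>S\<close> and \<open>C\<close>.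
\<close>

theorem SIC_isomorphic_closed_subspace:
  assumes X: "cylinder_based u X" and Y: "(Y, C, m) \<in> Obj (SIC u)"
    and s: "s \<in> spectral_map X Y" and s': "s' \<in> spectral_map Y X"
    and s's: "\<And>x. x \<in> topspace X \<Longrightarrow> s' (s x) = x" and ss': "\<And>y. y \<in> topspace Y \<Longrightarrow> s (s' y) = y"
  defines "S \<equiv> {x \<in> topspace X. s x \<in> m ` topspace C}"
  shows "closedin X S"
    and "isomorphic_in (SIC u) (X, subtopology X S, \<lambda>x\<in>S. x) (Y, C, m)"
proof -
  have Xs: "spectral_space X" using X by (simp add: cylinder_based_def)
  have Ys: "spectral_space Y" and Cs: "spectral_space C" and m: "m \<in> spectral_map C Y"
    and inj: "inj_on m (topspace C)" and cm: "closed_map C Y m"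
    using Y by (simp_all add: SIC_def cylinder_based_def spectral_monomorphism_iff)
  have mY: "m c \<in> topspace Y" if "c \<in> topspace C" for c using m that by (auto simp: spectral_map_def)
  have sY: "s x \<in> topspace Y" if "x \<in> topspace X" for x using s that by (auto simp: spectral_map_def)
  have s'X: "s' y \<in> topspace X" if "y \<in> topspace Y" for y using s' that by (auto simp: spectral_map_def)
  have scont: "continuous_map X Y s" by (rule spectral_map_continuous[OF Ys s])
  have "closedin Y (m ` topspace C)" using cm by (simp add: closed_map_def)
  then show S: "closedin X S" unfolding S_def by (rule closedin_continuous_map_preimage[OF scont])
  have SX: "S \<subseteq> topspace X" by (auto simp: S_def)
  have topS: "topspace (subtopology X S) = S" using SX by auto
  define t where "t = (\<lambda>x\<in>S. inv_into (topspace C) m (s x))"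
  define t' where "t' = compose (topspace C) s' m"
  have tC: "t x \<in> topspace C" "m (t x) = s x" if "x \<in> S" for x
    using that unfolding t_def S_def by (auto intro: inv_into_into f_inv_into_f)
  have t': "t' \<in> spectral_map C X" unfolding t'_def by (rule spectral_map_compose[OF m s'])
  have t'S: "t' c \<in> S" if "c \<in> topspace C" for c
    using that by (simp add: t'_def S_def compose_def ss' mY s'X)
  have t't: "t' (t x) = x" if "x \<in> S" for x
    using tC[OF that] that SX s's by (auto simp: t'_def compose_def)
  have tt': "t (t' c) = c" if "c \<in> topspace C" for c
  proof (rule inj_onD[OF inj])
    show "m (t (t' c)) = m c" using tC(2)[OF t'S[OF that]] that by (simp add: t'_def compose_def ss' mY)
  qed (use that tC t'S in auto)
  have "t' \<in> spectral_map C (subtopology X S)"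
    unfolding spectral_map_def
  proof (intro CollectI conjI allI impI)
    show "t' \<in> topspace C \<rightarrow>\<^sub>E topspace (subtopology X S)"
      unfolding topS using t'S by (auto simp: t'_def compose_def)
    fix U assume "compact_openin (subtopology X S) U"
    then obtain V where V: "compact_openin X V" "U = V \<inter> S"
      unfolding compact_openin_closed_subspace[OF Xs S] by auto
    have "{c \<in> topspace C. t' c \<in> U} = {c \<in> topspace C. t' c \<in> V}" using V(2) t'S by auto
    then show "compact_openin C {c \<in> topspace C. t' c \<in> U}" using t' V(1) by (auto simp: spectral_map_def)
  qed
  moreover have "t \<in> spectral_map (subtopology X S) C"
    unfolding spectral_map_def topS
  proof (intro CollectI conjI allI impI)
    show "t \<in> S \<rightarrow>\<^sub>E topspace C" using tC(1) by (auto simp: t_def)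
    fix U assume U: "compact_openin C U"
    have UC: "U \<subseteq> topspace C" using U by (auto simp: compact_openin_def openin_subset)
    have eq: "{x \<in> S. t x \<in> U} = t' ` U"
    proof
      show "{x \<in> S. t x \<in> U} \<subseteq> t' ` U" using t't by (metis (mono_tags, lifting) image_eqI mem_Collect_eq subsetI)
      show "t' ` U \<subseteq> {x \<in> S. t x \<in> U}" using UC t'S tt' by auto
    qed
    have "compactin X (t' ` U)"
      using U spectral_map_continuous[OF Xs t'] by (auto simp: compact_openin_def intro: image_compactin)
    then have comp: "compactin (subtopology X S) {x \<in> S. t x \<in> U}"
      unfolding eq compactin_subtopology using UC t'S by auto
    have "closedin Y (m ` (topspace C - U))"
      using cm U by (simp add: closed_map_def compact_openin_def closedin_diff)
    then have "closedin X {x \<in> topspace X. s x \<in> m ` (topspace C - U)}"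
      by (rule closedin_continuous_map_preimage[OF scont])
    then have "openin X (topspace X - {x \<in> topspace X. s x \<in> m ` (topspace C - U)})" by blast
    moreover have "{x \<in> S. t x \<in> U} = (topspace X - {x \<in> topspace X. s x \<in> m ` (topspace C - U)}) \<inter> S"
    proof -
      have "t x \<in> U \<longleftrightarrow> s x \<notin> m ` (topspace C - U)" if x: "x \<in> S" for x
      proof
        assume "t x \<in> U"
        have "c = t x" if "c \<in> topspace C" "s x = m c" for c
          using inj_onD[OF inj _ that(1) tC(1)[OF x]] that(2) tC(2)[OF x] by simp
        then show "s x \<notin> m ` (topspace C - U)" using \<open>t x \<in> U\<close> by auto
      next
        assume "s x \<notin> m ` (topspace C - U)"
        then show "t x \<in> U" using tC[OF x] by (metis DiffI image_eqI)
      qed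
      then show ?thesis using SX by auto
    qed
    ultimately have "openin (subtopology X S) {x \<in> S. t x \<in> U}"
      unfolding openin_subtopology by blast
    then show "compact_openin (subtopology X S) {x \<in> S. t x \<in> U}" using comp by (simp add: compact_openin_def)
  qed
  moreover have "compose S s (\<lambda>x\<in>S. x) = compose S m t"
    using tC(2) by (auto simp: compose_def fun_eq_iff)
  moreover have "compose (topspace C) s' m = compose (topspace C) (\<lambda>x\<in>S. x) t'"
    using t'S by (auto simp: compose_def fun_eq_iff t'_def)
  ultimately have hom: "(s, t) \<in> Hom (SIC u) (X, subtopology X S, \<lambda>x\<in>S. x) (Y, C, m)"
    "(s', t') \<in> Hom (SIC u) (Y, C, m) (X, subtopology X S, \<lambda>x\<in>S. x)"
    using s s' by (simp_all add: SIC_def Int_absorb1[OF SX])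
  have "compose (topspace X) s' s = (\<lambda>x\<in>topspace X. x)" "compose S t' t = (\<lambda>x\<in>S. x)"
    "compose (topspace Y) s s' = (\<lambda>y\<in>topspace Y. y)" "compose (topspace C) t t' = (\<lambda>c\<in>topspace C. c)"
    using s's ss' t't tt' by (auto simp: compose_def fun_eq_iff)
  then show "isomorphic_in (SIC u) (X, subtopology X S, \<lambda>x\<in>S. x) (Y, C, m)"
    unfolding isomorphic_in_def by (intro bexI[OF _ hom(1)] bexI[OF _ hom(2)]) (simp add: SIC_def Int_absorb1[OF SX])
qed

lemma anti_isomorphic_compose:
  assumes "anti_isomorphic L N" "anti_isomorphic M N"
  shows "\<exists>\<phi>. bij_betw \<phi> L M \<and> (\<forall>U\<in>L. \<forall>V\<in>L. \<phi> U \<subseteq> \<phi> V \<longleftrightarrow> U \<subseteq> V)"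
proof -
  obtain \<alpha> where \<alpha>: "bij_betw \<alpha> L N" "\<And>U V. U \<in> L \<Longrightarrow> V \<in> L \<Longrightarrow> U \<subseteq> V \<longleftrightarrow> \<alpha> V \<subseteq> \<alpha> U"
    using assms(1) by (auto simp: anti_isomorphic_def)
  obtain \<beta> where \<beta>: "bij_betw \<beta> M N" "\<And>U V. U \<in> M \<Longrightarrow> V \<in> M \<Longrightarrow> U \<subseteq> V \<longleftrightarrow> \<beta> V \<subseteq> \<beta> U"
    using assms(2) by (auto simp: anti_isomorphic_def)
  define \<phi> where "\<phi> = inv_into M \<beta> \<circ> \<alpha>"
  have bij: "bij_betw \<phi> L M"
    unfolding \<phi>_def by (rule bij_betw_trans[OF \<alpha>(1) bij_betw_inv_into[OF \<beta>(1)]])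
  have \<phi>M: "\<phi> U \<in> M" if "U \<in> L" for U using bij that by (auto simp: bij_betw_def)
  have "\<beta> (\<phi> U) = \<alpha> U" if "U \<in> L" for U
    using bij_betw_inv_into_right[OF \<beta>(1)] \<alpha>(1) that by (auto simp: \<phi>_def bij_betw_def)
  then have "\<phi> U \<subseteq> \<phi> V \<longleftrightarrow> U \<subseteq> V" if "U \<in> L" "V \<in> L" for U V
    using \<alpha>(2)[OF that] \<beta>(2)[OF \<phi>M[OF that(1)] \<phi>M[OF that(2)]] that by simp
  then show ?thesis using bij by (intro exI[of _ \<phi>] conjI ballI)
qed

section \<open>The spectrum of a free MV-algebra\<close>

text \<open>
  Membership in an ideal depends only on the zero set, since an ideal contains the truncated
  multiples \<open>min 1 (n f)\<close> of its elements \<open>f\<close>, and these dominate every \<open>g\<close> that vanishes where \<open>f\<close>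
  does.  Ideals of \<open>Free K\<close> are in this way filters of zero sets.
\<close>

lemma mv_ideal_Free_iff:
  "mv_ideal (Free K) I \<longleftrightarrow> (\<forall>f\<in>I. mcnaughton K f) \<and> I \<noteq> {} \<and>
     (\<forall>f\<in>I. \<forall>g. mcnaughton K g \<and> zero_set K f \<subseteq> zero_set K g \<longrightarrow> g \<in> I) \<and>
     (\<forall>f\<in>I. \<forall>g\<in>I. mv_plus (Free K) f g \<in> I)" (is "?L \<longleftrightarrow> ?R")
proof
  assume I: ?L
  have mcn: "mcnaughton K f" if "f \<in> I" for f using I that by (auto simp: mv_ideal_def mv_carrier_Free)
  have down: "f \<in> I" if "mcnaughton K f" "g \<in> I" "\<And>x. x \<in> cube K \<Longrightarrow> f x \<le> g x" for f g
    using I that mv_le_Free[OF that(1) mcn[OF that(2)]] unfolding mv_ideal_def by (simp add: mv_carrier_Free)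
  have plus: "mv_plus (Free K) f g \<in> I" if "f \<in> I" "g \<in> I" for f g
    using I that by (simp add: mv_ideal_def)
  have up: "g \<in> I" if f: "f \<in> I" and g: "mcnaughton K g" and Z: "zero_set K f \<subseteq> zero_set K g" for f g
  proof -
    have mult: "(\<lambda>x\<in>cube K. min 1 (real n * f x)) \<in> I" for n
    proof (induction n)
      case 0
      have "(\<lambda>x\<in>cube K. 0) \<in> I"
        by (rule down[OF mcnaughton_zero f]) (use mcnaughton_range[OF mcn[OF f]] in simp)
      moreover have "(\<lambda>x\<in>cube K. min 1 (real 0 * f x)) = (\<lambda>x\<in>cube K. 0)" by (rule ext) simp
      ultimately show ?case by (simp only:)
    next
      case (Suc n)
      have "(\<lambda>x\<in>cube K. min 1 (real (Suc n) * f x)) = mv_plus (Free K) (\<lambda>x\<in>cube K. min 1 (real n * f x)) f"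
      proof (rule ext)
        fix x
        have "min 1 (real (Suc n) * f x) = min 1 (min 1 (real n * f x) + f x)" if "x \<in> cube K"
          using mcnaughton_range[OF mcn[OF f] that] by (auto simp: min_def algebra_simps)
        then show "(\<lambda>x\<in>cube K. min 1 (real (Suc n) * f x)) x
            = mv_plus (Free K) (\<lambda>x\<in>cube K. min 1 (real n * f x)) f x"
          by (simp add: Free_def)
      qed
      then show ?case using plus[OF Suc f] by (simp only:)
    qed
    obtain n :: nat where n: "\<forall>x\<in>cube K. g x \<le> real n * f x"
      using mcnaughton_dominated[OF g mcn[OF f] Z] by blast
    show ?thesis
      by (rule down[OF g mult[of n]]) (use n mcnaughton_range[OF g] in simp)
  qed
  show ?R
  proof (intro conjI ballI allI impI)
    show "I \<noteq> {}" using I by (simp add: mv_ideal_def)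
    fix f assume f: "f \<in> I"
    show "mcnaughton K f" by (rule mcn[OF f])
    fix g
    show "g \<in> I" if "mcnaughton K g \<and> zero_set K f \<subseteq> zero_set K g" using up[OF f] that by simp
    show "mv_plus (Free K) f g \<in> I" if "g \<in> I" by (rule plus[OF f that])
  qed
next
  assume R: ?R
  have down: "f \<in> I" if "g \<in> I" "mcnaughton K f" "mv_le (Free K) f g" for f g
  proof -
    have g: "mcnaughton K g" using R that(1) by blast
    then have "\<forall>x\<in>cube K. f x \<le> g x" using that(2,3) by (simp add: mv_le_Free)
    then have "zero_set K g \<subseteq> zero_set K f"
      using mcnaughton_range[OF that(2)] by (fastforce simp: zero_set_def)
    then show ?thesis using R that(1,2) by blast
  qed
  show ?L
    unfolding mv_ideal_def
  proof (intro conjI ballI impI)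
    show "I \<subseteq> mv_carrier (Free K)" "I \<noteq> {}" using R by (auto simp: mv_carrier_Free)
    fix f g assume f: "f \<in> I"
    show "g \<in> I" if "g \<in> mv_carrier (Free K)" "mv_le (Free K) g f"
      by (rule down[OF f]) (use that in \<open>simp_all add: mv_carrier_Free\<close>)
    show "mv_plus (Free K) f g \<in> I" if "g \<in> I" using R f that by blast
  qed
qed

definition mv_prime :: "'a mv \<Rightarrow> 'a set \<Rightarrow> bool" where
  "mv_prime A P \<longleftrightarrow> mv_ideal A P \<and> mv_neg A (mv_zero A) \<notin> P \<and>
     (\<forall>x\<in>mv_carrier A. \<forall>y\<in>mv_carrier A. mv_inf A x y \<in> P \<longrightarrow> x \<in> P \<or> y \<in> P)"

lemma mv_ideal_FreeD:
  assumes "mv_ideal (Free K) I"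
  shows "f \<in> I \<Longrightarrow> mcnaughton K f"
    and "f \<in> I \<Longrightarrow> mcnaughton K g \<Longrightarrow> zero_set K f \<subseteq> zero_set K g \<Longrightarrow> g \<in> I"
    and "f \<in> I \<Longrightarrow> g \<in> I \<Longrightarrow> mv_plus (Free K) f g \<in> I"
    and "mv_zero (Free K) \<in> I"
proof -
  note I = assms[unfolded mv_ideal_Free_iff]
  show "f \<in> I \<Longrightarrow> mcnaughton K f" using I by blast
  show up: "f \<in> I \<Longrightarrow> mcnaughton K g \<Longrightarrow> zero_set K f \<subseteq> zero_set K g \<Longrightarrow> g \<in> I" for f g
    using I by blast
  show "f \<in> I \<Longrightarrow> g \<in> I \<Longrightarrow> mv_plus (Free K) f g \<in> I" using I by blast
  obtain f where "f \<in> I" using I by blast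
  moreover have "mcnaughton K (mv_zero (Free K))" using mcnaughton_zero by (simp add: Free_def)
  ultimately show "mv_zero (Free K) \<in> I" using up zero_set_zero[of K] by (auto simp: zero_set_def)
qed

lemma mv_prime_FreeD:
  assumes "mv_prime (Free K) P"
  shows "mv_ideal (Free K) P" "mv_neg (Free K) (mv_zero (Free K)) \<notin> P"
    and "mcnaughton K f \<Longrightarrow> mcnaughton K g \<Longrightarrow> mv_inf (Free K) f g \<in> P \<longleftrightarrow> f \<in> P \<or> g \<in> P"
proof -
  show P: "mv_ideal (Free K) P" "mv_neg (Free K) (mv_zero (Free K)) \<notin> P"
    using assms by (simp_all add: mv_prime_def)
  assume fg: "mcnaughton K f" "mcnaughton K g"
  have "mv_inf (Free K) f g \<in> P" if "f \<in> P \<or> g \<in> P"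
    using that mv_ideal_FreeD(2)[OF P(1) _ mcnaughton_inf[OF fg]] zero_set_inf[OF fg] by blast
  moreover have "f \<in> mv_carrier (Free K)" "g \<in> mv_carrier (Free K)" using fg by (simp_all add: mv_carrier_Free)
  ultimately show "mv_inf (Free K) f g \<in> P \<longleftrightarrow> f \<in> P \<or> g \<in> P"
    using assms unfolding mv_prime_def by blast
qed

lemma mcnaughton_Free_plus:
  "mcnaughton K f \<Longrightarrow> mcnaughton K g \<Longrightarrow> mcnaughton K (mv_plus (Free K) f g)"
  using mcnaughton_plus by (simp add: Free_def)

lemma mcnaughton_Free_zero: "mcnaughton K (mv_zero (Free K))"
  using mcnaughton_zero by (simp add: Free_def)

lemma mcnaughton_Free_one: "mcnaughton K (mv_neg (Free K) (mv_zero (Free K)))"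
  using mv_algebra_Free[of K] by (simp add: mv_algebra_def mv_carrier_Free)

text \<open>
  The ideal generated by \<open>P\<close> and \<open>a\<close>: an element below \<open>p + n a\<close> vanishes wherever \<open>p\<close> and \<open>a\<close> do, and
  conversely by domination.
\<close>

lemma ideal_generated:
  assumes P: "mv_ideal (Free K) P" and a: "mcnaughton K a"
  shows "mv_ideal (Free K) {h. mcnaughton K h \<and> (\<exists>p\<in>P. zero_set K p \<inter> zero_set K a \<subseteq> zero_set K h)}"
    (is "mv_ideal _ ?J")
  unfolding mv_ideal_Free_iff
proof (intro conjI ballI allI impI)
  have "a \<in> ?J" using a mv_ideal_FreeD(4)[OF P] by blast
  then show "?J \<noteq> {}" by blast
  fix f assume f: "f \<in> ?J"
  then show "mcnaughton K f" by simp
  fix g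
  show "g \<in> ?J" if "mcnaughton K g \<and> zero_set K f \<subseteq> zero_set K g" using f that by blast
  assume g: "g \<in> ?J"
  obtain p q where pq: "p \<in> P" "zero_set K p \<inter> zero_set K a \<subseteq> zero_set K f"
    "q \<in> P" "zero_set K q \<inter> zero_set K a \<subseteq> zero_set K g" using f g by blast
  have "zero_set K (mv_plus (Free K) p q) = zero_set K p \<inter> zero_set K q"
    using pq mv_ideal_FreeD(1)[OF P] by (simp add: zero_set_plus)
  moreover have "zero_set K (mv_plus (Free K) f g) = zero_set K f \<inter> zero_set K g"
    using f g by (simp add: zero_set_plus)
  ultimately have "zero_set K (mv_plus (Free K) p q) \<inter> zero_set K a \<subseteq> zero_set K (mv_plus (Free K) f g)"
    using pq by blast
  then show "mv_plus (Free K) f g \<in> ?J"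
    using f g mcnaughton_Free_plus mv_ideal_FreeD(3)[OF P pq(1,3)] by blast
qed

text \<open>
  An ideal that is maximal among those containing \<open>I\<close> and omitting \<open>f\<close> is prime: if it omits both \<open>a\<close> and \<open>b\<close>,
  then adjoining either of them produces \<open>f\<close>, with the help of elements \<open>p\<close> and \<open>q\<close> respectively, and
  hence \<open>f\<close> vanishes wherever \<open>p\<close>, \<open>q\<close> and the infimum of \<open>a\<close> and \<open>b\<close> do.  So \<open>f\<close> would be in the
  ideal if that infimum were.
\<close>

theorem prime_ideal_extension:
  assumes I: "mv_ideal (Free K) I" and f: "mcnaughton K f" "f \<notin> I"
  shows "\<exists>P. mv_prime (Free K) P \<and> I \<subseteq> P \<and> f \<notin> P"
proof -
  define \<A> where "\<A> = {J. mv_ideal (Free K) J \<and> I \<subseteq> J \<and> f \<notin> J}"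
  have "\<exists>M\<in>\<A>. \<forall>X\<in>\<A>. M \<subseteq> X \<longrightarrow> X = M"
  proof (rule subset_Zorn_nonempty)
    show "\<A> \<noteq> {}" using I f by (auto simp: \<A>_def)
    fix \<C> assume \<C>: "\<C> \<noteq> {}" "subset.chain \<A> \<C>"
    have \<C>A: "\<C> \<subseteq> \<A>" using \<C>(2) by (simp add: subset.chain_def)
    then have ideal: "mv_ideal (Free K) J" if "J \<in> \<C>" for J using that by (auto simp: \<A>_def)
    have "mv_ideal (Free K) (\<Union>\<C>)"
      unfolding mv_ideal_Free_iff
    proof (intro conjI ballI allI impI)
      show "\<Union>\<C> \<noteq> {}" using \<C>(1) mv_ideal_FreeD(4)[OF ideal] by blast
      fix g assume "g \<in> \<Union>\<C>"
      then obtain J where J: "J \<in> \<C>" "g \<in> J" by blast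
      show "mcnaughton K g" using mv_ideal_FreeD(1)[OF ideal] J by blast
      fix h
      show "h \<in> \<Union>\<C>" if "mcnaughton K h \<and> zero_set K g \<subseteq> zero_set K h"
        using mv_ideal_FreeD(2)[OF ideal[OF J(1)] J(2)] that J(1) by blast
      assume "h \<in> \<Union>\<C>"
      then obtain J' where J': "J' \<in> \<C>" "h \<in> J'" by blast
      have "J \<subseteq> J' \<or> J' \<subseteq> J" using \<C>(2) J J' by (auto simp: subset.chain_def)
      then obtain J'' where "J'' \<in> \<C>" "g \<in> J''" "h \<in> J''" using J J' by blast
      then show "mv_plus (Free K) g h \<in> \<Union>\<C>" using mv_ideal_FreeD(3)[OF ideal] by blast
    qed
    then show "\<Union>\<C> \<in> \<A>" using \<C>(1) \<C>A unfolding \<A>_def by blast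
  qed
  then obtain P where P: "P \<in> \<A>" and max: "\<And>X. X \<in> \<A> \<Longrightarrow> P \<subseteq> X \<Longrightarrow> X = P" by blast
  have Pi: "mv_ideal (Free K) P" "I \<subseteq> P" "f \<notin> P" using P by (auto simp: \<A>_def)
  have gen: "\<exists>p\<in>P. zero_set K p \<inter> zero_set K a \<subseteq> zero_set K f" if a: "mcnaughton K a" "a \<notin> P" for a
  proof (rule ccontr)
    assume no: "\<not> (\<exists>p\<in>P. zero_set K p \<inter> zero_set K a \<subseteq> zero_set K f)"
    define J where "J = {h. mcnaughton K h \<and> (\<exists>p\<in>P. zero_set K p \<inter> zero_set K a \<subseteq> zero_set K h)}"
    have "P \<subseteq> J" using mv_ideal_FreeD(1)[OF Pi(1)] by (auto simp: J_def)
    moreover have "a \<in> J" using a mv_ideal_FreeD(4)[OF Pi(1)] by (auto simp: J_def)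
    moreover have "f \<notin> J" using no by (simp add: J_def)
    moreover have "mv_ideal (Free K) J" unfolding J_def by (rule ideal_generated[OF Pi(1) a(1)])
    ultimately have "J = P" using Pi(2) by (intro max) (auto simp: \<A>_def)
    then show False using \<open>a \<in> J\<close> a(2) by simp
  qed
  have "mv_prime (Free K) P"
    unfolding mv_prime_def
  proof (intro conjI ballI impI Pi)
    show "mv_neg (Free K) (mv_zero (Free K)) \<notin> P"
      using mv_ideal_FreeD(2)[OF Pi(1) _ f(1)] Pi(3) zero_set_one by auto
    fix a b assume ab: "a \<in> mv_carrier (Free K)" "b \<in> mv_carrier (Free K)" "mv_inf (Free K) a b \<in> P"
    show "a \<in> P \<or> b \<in> P"
    proof (rule ccontr)
      assume "\<not> (a \<in> P \<or> b \<in> P)"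
      then obtain p q where p: "p \<in> P" "zero_set K p \<inter> zero_set K a \<subseteq> zero_set K f"
        and q: "q \<in> P" "zero_set K q \<inter> zero_set K b \<subseteq> zero_set K f"
        using gen ab unfolding mv_carrier_Free by metis
      define r where "r = mv_plus (Free K) (mv_plus (Free K) p q) (mv_inf (Free K) a b)"
      have "r \<in> P" unfolding r_def using mv_ideal_FreeD(3)[OF Pi(1)] p(1) q(1) ab(3) by blast
      moreover have "zero_set K r = zero_set K p \<inter> zero_set K q \<inter> (zero_set K a \<union> zero_set K b)"
        using ab mv_ideal_FreeD(1)[OF Pi(1) p(1)] mv_ideal_FreeD(1)[OF Pi(1) q(1)]
        by (simp add: r_def zero_set_plus zero_set_inf mcnaughton_inf mcnaughton_Free_plus mv_carrier_Free)
      then have "zero_set K r \<subseteq> zero_set K f" using p q by blast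
      ultimately show False using mv_ideal_FreeD(2)[OF Pi(1) _ f(1)] Pi(3) by blast
    qed
  qed
  then show ?thesis using Pi by blast
qed

text \<open>
  The points of a spectrum are prime ideals, renamed by an injection \<open>e\<close> so that they live in the
  universe of the target category.
\<close>

definition basic_open :: "('a set \<Rightarrow> 'p) \<Rightarrow> 'a mv \<Rightarrow> 'a \<Rightarrow> 'p set" where
  "basic_open e A f = e ` {P. mv_prime A P \<and> f \<notin> P}"

definition ideal_hull :: "('a set \<Rightarrow> 'p) \<Rightarrow> 'a mv \<Rightarrow> 'a set \<Rightarrow> 'p set" where
  "ideal_hull e A I = e ` {P. mv_prime A P \<and> I \<subseteq> P}"

definition spectrum :: "('a set \<Rightarrow> 'p) \<Rightarrow> 'a mv \<Rightarrow> 'p topology" where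
  "spectrum e A = topology (arbitrary union_of (\<lambda>U. \<exists>f\<in>mv_carrier A. U = basic_open e A f))"

lemma basic_open_zero: "basic_open e (Free K) (mv_zero (Free K)) = {}"
  using mv_ideal_FreeD(4)[OF mv_prime_FreeD(1)] by (auto simp: basic_open_def)

lemma basic_open_one: "basic_open e (Free K) (mv_neg (Free K) (mv_zero (Free K))) = e ` {P. mv_prime (Free K) P}"
  using mv_prime_FreeD(2) by (auto simp: basic_open_def)

lemma basic_open_inf:
  assumes e: "inj e" and fg: "mcnaughton K f" "mcnaughton K g"
  shows "basic_open e (Free K) (mv_inf (Free K) f g) = basic_open e (Free K) f \<inter> basic_open e (Free K) g"
  unfolding basic_open_def image_Int[OF e, symmetric]
  using mv_prime_FreeD(3)[OF _ fg] by (intro arg_cong[of _ _ "image e"]) blast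

lemma basic_open_plus:
  assumes fg: "mcnaughton K f" "mcnaughton K g"
  shows "basic_open e (Free K) (mv_plus (Free K) f g) = basic_open e (Free K) f \<union> basic_open e (Free K) g"
proof -
  have "mv_plus (Free K) f g \<in> P \<longleftrightarrow> f \<in> P \<and> g \<in> P" if P: "mv_prime (Free K) P" for P
  proof -
    have Z: "zero_set K (mv_plus (Free K) f g) \<subseteq> zero_set K f" "zero_set K (mv_plus (Free K) f g) \<subseteq> zero_set K g"
      using zero_set_plus[OF fg] by auto
    note I = mv_prime_FreeD(1)[OF P]
    show ?thesis using mv_ideal_FreeD(3)[OF I, of f g] mv_ideal_FreeD(2)[OF I _ fg(1) Z(1)]
        mv_ideal_FreeD(2)[OF I _ fg(2) Z(2)] by blast
  qed
  then show ?thesis unfolding basic_open_def image_Un[symmetric]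
    by (intro arg_cong[of _ _ "image e"]) blast
qed

text \<open>
  If \<open>Z g\<close> is not contained in \<open>Z f\<close>, then \<open>f\<close> is not in the ideal generated by \<open>g\<close>, and some prime
  over that ideal omits \<open>f\<close> but not \<open>g\<close>.
\<close>

lemma basic_open_subset_iff:
  assumes e: "inj e" and fg: "mcnaughton K f" "mcnaughton K g"
  shows "basic_open e (Free K) f \<subseteq> basic_open e (Free K) g \<longleftrightarrow> zero_set K g \<subseteq> zero_set K f"
proof
  assume "zero_set K g \<subseteq> zero_set K f"
  then show "basic_open e (Free K) f \<subseteq> basic_open e (Free K) g"
    using mv_ideal_FreeD(2)[OF mv_prime_FreeD(1) _ fg(1)] unfolding basic_open_def by (intro image_mono) blast
next
  assume sub: "basic_open e (Free K) f \<subseteq> basic_open e (Free K) g"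
  show "zero_set K g \<subseteq> zero_set K f"
  proof (rule ccontr)
    assume no: "\<not> zero_set K g \<subseteq> zero_set K f"
    define J where "J = {h. mcnaughton K h \<and> zero_set K g \<subseteq> zero_set K h}"
    have J: "mv_ideal (Free K) J" unfolding mv_ideal_Free_iff
      using fg by (auto simp: J_def zero_set_plus mcnaughton_Free_plus)
    have "f \<notin> J" using no by (simp add: J_def)
    from prime_ideal_extension[OF J fg(1) this] obtain P
      where P: "mv_prime (Free K) P" "J \<subseteq> P" "f \<notin> P" by blast
    then have "g \<in> P" using fg by (auto simp: J_def)
    then have "e P \<notin> basic_open e (Free K) g" using e by (auto simp: basic_open_def dest: injD)
    then show False using sub P by (auto simp: basic_open_def)
  qed
qed

lemma openin_spectrum:
  assumes e: "inj e"
  shows "openin (spectrum e (Free K)) U \<longleftrightarrow>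
    (\<forall>x\<in>U. \<exists>f. mcnaughton K f \<and> x \<in> basic_open e (Free K) f \<and> basic_open e (Free K) f \<subseteq> U)"
proof -
  have "istopology (arbitrary union_of (\<lambda>U. \<exists>f\<in>mv_carrier (Free K). U = basic_open e (Free K) f))"
  proof (rule istopology_base)
    fix S T assume "\<exists>f\<in>mv_carrier (Free K). S = basic_open e (Free K) f" "\<exists>f\<in>mv_carrier (Free K). T = basic_open e (Free K) f"
    then obtain f g where "mcnaughton K f" "mcnaughton K g" "S = basic_open e (Free K) f" "T = basic_open e (Free K) g"
      by (auto simp: mv_carrier_Free)
    then show "\<exists>f\<in>mv_carrier (Free K). S \<inter> T = basic_open e (Free K) f"
      unfolding mv_carrier_Free Bex_def
      using basic_open_inf[OF e] mcnaughton_inf by (intro exI[of _ "mv_inf (Free K) f g"]) simp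
  qed
  then have "openin (spectrum e (Free K)) U \<longleftrightarrow>
      (\<forall>x\<in>U. \<exists>V. (\<exists>f. mcnaughton K f \<and> V = basic_open e (Free K) f) \<and> x \<in> V \<and> V \<subseteq> U)"
    by (simp add: spectrum_def topology_inverse' arbitrary_union_of_alt Bex_def mv_carrier_Free)
  also have "\<dots> \<longleftrightarrow> (\<forall>x\<in>U. \<exists>f. mcnaughton K f \<and> x \<in> basic_open e (Free K) f \<and> basic_open e (Free K) f \<subseteq> U)"
    by (intro ball_cong refl) auto
  finally show ?thesis .
qed

lemma topspace_spectrum:
  assumes e: "inj e"
  shows "topspace (spectrum e (Free K)) = e ` {P. mv_prime (Free K) P}"
proof
  show "topspace (spectrum e (Free K)) \<subseteq> e ` {P. mv_prime (Free K) P}"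
    using openin_topspace[of "spectrum e (Free K)"] unfolding openin_spectrum[OF e] by (auto simp: basic_open_def)
  have "openin (spectrum e (Free K)) (e ` {P. mv_prime (Free K) P})"
    unfolding openin_spectrum[OF e] basic_open_one[symmetric] using mcnaughton_Free_one by blast
  then show "e ` {P. mv_prime (Free K) P} \<subseteq> topspace (spectrum e (Free K))" by (rule openin_subset)
qed

lemma basic_open_open:
  assumes "inj e" "mcnaughton K f"
  shows "openin (spectrum e (Free K)) (basic_open e (Free K) f)"
  using assms by (auto simp: openin_spectrum)

text \<open>
  The functions \<open>h\<close> for which \<open>D h\<close> has a finite subcover form an ideal.  No prime omitting \<open>f\<close> contains this
  ideal, because the prime lies in a member of the cover and thus in some \<open>D g\<close> inside that member.
  Hence \<open>f\<close> belongs to the ideal.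
\<close>

lemma basic_open_compact:
  assumes e: "inj e" and f: "mcnaughton K f"
  shows "compactin (spectrum e (Free K)) (basic_open e (Free K) f)"
  unfolding compactin_def
proof (intro conjI allI impI)
  show "basic_open e (Free K) f \<subseteq> topspace (spectrum e (Free K))"
    using basic_open_open[OF e f] by (rule openin_subset)
  fix \<U> assume \<U>: "Ball \<U> (openin (spectrum e (Free K))) \<and> basic_open e (Free K) f \<subseteq> \<Union>\<U>"
  define J where "J = {h. mcnaughton K h \<and> (\<exists>\<F>. finite \<F> \<and> \<F> \<subseteq> \<U> \<and> basic_open e (Free K) h \<subseteq> \<Union>\<F>)}"
  have "mv_ideal (Free K) J"
    unfolding mv_ideal_Free_iff
  proof (intro conjI ballI allI impI)
    have "mv_zero (Free K) \<in> J"
      using mcnaughton_Free_zero basic_open_zero[of e K] by (auto simp: J_def intro!: exI[of _ "{}"])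
    then show "J \<noteq> {}" by blast
    fix g assume g: "g \<in> J"
    then show "mcnaughton K g" by (simp add: J_def)
    obtain \<F> where \<F>: "finite \<F>" "\<F> \<subseteq> \<U>" "basic_open e (Free K) g \<subseteq> \<Union>\<F>" using g by (auto simp: J_def)
    fix h
    show "h \<in> J" if h: "mcnaughton K h \<and> zero_set K g \<subseteq> zero_set K h"
    proof -
      have "basic_open e (Free K) h \<subseteq> basic_open e (Free K) g"
        using h g by (simp add: J_def basic_open_subset_iff[OF e])
      then show ?thesis using h \<F> unfolding J_def by blast
    qed
    assume h: "h \<in> J"
    then obtain \<G> where \<G>: "finite \<G>" "\<G> \<subseteq> \<U>" "basic_open e (Free K) h \<subseteq> \<Union>\<G>" by (auto simp: J_def)
    have "basic_open e (Free K) (mv_plus (Free K) g h) \<subseteq> \<Union>(\<F> \<union> \<G>)"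
      using \<F> \<G> g h by (auto simp: J_def basic_open_plus)
    moreover have "finite (\<F> \<union> \<G>)" "\<F> \<union> \<G> \<subseteq> \<U>" using \<F> \<G> by auto
    moreover have "mcnaughton K (mv_plus (Free K) g h)" using g h by (simp add: J_def mcnaughton_Free_plus)
    ultimately show "mv_plus (Free K) g h \<in> J" unfolding J_def by blast
  qed
  moreover have "\<not> J \<subseteq> P" if P: "mv_prime (Free K) P" "f \<notin> P" for P
  proof -
    have "e P \<in> basic_open e (Free K) f" using P by (auto simp: basic_open_def)
    then obtain U where U: "U \<in> \<U>" "e P \<in> U" using \<U> by blast
    then have "openin (spectrum e (Free K)) U" using \<U> by blast
    then obtain g where g: "mcnaughton K g" "e P \<in> basic_open e (Free K) g" "basic_open e (Free K) g \<subseteq> U"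
      using U(2) unfolding openin_spectrum[OF e] by blast
    have "g \<notin> P" using g(2) e by (auto simp: basic_open_def dest: injD)
    moreover have "g \<in> J" using g U(1) by (auto simp: J_def intro!: exI[of _ "{U}"])
    ultimately show ?thesis by blast
  qed
  ultimately have "f \<in> J" using prime_ideal_extension[OF _ f] by blast
  then show "\<exists>\<F>. finite \<F> \<and> \<F> \<subseteq> \<U> \<and> basic_open e (Free K) f \<subseteq> \<Union>\<F>" by (simp add: J_def)
qed

lemma compact_openin_spectrum:
  assumes e: "inj e"
  shows "compact_openin (spectrum e (Free K)) U \<longleftrightarrow> (\<exists>f. mcnaughton K f \<and> U = basic_open e (Free K) f)"
proof
  assume U: "compact_openin (spectrum e (Free K)) U"
  define \<B> where "\<B> = {V. \<exists>f. mcnaughton K f \<and> V = basic_open e (Free K) f \<and> V \<subseteq> U}"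
  have "\<forall>V\<in>\<B>. openin (spectrum e (Free K)) V" using basic_open_open[OF e] by (auto simp: \<B>_def)
  moreover have "U \<subseteq> \<Union>\<B>"
  proof
    fix x assume "x \<in> U"
    then obtain f where "mcnaughton K f" "x \<in> basic_open e (Free K) f" "basic_open e (Free K) f \<subseteq> U"
      using U openin_spectrum[OF e, of K U] by (auto simp: compact_openin_def)
    then show "x \<in> \<Union>\<B>" by (auto simp: \<B>_def)
  qed
  ultimately obtain \<F> where \<F>: "finite \<F>" "\<F> \<subseteq> \<B>" "U \<subseteq> \<Union>\<F>"
    using U unfolding compact_openin_def compactin_def by meson
  have "\<exists>f. mcnaughton K f \<and> \<Union>\<F> = basic_open e (Free K) f"
    using \<F>(1,2)
  proof (induction \<F> rule: finite_induct)
    case empty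
    show ?case using mcnaughton_Free_zero basic_open_zero[of e K] by (intro exI[of _ "mv_zero (Free K)"]) simp
  next
    case (insert V \<F>)
    obtain f where f: "mcnaughton K f" "\<Union>\<F> = basic_open e (Free K) f" using insert by auto
    obtain g where g: "mcnaughton K g" "V = basic_open e (Free K) g" using insert.prems by (auto simp: \<B>_def)
    show ?case using f g mcnaughton_Free_plus[OF g(1) f(1)] basic_open_plus[OF g(1) f(1), of e]
      by (intro exI[of _ "mv_plus (Free K) g f"]) simp
  qed
  moreover have "U = \<Union>\<F>" using \<F> by (auto simp: \<B>_def)
  ultimately show "\<exists>f. mcnaughton K f \<and> U = basic_open e (Free K) f" by simp
qed (use basic_open_open[OF e] basic_open_compact[OF e] in \<open>auto simp: compact_openin_def\<close>)

lemma ideal_hull_closed: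
  assumes e: "inj e" and I: "mv_ideal (Free K) I"
  shows "closedin (spectrum e (Free K)) (ideal_hull e (Free K) I)"
proof -
  have "ideal_hull e (Free K) I = topspace (spectrum e (Free K)) - \<Union>(basic_open e (Free K) ` I)"
    unfolding topspace_spectrum[OF e] ideal_hull_def basic_open_def using e by (auto dest: injD)
  moreover have "openin (spectrum e (Free K)) (\<Union>(basic_open e (Free K) ` I))"
    using basic_open_open[OF e] mv_ideal_FreeD(1)[OF I] by (intro openin_Union) auto
  ultimately show ?thesis by (simp add: closedin_diff)
qed

text \<open>
  The ideal consists of the functions that belong to every prime in \<open>S\<close>.
\<close>

lemma closed_is_ideal_hull:
  assumes e: "inj e" and S: "closedin (spectrum e (Free K)) S"
  defines "I \<equiv> {f. mcnaughton K f \<and> S \<inter> basic_open e (Free K) f = {}}"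
  shows "mv_ideal (Free K) I" "S = ideal_hull e (Free K) I"
proof -
  show "mv_ideal (Free K) I"
    unfolding mv_ideal_Free_iff
  proof (intro conjI ballI allI impI)
    show "I \<noteq> {}" using mcnaughton_Free_zero basic_open_zero[of e K] by (auto simp: I_def)
    fix f assume f: "f \<in> I"
    then show "mcnaughton K f" by (simp add: I_def)
    fix g
    show "g \<in> I" if g: "mcnaughton K g \<and> zero_set K f \<subseteq> zero_set K g"
    proof -
      have "basic_open e (Free K) g \<subseteq> basic_open e (Free K) f"
        using f g by (simp add: I_def basic_open_subset_iff[OF e])
      then show ?thesis using f g by (auto simp: I_def)
    qed
    assume "g \<in> I"
    then show "mv_plus (Free K) f g \<in> I"
      using f by (auto simp: I_def mcnaughton_Free_plus basic_open_plus)
  qed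
  show "S = ideal_hull e (Free K) I"
  proof
    show "S \<subseteq> ideal_hull e (Free K) I"
    proof
      fix x assume x: "x \<in> S"
      then obtain P where P: "mv_prime (Free K) P" "x = e P"
        using closedin_subset[OF S] unfolding topspace_spectrum[OF e] by blast
      have "I \<subseteq> P" using x P by (auto simp: I_def basic_open_def)
      then show "x \<in> ideal_hull e (Free K) I" using P by (auto simp: ideal_hull_def)
    qed
    show "ideal_hull e (Free K) I \<subseteq> S"
    proof
      fix x assume "x \<in> ideal_hull e (Free K) I"
      then obtain P where P: "mv_prime (Free K) P" "I \<subseteq> P" "x = e P" by (auto simp: ideal_hull_def)
      show "x \<in> S"
      proof (rule ccontr)
        assume "x \<notin> S"
        then have "x \<in> topspace (spectrum e (Free K)) - S" using P topspace_spectrum[OF e, of K] by blast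
        moreover have "openin (spectrum e (Free K)) (topspace (spectrum e (Free K)) - S)" using S by blast
        ultimately obtain f where f: "mcnaughton K f" "x \<in> basic_open e (Free K) f"
          "basic_open e (Free K) f \<subseteq> topspace (spectrum e (Free K)) - S"
          unfolding openin_spectrum[OF e] by blast
        have "f \<in> I" using f by (auto simp: I_def)
        moreover have "f \<notin> P" using f(2) P(3) e by (auto simp: basic_open_def dest: injD)
        ultimately show False using P(2) by blast
      qed
    qed
  qed
qed

lemma closure_of_point_spectrum:
  assumes e: "inj e" and P: "mv_prime (Free K) P"
  shows "spectrum e (Free K) closure_of {e P} = ideal_hull e (Free K) P"
proof (rule closure_of_unique)
  show "{e P} \<subseteq> ideal_hull e (Free K) P" using P by (auto simp: ideal_hull_def)
  show "closedin (spectrum e (Free K)) (ideal_hull e (Free K) P)"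
    by (rule ideal_hull_closed[OF e mv_prime_FreeD(1)[OF P]])
  fix T assume T: "{e P} \<subseteq> T" "closedin (spectrum e (Free K)) T"
  have "e P \<in> ideal_hull e (Free K) {f. mcnaughton K f \<and> T \<inter> basic_open e (Free K) f = {}}"
    using closed_is_ideal_hull(2)[OF e T(2)] T(1) by blast
  then have "{f. mcnaughton K f \<and> T \<inter> basic_open e (Free K) f = {}} \<subseteq> P"
    using e by (auto simp: ideal_hull_def dest: injD)
  then have "ideal_hull e (Free K) P \<subseteq> ideal_hull e (Free K) {f. mcnaughton K f \<and> T \<inter> basic_open e (Free K) f = {}}"
    unfolding ideal_hull_def by blast
  then show "ideal_hull e (Free K) P \<subseteq> T" using closed_is_ideal_hull(2)[OF e T(2)] by simp
qed

text \<open>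
  The generic point of an irreducible closed set is the intersection of its primes: irreducibility is
  exactly primeness of this intersection.
\<close>

lemma sober_spectrum:
  assumes e: "inj e"
  shows "sober_space (spectrum e (Free K))"
  unfolding sober_space_def
proof (intro allI impI)
  let ?X = "spectrum e (Free K)"
  fix S assume S: "irreducible_closedin ?X S"
  then have Sc: "closedin ?X S" by (simp add: irreducible_closedin_def)
  define P where "P = {f. mcnaughton K f \<and> S \<inter> basic_open e (Free K) f = {}}"
  have Pi: "mv_ideal (Free K) P" "S = ideal_hull e (Free K) P"
    using closed_is_ideal_hull[OF e Sc] by (simp_all add: P_def)
  have SX: "S \<subseteq> topspace ?X" using Sc by (rule closedin_subset)
  have irr: "S = A \<or> S = B" if "closedin ?X A \<and> closedin ?X B \<and> S = A \<union> B" for A B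
    using S that unfolding irreducible_closedin_def by metis
  have "mv_prime (Free K) P"
    unfolding mv_prime_def
  proof (intro conjI ballI impI Pi(1))
    have "S \<noteq> {}" using S by (simp add: irreducible_closedin_def)
    moreover have "S \<subseteq> basic_open e (Free K) (mv_neg (Free K) (mv_zero (Free K)))"
      using SX by (simp only: topspace_spectrum[OF e] basic_open_one)
    ultimately show "mv_neg (Free K) (mv_zero (Free K)) \<notin> P" by (simp add: P_def Int_absorb2)
    fix f g assume fg: "f \<in> mv_carrier (Free K)" "g \<in> mv_carrier (Free K)" "mv_inf (Free K) f g \<in> P"
    then have mcn: "mcnaughton K f" "mcnaughton K g" by (simp_all add: mv_carrier_Free)
    have disj: "S \<inter> (basic_open e (Free K) f \<inter> basic_open e (Free K) g) = {}"
      using fg(3) basic_open_inf[OF e mcn] by (simp add: P_def)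
    have "closedin ?X (S - basic_open e (Free K) f)" "closedin ?X (S - basic_open e (Free K) g)"
      using Sc basic_open_open[OF e] mcn by (auto intro: closedin_diff)
    moreover have "S = (S - basic_open e (Free K) f) \<union> (S - basic_open e (Free K) g)" using disj by blast
    ultimately have "S = S - basic_open e (Free K) f \<or> S = S - basic_open e (Free K) g"
      by (intro irr conjI)
    then have "S \<inter> basic_open e (Free K) f = {} \<or> S \<inter> basic_open e (Free K) g = {}" by blast
    then show "f \<in> P \<or> g \<in> P" using mcn by (simp add: P_def)
  qed
  then have P: "mv_prime (Free K) P" "S = ?X closure_of {e P}"
    using closure_of_point_spectrum[OF e] Pi(2) by auto
  show "\<exists>!x. x \<in> topspace ?X \<and> S = ?X closure_of {x}"
  proof (rule ex1I[of _ "e P"])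
    show "e P \<in> topspace ?X \<and> S = ?X closure_of {e P}" using P topspace_spectrum[OF e, of K] by blast
    fix x assume x: "x \<in> topspace ?X \<and> S = ?X closure_of {x}"
    then obtain Q where Q: "mv_prime (Free K) Q" "x = e Q" using topspace_spectrum[OF e, of K] by auto
    have "ideal_hull e (Free K) Q = S" using x Q closure_of_point_spectrum[OF e Q(1)] by simp
    moreover have "S = ideal_hull e (Free K) P" by (rule Pi(2))
    ultimately have "ideal_hull e (Free K) Q = ideal_hull e (Free K) P" by simp
    then have "e P \<in> ideal_hull e (Free K) Q" "e Q \<in> ideal_hull e (Free K) P" using P(1) Q(1) by (auto simp: ideal_hull_def)
    then have "P = Q" using e by (auto simp: ideal_hull_def dest: injD)
    then show "x = e P" using Q by simp
  qed
qed

theorem spectral_spectrum: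
  assumes e: "inj e"
  shows "spectral_space (spectrum e (Free K))"
  unfolding spectral_space_def
proof (intro conjI allI impI)
  let ?X = "spectrum e (Free K)"
  show "sober_space ?X" by (rule sober_spectrum[OF e])
  show "compact_space ?X"
    unfolding compact_space_def topspace_spectrum[OF e] basic_open_one[symmetric]
    by (rule basic_open_compact[OF e mcnaughton_Free_one])
  show "openin ?X = arbitrary union_of (compact_openin ?X)"
  proof
    fix U
    show "openin ?X U = (arbitrary union_of (compact_openin ?X)) U"
      unfolding arbitrary_union_of_alt compact_openin_spectrum[OF e] openin_spectrum[OF e, of K U] by blast
  qed
  fix U V assume "compact_openin ?X U \<and> compact_openin ?X V"
  then obtain f g where "mcnaughton K f" "U = basic_open e (Free K) f" "mcnaughton K g" "V = basic_open e (Free K) g"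
    unfolding compact_openin_spectrum[OF e] by auto
  then show "compact_openin ?X (U \<inter> V)"
    unfolding compact_openin_spectrum[OF e] using basic_open_inf[OF e] mcnaughton_inf
    by (intro exI[of _ "mv_inf (Free K) f g"]) simp
qed

theorem spectrum_anti_isomorphic_Cypol:
  assumes e: "inj e"
  shows "anti_isomorphic {U. compact_openin (spectrum e (Free K)) U} (Cypol K)"
proof -
  let ?D = "basic_open e (Free K)"
  \<comment> \<open>The zero set of \<open>f\<close> depends only on \<open>D f\<close>, so any representative of \<open>U\<close> will do.\<close>
  define \<phi> where "\<phi> = (\<lambda>U. zero_set K (SOME f. mcnaughton K f \<and> U = ?D f))"
  have \<phi>: "\<phi> (?D f) = zero_set K f" if f: "mcnaughton K f" for f
  proof -
    define g where "g = (SOME g. mcnaughton K g \<and> ?D f = ?D g)"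
    have g: "mcnaughton K g \<and> ?D f = ?D g" unfolding g_def by (rule someI[of _ f]) (use f in simp)
    then have "zero_set K g = zero_set K f"
      using basic_open_subset_iff[OF e f, of g] basic_open_subset_iff[OF e _ f, of g] by auto
    then show ?thesis by (simp add: \<phi>_def g_def)
  qed
  have CO: "{U. compact_openin (spectrum e (Free K)) U} = ?D ` {f. mcnaughton K f}"
    by (auto simp: compact_openin_spectrum[OF e])
  have order: "U \<subseteq> V \<longleftrightarrow> \<phi> V \<subseteq> \<phi> U"
    if UV: "U \<in> ?D ` {f. mcnaughton K f}" "V \<in> ?D ` {f. mcnaughton K f}" for U V
  proof -
    obtain f g where "mcnaughton K f" "U = ?D f" "mcnaughton K g" "V = ?D g" using UV by auto
    then show ?thesis using \<phi> basic_open_subset_iff[OF e, of K f g] by simp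
  qed
  have "inj_on \<phi> (?D ` {f. mcnaughton K f})"
    using order by (intro inj_onI) (metis order_refl subset_antisym)
  moreover have "\<phi> ` ?D ` {f. mcnaughton K f} = zero_set K ` {f. mcnaughton K f}"
    unfolding image_image by (intro image_cong) (auto simp: \<phi>)
  moreover have "zero_set K ` {f. mcnaughton K f} = Cypol K"
    using zero_set_in_Cypol Cypol_zero_set[of _ K] by (auto simp: image_iff) metis
  ultimately have "bij_betw \<phi> (?D ` {f. mcnaughton K f}) (Cypol K)" by (simp add: bij_betw_def)
  then show ?thesis unfolding anti_isomorphic_def CO using order by (intro exI[of _ \<phi>] conjI ballI) auto
qed

section \<open>The functor\<close>

lemma mv_hom_inf:
  assumes A: "mv_algebra A" and h: "h \<in> mv_hom A B" and xy: "x \<in> mv_carrier A" "y \<in> mv_carrier A"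
  shows "h (mv_inf A x y) = mv_inf B (h x) (h y)"
proof -
  have "mv_neg A u \<in> mv_carrier A" "mv_plus A u v \<in> mv_carrier A"
    if "u \<in> mv_carrier A" "v \<in> mv_carrier A" for u v using A that by (auto simp: mv_algebra_def)
  then show ?thesis using h xy by (simp add: mv_hom_def mv_inf_def)
qed

lemma mv_prime_vimage:
  assumes A: "mv_algebra A" and B: "mv_algebra B" and h: "h \<in> mv_hom A B" and P: "mv_prime B P"
  shows "mv_prime A {x \<in> mv_carrier A. h x \<in> P}"
proof -
  note A' = A[unfolded mv_algebra_def] and B' = B[unfolded mv_algebra_def]
  have hc: "h x \<in> mv_carrier B" if "x \<in> mv_carrier A" for x using h that by (auto simp: mv_hom_def)
  have h0: "h (mv_zero A) = mv_zero B" using h by (simp add: mv_hom_def)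
  have hneg: "h (mv_neg A x) = mv_neg B (h x)" if "x \<in> mv_carrier A" for x
    using h that by (simp add: mv_hom_def)
  have hplus: "h (mv_plus A x y) = mv_plus B (h x) (h y)" if "x \<in> mv_carrier A" "y \<in> mv_carrier A" for x y
    using h that by (simp add: mv_hom_def)
  have P': "mv_ideal B P" using P by (simp add: mv_prime_def)
  have down: "x \<in> P" if "y \<in> P" "x \<in> mv_carrier B" "mv_le B x y" for x y
    using P' that unfolding mv_ideal_def by blast
  obtain p where p: "p \<in> P" "p \<in> mv_carrier B" using P' by (auto simp: mv_ideal_def)
  have "mv_le B (mv_zero B) p" using B' p(2) by (simp add: mv_le_def)
  then have "mv_zero B \<in> P" using down[OF p(1)] B' by blast
  then have zero: "mv_zero A \<in> {x \<in> mv_carrier A. h x \<in> P}" using A' h0 by simp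
  have "mv_ideal A {x \<in> mv_carrier A. h x \<in> P}"
    unfolding mv_ideal_def
  proof (intro conjI ballI impI)
    show "{x \<in> mv_carrier A. h x \<in> P} \<noteq> {}" using zero by blast
    fix y assume y: "y \<in> {x \<in> mv_carrier A. h x \<in> P}"
    fix x
    show "x \<in> {x \<in> mv_carrier A. h x \<in> P}" if x: "x \<in> mv_carrier A" "mv_le A x y"
    proof -
      have "mv_neg A x \<in> mv_carrier A" "mv_zero A \<in> mv_carrier A" "y \<in> mv_carrier A"
        using A' x(1) y by auto
      then have "mv_plus B (mv_neg B (h x)) (h y) = h (mv_plus A (mv_neg A x) y)"
        "mv_neg B (mv_zero B) = h (mv_neg A (mv_zero A))"
        using x(1) h0 by (simp_all add: hplus hneg)
      then have "mv_le B (h x) (h y)" using x(2) by (simp add: mv_le_def)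
      then show ?thesis using down[of "h y" "h x"] y x(1) hc by simp
    qed
    show "mv_plus A y x \<in> {x \<in> mv_carrier A. h x \<in> P}" if "x \<in> {x \<in> mv_carrier A. h x \<in> P}"
      using that y A' P' by (simp add: hplus mv_ideal_def)
  qed auto
  moreover have "mv_neg A (mv_zero A) \<notin> {x \<in> mv_carrier A. h x \<in> P}"
    using P A' hneg h0 by (simp add: mv_prime_def)
  moreover have "x \<in> {x \<in> mv_carrier A. h x \<in> P} \<or> y \<in> {x \<in> mv_carrier A. h x \<in> P}"
    if "x \<in> mv_carrier A" "y \<in> mv_carrier A" "mv_inf A x y \<in> {x \<in> mv_carrier A. h x \<in> P}" for x y
    using P that mv_hom_inf[OF A h that(1,2)] hc unfolding mv_prime_def by auto
  ultimately show ?thesis unfolding mv_prime_def by blast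
qed

text \<open>
  Preimages of primes under \<open>h\<close>, on the names of points.
\<close>

definition spectrum_map :: "('a set \<Rightarrow> 'p) \<Rightarrow> 'a mv \<Rightarrow> ('a \<Rightarrow> 'a) \<Rightarrow> 'p \<Rightarrow> 'p" where
  "spectrum_map e A h x = e {f \<in> mv_carrier A. h f \<in> inv e x}"

definition context_of ::
  "((('u \<Rightarrow> real) \<Rightarrow> real) set \<Rightarrow> 'p) \<Rightarrow> (('u \<Rightarrow> real) \<Rightarrow> real) presented \<Rightarrow> 'p in_context" where
  "context_of e = (\<lambda>(F, I).
     (spectrum e F, subtopology (spectrum e F) (ideal_hull e F I), \<lambda>x\<in>ideal_hull e F I. x))"

definition context_map ::
  "((('u \<Rightarrow> real) \<Rightarrow> real) set \<Rightarrow> 'p) \<Rightarrow> (('u \<Rightarrow> real) \<Rightarrow> real) presented \<Rightarrow>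
   (('u \<Rightarrow> real) \<Rightarrow> real) presented \<Rightarrow> ((('u \<Rightarrow> real) \<Rightarrow> real) \<Rightarrow> ('u \<Rightarrow> real) \<Rightarrow> real) \<Rightarrow>
   ('p \<Rightarrow> 'p) \<times> ('p \<Rightarrow> 'p)" where
  "context_map e = (\<lambda>(F, I) (G, J) h.
     (restrict (spectrum_map e F h) (topspace (spectrum e G)),
      restrict (spectrum_map e F h) (ideal_hull e G J)))"

lemma spectrum_map_point: "inj e \<Longrightarrow> spectrum_map e A h (e P) = e {f \<in> mv_carrier A. h f \<in> P}"
  by (simp add: spectrum_map_def inv_f_f)

lemma ideal_hull_topspace: "inj e \<Longrightarrow> ideal_hull e (Free K) I \<subseteq> topspace (spectrum e (Free K))"
  by (auto simp: topspace_spectrum ideal_hull_def)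

lemma spectrum_map_topspace:
  assumes e: "inj e" and h: "h \<in> mv_hom (Free K) (Free L)" and x: "x \<in> topspace (spectrum e (Free L))"
  shows "spectrum_map e (Free K) h x \<in> topspace (spectrum e (Free K))"
  using x mv_prime_vimage[OF mv_algebra_Free mv_algebra_Free h]
  by (auto simp: topspace_spectrum[OF e] spectrum_map_point[OF e])

lemma spectrum_map_ideal_hull:
  assumes e: "inj e" and h: "h \<in> mv_hom (Free K) (Free L)" and I: "mv_ideal (Free K) I" "h ` I \<subseteq> J"
    and x: "x \<in> ideal_hull e (Free L) J"
  shows "spectrum_map e (Free K) h x \<in> ideal_hull e (Free K) I"
proof -
  obtain P where P: "mv_prime (Free L) P" "J \<subseteq> P" "x = e P" using x by (auto simp: ideal_hull_def)
  have "I \<subseteq> {f \<in> mv_carrier (Free K). h f \<in> P}"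
    using I P(2) by (auto simp: mv_ideal_def)
  then show ?thesis
    using mv_prime_vimage[OF mv_algebra_Free mv_algebra_Free h P(1)]
    by (simp add: P(3) spectrum_map_point[OF e] ideal_hull_def)
qed

text \<open>
  The reason why the map of spectra is spectral, as the compact open sets are the basic ones.
\<close>

lemma spectrum_map_basic_open:
  assumes e: "inj e" and h: "h \<in> mv_hom (Free K) (Free L)" and f: "mcnaughton K f"
  shows "{x \<in> topspace (spectrum e (Free L)). spectrum_map e (Free K) h x \<in> basic_open e (Free K) f}
    = basic_open e (Free L) (h f)"
proof -
  have "spectrum_map e (Free K) h (e P) \<in> basic_open e (Free K) f \<longleftrightarrow> h f \<notin> P"
    if P: "mv_prime (Free L) P" for P
  proof -
    have "spectrum_map e (Free K) h (e P) \<in> basic_open e (Free K) f \<longleftrightarrow>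
        f \<notin> {f \<in> mv_carrier (Free K). h f \<in> P}"
      using mv_prime_vimage[OF mv_algebra_Free mv_algebra_Free h P] e
      unfolding spectrum_map_point[OF e] basic_open_def by (simp add: inj_image_mem_iff)
    then show ?thesis using f by (simp add: mv_carrier_Free)
  qed
  then show ?thesis unfolding topspace_spectrum[OF e] by (auto simp: basic_open_def[of e "Free L"])
qed

lemma spectrum_map_spectral:
  assumes e: "inj e" and h: "h \<in> mv_hom (Free K) (Free L)"
  shows "restrict (spectrum_map e (Free K) h) (topspace (spectrum e (Free L)))
    \<in> spectral_map (spectrum e (Free L)) (spectrum e (Free K))"
  unfolding spectral_map_def
proof (intro CollectI conjI allI impI)
  show "restrict (spectrum_map e (Free K) h) (topspace (spectrum e (Free L)))
    \<in> topspace (spectrum e (Free L)) \<rightarrow>\<^sub>E topspace (spectrum e (Free K))"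
    using spectrum_map_topspace[OF e h] by simp
  fix U assume "compact_openin (spectrum e (Free K)) U"
  then obtain f where f: "mcnaughton K f" "U = basic_open e (Free K) f"
    unfolding compact_openin_spectrum[OF e] by auto
  have "mcnaughton L (h f)" using h f(1) by (auto simp: mv_hom_def mv_carrier_Free)
  moreover have "{x \<in> topspace (spectrum e (Free L)).
      restrict (spectrum_map e (Free K) h) (topspace (spectrum e (Free L))) x \<in> U} = basic_open e (Free L) (h f)"
    unfolding f(2) spectrum_map_basic_open[OF e h f(1), symmetric] by auto
  ultimately show "compact_openin (spectrum e (Free L)) {x \<in> topspace (spectrum e (Free L)).
      restrict (spectrum_map e (Free K) h) (topspace (spectrum e (Free L))) x \<in> U}"
    unfolding compact_openin_spectrum[OF e] by blast
qed

lemma spectral_map_closed_subspaces: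
  assumes X: "spectral_space X" and Y: "spectral_space Y" and S: "closedin X S" and T: "closedin Y T"
    and s: "restrict s (topspace X) \<in> spectral_map X Y" and sub: "\<And>x. x \<in> S \<Longrightarrow> s x \<in> T"
  shows "restrict s S \<in> spectral_map (subtopology X S) (subtopology Y T)"
proof -
  have SX: "S \<subseteq> topspace X" "T \<subseteq> topspace Y" using S T by (auto dest: closedin_subset)
  then have top: "topspace (subtopology X S) = S" "topspace (subtopology Y T) = T" by auto
  show ?thesis
    unfolding spectral_map_def top
  proof (intro CollectI conjI allI impI)
    show "restrict s S \<in> S \<rightarrow>\<^sub>E T" using sub by simp
    fix U assume "compact_openin (subtopology Y T) U"
    then obtain V where V: "compact_openin Y V" "U = V \<inter> T"
      unfolding compact_openin_closed_subspace[OF Y T] by auto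
    have "compact_openin X {x \<in> topspace X. restrict s (topspace X) x \<in> V}"
      using s V(1) by (simp add: spectral_map_def)
    moreover have "{x \<in> S. restrict s S x \<in> U} = {x \<in> topspace X. restrict s (topspace X) x \<in> V} \<inter> S"
      using SX V(2) sub by auto
    ultimately show "compact_openin (subtopology X S) {x \<in> S. restrict s S x \<in> U}"
      unfolding compact_openin_closed_subspace[OF X S] by blast
  qed
qed

lemma Obj_MVp: "(F, I) \<in> Obj MVp \<longleftrightarrow> (\<exists>K. is_cardinal K \<and> F = Free K \<and> mv_ideal (Free K) I)"
  by (auto simp: MVp_def)

lemma Hom_MVp: "Hom MVp (F, I) (G, J) = {h \<in> mv_hom F G. h ` I \<subseteq> J}"
  by (simp add: MVp_def)

lemma cylinder_based_spectrum:
  fixes K :: "'u set"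
  assumes "inj e" "is_cardinal K"
  shows "cylinder_based TYPE('u) (spectrum e (Free K))"
  using assms spectral_spectrum spectrum_anti_isomorphic_Cypol unfolding cylinder_based_def by blast

lemma topspace_ideal_hull:
  "inj e \<Longrightarrow> topspace (subtopology (spectrum e (Free K)) (ideal_hull e (Free K) I)) = ideal_hull e (Free K) I"
  using ideal_hull_topspace[of e K I] by auto

theorem context_functor:
  fixes e :: "(('u \<Rightarrow> real) \<Rightarrow> real) set \<Rightarrow> 'p"
  assumes e: "inj e"
  shows "contravariant_functor MVp (SIC TYPE('u)) (context_of e) (context_map e)"
  unfolding contravariant_functor_def
proof (intro conjI category_MVp category_SIC ballI; clarify)
  fix F I assume "(F, I) \<in> Obj (MVp :: ((('u \<Rightarrow> real) \<Rightarrow> real) presented, _) cat)"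
  then obtain K where K: "is_cardinal K" "F = Free K" "mv_ideal (Free K) I" unfolding Obj_MVp by blast
  note cl = ideal_hull_closed[OF e K(3)] and sp = spectral_spectrum[OF e, of K]
  show "context_of e (F, I) \<in> Obj (SIC TYPE('u))"
    using cylinder_based_spectrum[OF e K(1)] spectral_closed_subspace[OF sp cl] closed_subspace_inclusion[OF sp cl]
    by (simp add: context_of_def SIC_def K(2))
  have "spectrum_map e (Free K) (\<lambda>f\<in>mv_carrier (Free K). f) x = x" if x: "x \<in> topspace (spectrum e (Free K))" for x
  proof -
    obtain P where P: "mv_prime (Free K) P" "x = e P" using x by (auto simp: topspace_spectrum[OF e])
    have "{f \<in> mv_carrier (Free K). (\<lambda>f\<in>mv_carrier (Free K). f) f \<in> P} = P"
      using P(1) by (auto simp: mv_prime_def mv_ideal_def)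
    then show ?thesis unfolding P(2) spectrum_map_point[OF e] by simp
  qed
  then have "restrict (spectrum_map e (Free K) (\<lambda>f\<in>mv_carrier (Free K). f)) A = (\<lambda>x\<in>A. x)"
    if "A \<subseteq> topspace (spectrum e (Free K))" for A
    using that by (intro restrict_ext) auto
  then show "context_map e (F, I) (F, I) (Id MVp (F, I)) = Id (SIC TYPE('u)) (context_of e (F, I))"
    using ideal_hull_topspace[OF e, of K I] topspace_ideal_hull[OF e, of K I]
    by (simp add: context_map_def context_of_def SIC_def MVp_def K(2))
next
  fix F I G J h
  assume o: "(F, I) \<in> Obj (MVp :: ((('u \<Rightarrow> real) \<Rightarrow> real) presented, _) cat)" "(G, J) \<in> Obj (MVp :: ((('u \<Rightarrow> real) \<Rightarrow> real) presented, _) cat)"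
    and h: "h \<in> Hom MVp (F, I) (G, J)"
  obtain K where K: "F = Free K" "mv_ideal (Free K) I" using o(1) unfolding Obj_MVp by blast
  obtain L where L: "G = Free L" "mv_ideal (Free L) J" using o(2) unfolding Obj_MVp by blast
  have h': "h \<in> mv_hom (Free K) (Free L)" "h ` I \<subseteq> J" using h by (simp_all add: Hom_MVp K L)
  have "restrict (spectrum_map e (Free K) h) (ideal_hull e (Free L) J)
      \<in> spectral_map (subtopology (spectrum e (Free L)) (ideal_hull e (Free L) J))
          (subtopology (spectrum e (Free K)) (ideal_hull e (Free K) I))"
    by (rule spectral_map_closed_subspaces[OF spectral_spectrum[OF e] spectral_spectrum[OF e]
          ideal_hull_closed[OF e L(2)] ideal_hull_closed[OF e K(2)] spectrum_map_spectral[OF e h'(1)]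
          spectrum_map_ideal_hull[OF e h'(1) K(2) h'(2)]])
  moreover have "compose (ideal_hull e (Free L) J) (restrict (spectrum_map e (Free K) h) (topspace (spectrum e (Free L))))
       (\<lambda>x\<in>ideal_hull e (Free L) J. x) =
     compose (ideal_hull e (Free L) J) (\<lambda>x\<in>ideal_hull e (Free K) I. x)
       (restrict (spectrum_map e (Free K) h) (ideal_hull e (Free L) J))"
    unfolding compose_def
  proof (rule restrict_ext)
    fix x assume x: "x \<in> ideal_hull e (Free L) J"
    then have "x \<in> topspace (spectrum e (Free L))" using ideal_hull_topspace[OF e] by blast
    then show "restrict (spectrum_map e (Free K) h) (topspace (spectrum e (Free L))) ((\<lambda>x\<in>ideal_hull e (Free L) J. x) x)
      = (\<lambda>x\<in>ideal_hull e (Free K) I. x) (restrict (spectrum_map e (Free K) h) (ideal_hull e (Free L) J) x)"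
      using x spectrum_map_ideal_hull[OF e h'(1) K(2) h'(2) x] by simp
  qed
  ultimately show "context_map e (F, I) (G, J) h \<in> Hom (SIC TYPE('u)) (context_of e (G, J)) (context_of e (F, I))"
    using spectrum_map_spectral[OF e h'(1)] topspace_ideal_hull[OF e, of L J]
    by (simp add: context_map_def context_of_def SIC_def K(1) L(1))
next
  fix F I G J H N f g
  assume o: "(F, I) \<in> Obj (MVp :: ((('u \<Rightarrow> real) \<Rightarrow> real) presented, _) cat)" "(G, J) \<in> Obj (MVp :: ((('u \<Rightarrow> real) \<Rightarrow> real) presented, _) cat)"
      "(H, N) \<in> Obj (MVp :: ((('u \<Rightarrow> real) \<Rightarrow> real) presented, _) cat)"
    and f: "f \<in> Hom MVp (F, I) (G, J)" and g: "g \<in> Hom MVp (G, J) (H, N)"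
  obtain K where K: "F = Free K" "mv_ideal (Free K) I" using o(1) unfolding Obj_MVp by blast
  obtain L where L: "G = Free L" "mv_ideal (Free L) J" using o(2) unfolding Obj_MVp by blast
  obtain M where M: "H = Free M" "mv_ideal (Free M) N" using o(3) unfolding Obj_MVp by blast
  have f': "f \<in> mv_hom (Free K) (Free L)" "f ` I \<subseteq> J" using f by (simp_all add: Hom_MVp K L)
  have g': "g \<in> mv_hom (Free L) (Free M)" "g ` J \<subseteq> N" using g by (simp_all add: Hom_MVp L M)
  have fc: "f u \<in> mv_carrier (Free L)" if "u \<in> mv_carrier (Free K)" for u
    using f'(1) that by (auto simp: mv_hom_def)
  have eq: "spectrum_map e (Free K) (compose (mv_carrier (Free K)) g f) x =
      spectrum_map e (Free K) f (spectrum_map e (Free L) g x)" if x: "x \<in> topspace (spectrum e (Free M))" for x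
  proof -
    obtain P where P: "x = e P" using x by (auto simp: topspace_spectrum[OF e])
    have "{u \<in> mv_carrier (Free K). compose (mv_carrier (Free K)) g f u \<in> P}
      = {u \<in> mv_carrier (Free K). f u \<in> {v \<in> mv_carrier (Free L). g v \<in> P}}"
      using fc by (auto simp: compose_def)
    then show ?thesis unfolding P spectrum_map_point[OF e] by simp
  qed
  have "restrict (spectrum_map e (Free K) (compose (mv_carrier (Free K)) g f)) (topspace (spectrum e (Free M))) =
    compose (topspace (spectrum e (Free M))) (restrict (spectrum_map e (Free K) f) (topspace (spectrum e (Free L))))
      (restrict (spectrum_map e (Free L) g) (topspace (spectrum e (Free M))))"
    unfolding compose_def[of "topspace (spectrum e (Free M))"]
    by (rule restrict_ext) (simp add: eq spectrum_map_topspace[OF e g'(1)])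
  moreover have "restrict (spectrum_map e (Free K) (compose (mv_carrier (Free K)) g f)) (ideal_hull e (Free M) N) =
    compose (ideal_hull e (Free M) N) (restrict (spectrum_map e (Free K) f) (ideal_hull e (Free L) J))
      (restrict (spectrum_map e (Free L) g) (ideal_hull e (Free M) N))"
    unfolding compose_def[of "ideal_hull e (Free M) N"]
  proof (rule restrict_ext)
    fix x assume x: "x \<in> ideal_hull e (Free M) N"
    then have "x \<in> topspace (spectrum e (Free M))" using ideal_hull_topspace[OF e] by blast
    then show "spectrum_map e (Free K) (compose (mv_carrier (Free K)) g f) x =
      restrict (spectrum_map e (Free K) f) (ideal_hull e (Free L) J)
       (restrict (spectrum_map e (Free L) g) (ideal_hull e (Free M) N) x)"
      using x spectrum_map_ideal_hull[OF e g'(1) L(2) g'(2) x] by (simp add: eq)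
  qed
  ultimately show "context_map e (F, I) (H, N) (Comp MVp (F, I) (G, J) (H, N) g f) =
      Comp (SIC TYPE('u)) (context_of e (H, N)) (context_of e (G, J)) (context_of e (F, I))
        (context_map e (F, I) (G, J) f) (context_map e (G, J) (H, N) g)"
    using topspace_ideal_hull[OF e, of M N]
    by (simp add: context_map_def context_of_def SIC_def MVp_def K(1) L(1) M(1))
qed

lemma mv_prime_at_point:
  assumes z: "z \<in> cube K"
  shows "mv_prime (Free K) {f. mcnaughton K f \<and> z \<in> zero_set K f}" (is "mv_prime _ ?P")
proof -
  have "mv_zero (Free K) \<in> ?P" using z by (simp add: zero_set_zero mcnaughton_Free_zero)
  then have "mv_ideal (Free K) ?P"
    unfolding mv_ideal_Free_iff by (intro conjI ballI allI impI) (auto simp: zero_set_plus mcnaughton_Free_plus)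
  then show ?thesis
    using z by (auto simp: mv_prime_def mv_carrier_Free zero_set_inf zero_set_one)
qed

text \<open>
  Suppose that \<open>i\<close> is in \<open>K\<close> but not in \<open>L\<close>.  A point of \<open>cube K\<close> whose \<open>i\<close>-th coordinate is not \<open>undefined\<close> lies
  outside \<open>cube L\<close>, so every McNaughton function over \<open>L\<close> takes the value \<open>undefined\<close> there.  It is enough
  to find a function in some prime of \<open>Free K\<close> with another value at such a point.
\<close>

lemma spectrum_determines_exponent:
  fixes K L :: "'u set"
  assumes eq: "{P. mv_prime (Free K) P} = {P. mv_prime (Free L) P}"
  shows "K \<subseteq> L"
proof
  fix i assume i: "i \<in> K"
  show "i \<in> L"
  proof (rule ccontr)
    assume iL: "i \<notin> L"
    \<comment> \<open>If \<open>undefined\<close> is \<open>0\<close>, a function that vanishes only where the \<open>i\<close>-th coordinate does is used at a point where that coordinate is \<open>1\<close>; otherwise it is used at a point where the coordinate is \<open>0\<close>.\<close>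
    define r :: real where "r = (if undefined = (0::real) then 1 else 0)"
    define x where "x = (\<lambda>j\<in>K. if j = i then r else 0)"
    define z where "z = (\<lambda>j\<in>K. 0 :: real)"
    have r: "r \<noteq> undefined" by (simp add: r_def)
    have x: "x \<in> cube K" by (auto simp: x_def cube_def r_def)
    have z: "z \<in> cube K" by (auto simp: z_def cube_def)
    have "x i \<noteq> undefined" using i r by (simp add: x_def)
    then have xL: "x \<notin> cube L" using iL by (auto simp: cube_def PiE_def extensional_def)
    obtain f where f: "mcnaughton K f" "zero_set K f = {x \<in> cube K. x i \<le> 0}"
    proof -
      have "{i} \<subseteq> K" using i by simp
      then obtain f where "mcnaughton K f"
        "zero_set K f = {x \<in> cube K. affine_form {i} (\<lambda>_. 1, 0) x \<le> 0}"
        using mcnaughton_half_space[of "{i}" K "(\<lambda>_. 1, 0)"] by auto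
      then show thesis using that by (simp add: affine_form_def)
    qed
    have "z \<in> zero_set K f" using z i by (simp add: f(2) z_def)
    then have "f \<in> {f. mcnaughton K f \<and> z \<in> zero_set K f}" using f(1) by simp
    moreover have "mv_prime (Free L) {f. mcnaughton K f \<and> z \<in> zero_set K f}"
      using mv_prime_at_point[OF z] eq by blast
    ultimately have "mcnaughton L f" using mv_ideal_FreeD(1)[OF mv_prime_FreeD(1)] by blast
    then have "f x = undefined" using xL by (intro extensional_arb[OF mcnaughton_extensional])
    moreover have "f x = 0 \<longleftrightarrow> r \<le> 0"
    proof -
      have "f x = 0 \<longleftrightarrow> x \<in> zero_set K f" using x by (simp add: zero_set_def)
      also have "\<dots> \<longleftrightarrow> r \<le> 0" using x i by (simp add: f(2) x_def)
      finally show ?thesis .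
    qed
    ultimately show False using r by (auto simp: r_def split: if_splits)
  qed
qed

lemma ideal_is_intersection_of_primes:
  assumes "mv_ideal (Free K) I"
  shows "I = {f. mcnaughton K f \<and> (\<forall>P. mv_prime (Free K) P \<and> I \<subseteq> P \<longrightarrow> f \<in> P)}"
  using mv_ideal_FreeD(1)[OF assms] prime_ideal_extension[OF assms] by blast

theorem context_of_inj:
  fixes e :: "(('u \<Rightarrow> real) \<Rightarrow> real) set \<Rightarrow> 'p"
  assumes e: "inj e"
  shows "inj_on (context_of e) (Obj MVp)"
proof (rule inj_onI; clarify)
  fix F I G J
  assume o: "(F, I) \<in> Obj (MVp :: ((('u \<Rightarrow> real) \<Rightarrow> real) presented, _) cat)" "(G, J) \<in> Obj (MVp :: ((('u \<Rightarrow> real) \<Rightarrow> real) presented, _) cat)"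
    and eq: "context_of e (F, I) = context_of e (G, J)"
  obtain K where K: "F = Free K" "mv_ideal (Free K) I" using o(1) unfolding Obj_MVp by blast
  obtain L where L: "G = Free L" "mv_ideal (Free L) J" using o(2) unfolding Obj_MVp by blast
  have eqs: "spectrum e (Free K) = spectrum e (Free L)"
    "subtopology (spectrum e (Free K)) (ideal_hull e (Free K) I) = subtopology (spectrum e (Free L)) (ideal_hull e (Free L) J)"
  proof -
    have *: "spectrum e (Free K) = spectrum e (Free L) \<and>
      subtopology (spectrum e (Free K)) (ideal_hull e (Free K) I) =
        subtopology (spectrum e (Free L)) (ideal_hull e (Free L) J) \<and>
      (\<lambda>x\<in>ideal_hull e (Free K) I. x) = (\<lambda>x\<in>ideal_hull e (Free L) J. x)"
      using eq unfolding context_of_def K L prod.case prod.inject .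
    show "spectrum e (Free K) = spectrum e (Free L)" by (rule conjunct1[OF *])
    show "subtopology (spectrum e (Free K)) (ideal_hull e (Free K) I) =
        subtopology (spectrum e (Free L)) (ideal_hull e (Free L) J)"
      by (rule conjunct1[OF conjunct2[OF *]])
  qed
  have "e ` {P. mv_prime (Free K) P} = e ` {P. mv_prime (Free L) P}"
    using arg_cong[OF eqs(1), of topspace] unfolding topspace_spectrum[OF e] .
  then have "{P. mv_prime (Free K) P} = {P. mv_prime (Free L) P}" using e by (simp only: inj_image_eq_iff)
  then have KL: "K = L" using spectrum_determines_exponent[of K L] spectrum_determines_exponent[of L K] by blast
  have "ideal_hull e (Free K) I = ideal_hull e (Free L) J"
    using arg_cong[OF eqs(2), of topspace] unfolding topspace_ideal_hull[OF e] .
  then have "{P. mv_prime (Free K) P \<and> I \<subseteq> P} = {P. mv_prime (Free K) P \<and> J \<subseteq> P}"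
    using e by (simp only: ideal_hull_def KL inj_image_eq_iff)
  then have same: "mv_prime (Free K) P \<and> I \<subseteq> P \<longleftrightarrow> mv_prime (Free K) P \<and> J \<subseteq> P" for P by blast
  have "I = {f. mcnaughton K f \<and> (\<forall>P. mv_prime (Free K) P \<and> I \<subseteq> P \<longrightarrow> f \<in> P)}"
    by (rule ideal_is_intersection_of_primes[OF K(2)])
  also have "\<dots> = {f. mcnaughton K f \<and> (\<forall>P. mv_prime (Free K) P \<and> J \<subseteq> P \<longrightarrow> f \<in> P)}"
    unfolding same ..
  also have "\<dots> = J" using ideal_is_intersection_of_primes[OF L(2)] KL by simp
  finally show "F = G \<and> I = J" using K L KL by simp
qed

theorem context_of_surj:
  fixes e :: "(('u \<Rightarrow> real) \<Rightarrow> real) set \<Rightarrow> 'p"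
  assumes e: "inj e" and Z: "Z \<in> Obj (SIC TYPE('u))"
  shows "\<exists>A\<in>Obj MVp. isomorphic_in (SIC TYPE('u)) (context_of e A) Z"
proof -
  obtain Y C m where Zeq: "Z = (Y, C, m)" by (cases Z)
  have Zobj: "(Y, C, m) \<in> Obj (SIC TYPE('u))" using Z by (simp only: Zeq)
  then have "cylinder_based TYPE('u) Y" by (simp add: SIC_def)
  then obtain K :: "'u set" where K: "is_cardinal K" "anti_isomorphic {U. compact_openin Y U} (Cypol K)"
    and Y: "spectral_space Y" by (auto simp: cylinder_based_def)
  let ?X = "spectrum e (Free K)"
  obtain \<phi> where \<phi>: "bij_betw \<phi> {U. compact_openin ?X U} {V. compact_openin Y V}"
    "\<forall>U\<in>{U. compact_openin ?X U}. \<forall>V\<in>{U. compact_openin ?X U}. \<phi> U \<subseteq> \<phi> V \<longleftrightarrow> U \<subseteq> V"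
    using anti_isomorphic_compose[OF spectrum_anti_isomorphic_Cypol[OF e] K(2)] by auto
  have "\<exists>s\<in>spectral_map ?X Y. \<exists>s'\<in>spectral_map Y ?X.
      (\<forall>x\<in>topspace ?X. s' (s x) = x) \<and> (\<forall>y\<in>topspace Y. s (s' y) = y)"
    by (rule spectral_homeomorphism[OF spectral_spectrum[OF e] Y \<phi>(1)]) (use \<phi>(2) in simp)
  then obtain s s' where s: "s \<in> spectral_map ?X Y" "s' \<in> spectral_map Y ?X"
    "\<And>x. x \<in> topspace ?X \<Longrightarrow> s' (s x) = x" "\<And>y. y \<in> topspace Y \<Longrightarrow> s (s' y) = y" by blast
  define S where "S = {x \<in> topspace ?X. s x \<in> m ` topspace C}"
  note iso = SIC_isomorphic_closed_subspace[OF cylinder_based_spectrum[OF e K(1)] Zobj s, folded S_def]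
  obtain I where I: "mv_ideal (Free K) I" "S = ideal_hull e (Free K) I"
    using closed_is_ideal_hull[OF e iso(1)] by blast
  have "(Free K, I) \<in> Obj MVp" using K(1) I(1) by (auto simp: Obj_MVp)
  moreover have "isomorphic_in (SIC TYPE('u)) (context_of e (Free K, I)) Z"
    using iso(2) by (simp add: context_of_def Zeq I(2))
  ultimately show ?thesis by blast
qed

theorem theorem5p4:
  assumes universe: "\<exists>e :: (('u \<Rightarrow> real) \<Rightarrow> real) set \<Rightarrow> 'p. inj e"
  shows "\<exists>(\<alpha>\<^sub>o :: (('u \<Rightarrow> real) \<Rightarrow> real) presented \<Rightarrow> 'p in_context) \<alpha>\<^sub>m.
           contravariant_functor MVp (SIC TYPE('u)) \<alpha>\<^sub>o \<alpha>\<^sub>m \<and>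
           inj_on \<alpha>\<^sub>o (Obj MVp) \<and>
           (\<forall>Z \<in> Obj (SIC TYPE('u)). \<exists>A \<in> Obj MVp. isomorphic_in (SIC TYPE('u)) (\<alpha>\<^sub>o A) Z)"
proof -
  obtain e :: "(('u \<Rightarrow> real) \<Rightarrow> real) set \<Rightarrow> 'p" where e: "inj e" using universe by blast
  show ?thesis
    by (intro exI[of _ "context_of e"] exI[of _ "context_map e"] conjI ballI
        context_functor[OF e] context_of_inj[OF e] context_of_surj[OF e])
qed

end
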